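(* Let $\gamma,F,c,(b_m)_{m\in\mathbb Z},w$ satisfy the general assumptions (see context). Assume there exist constants $N\in\mathbb N$, $c_0>0$, $C_0>1$ and a map $\{q\in\mathbb R^N:|q|\le c_0\}\to\mathcal L_{0,w}$, $q\mapsto u(q)$, such that: (1) for all $|q|\le c_0$: $\|u(q)\|_{0,w}\le c_1$ and $\rho_{u(q)}\le \frac{c_1}{4}$, where $c_1:=\min\left(\frac{1}{4C_KC_{F,c}},\frac{\rho_{F,c}}{8}\right)$; (2) $q\mapsto u(q)$ is a $C^1$ map from $\{q\in\mathbb R^N:|q|\le c_0\}$ to $\mathcal L_{-\sigma_1,w}$, and $\left\|\frac{\partial}{\partial q_j}u(q)\right\|_{-\sigma_1,w}\le C_0$ for all $|q|\le c_0$, $1\le j\le N$; (3) for all $|q|\le c_0$, $n\ge0$, $m\in\mathbb Z$: $u(q)(n,-m)=\overline{u(q)(n,m)}$. Then for all $(q,\epsilon)\in\mathbb R^{N+1}$ with $|q|,|\epsilon|\le\min\left(c_0,\frac{c_1}{4C_0}\right)$ there exists a unique $v\in\mathcal L_{\sigma_0,w}$ with the following properties (i)-(iii): (i) for all $m\in\mathbb Z$, $n\ge1$: $v(n-1,m)+\delta_mv(n,m)+v(n+1,m)+W(u(q),v)(n,m)=0$; (ii) $\|v\|_{\sigma_0,w}\le2(\rho_{u(q)}+|\epsilon|)\le c_1\le\frac{\rho_{F,c}}{8}$; (iii) for all $|m|>m_0$: $v(0,m)=\epsilon b_m-u(q)(0,m)$. Furthermore: (iv) for all $n\ge0$ and $m\in\mathbb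 Z$: $v(n,-m)=\overline{v(n,m)}$; (v) the map $(q,\epsilon)\mapsto v$ is a $C^1$ map into $\mathcal L_{\sigma_1,w}$.
   Context: **General assumptions.** $c\in\mathbb R$; $F:\mathbb R\to\mathbb R$ is real analytic in a neighborhood of $-c$ with $F'(-c)>0$; $\gamma>0$ with $\frac{(m\gamma)^2}{F'(-c)}\ne4$ for all $m\in\mathbb Z$; $w:\mathbb Z\to\mathbb R$ is an admissible weight function, i.e. $w(m)\ge1$ and $w(m)\le w(m-n)w(n)$ for all $m,n\in\mathbb Z$; $(b_m)_{m\in\mathbb Z}$ is a complex sequence with $\sum_mw(m)|b_m|=1$ and $b_{-m}=\overline{b_m}$. **Spaces.** For $\sigma\in\mathbb R$, $\mathcal L_{\sigma,w}$ is the Banach space of $u:\mathbb N_0\times\mathbb Z\to\mathbb C$ with $\|u\|_{\sigma,w}:=\sum_{m\in\mathbb Z}w(m)\sup_{n\ge0}e^{\sigma n}|u(n,m)|<\infty$. **Nonlinear terms.** $\alpha_k:=F^{(k)}(-c)$, and $\rho_{F,c}$ is the minimum of $1$ and the radius of convergence of $\sum_k\frac{\alpha_k}{k!}(x+c)^k$. $\triangle u(n,m):=u(n-1,m)-u(n,m)$ for $n\ge1$ and $\triangle u(0,m):=0$. $u(n,\cdot)^{*k}$ is the $k$-fold convolution in the variable $m$, $(x*y)(m)=\sum_lx(m-l)y(l)$ ($x^{*0}$ is the convolution identity). For $n\ge1$, $$Y(u,v)(n,m):=\frac1{\alpha_1}\sum_{k=2}^\infty\frac{\alpha_k}{k!}\left((\triangle(u+v))(n,\cdot)^{*k}-(\triangle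 u)(n,\cdot)^{*k}\right)(m),$$ $$W(u)(n,m):=\frac1{\alpha_1}\sum_{k=2}^\infty\frac{\alpha_k}{k!}\left((\triangle u)(n,\cdot)^{*k}-(\triangle u)(n+1,\cdot)^{*k}\right)(m),$$ $$W(u,v)(n,m):=Y(u,v)(n,m)-Y(u,v)(n+1,m),$$ and these are $0$ for $n=0$. **The constant $C_{F,c}$** is a fixed positive constant such that for all $0\le\sigma\le1$, $u\in\mathcal L_{0,w}$, $v\in\mathcal L_{\sigma,w}$ with $\|u\|_{0,w},\|v\|_{\sigma,w}<\rho_{F,c}/8$ (all series converging absolutely): $\|W(u)\|_{0,w}\le C_{F,c}\|u\|_{0,w}^2$; $\|Y(u,v)\|_{\sigma,w}\le C_{F,c}\|v\|_{\sigma,w}\max(\|u\|_{0,w},\|v\|_{0,w})$; $v\mapsto Y(u,v)$ is $C^2$ into $\mathcal L_{\sigma,w}$ with $\|D_vY(u,v)x\|_{\sigma,w}\le C_{F,c}\max(\|u\|_{0,w},\|v\|_{0,w})\|x\|_{\sigma,w}$ and $\|D_v^2Y(u,v)[x_1,x_2]\|_{\sigma,w}\le C_{F,c}\|x_1\|_{\sigma,w}\|x_2\|_{\sigma,w}$; $u\mapsto Y(u,v)$ is $C^1$ from $\mathcal L_{0,w}$ into $\mathcal L_{\sigma,w}$, its derivative $D_uY(u,v)$, given by the termwise-differentiated series, extends for each $\sigma'\in\mathbb R$ to a bounded operator $\mathcal L_{\sigma',w}\to\mathcal L_{\sigma+\sigma',w}$ of norm at most $(1+e^{\sigma'})C_{F,c}\max(\|u\|_{0,w},\|v\|_{\sigma,w})$;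 and for $\sigma'\ge0$, $x\in\mathcal L_{-\sigma',w}$, the map $v\mapsto D_uY(u,v)x$ is $C^1$ into $\mathcal L_{\sigma-\sigma',w}$ with derivative in direction $z$ of norm at most $C_{F,c}\|x\|_{-\sigma',w}\|z\|_{\sigma,w}$. (Such a constant exists.) **Other constants.** $\delta_m:=-2+\frac{(m\gamma)^2}{F'(-c)}$; $m_0:=\max\{m\in\mathbb Z:0\le\frac{(m\gamma)^2}{F'(-c)}\le4\}$; for $|m|>m_0$, $z_m:=-\frac{\delta_m}2+\sqrt{\frac{\delta_m^2}4-1}$ (so $|z_m|<1$); for $0<|m|\le m_0$, $\beta_m:=-\mathrm{sgn}(m)\arccos(-\delta_m/2)$. Further $\sigma_0:=\min(1,-\frac12\ln|z_{m_0+1}|)$, $\sigma_1:=\frac14\sigma_0$, $$C_K:=\max\left[\frac{1+e^{-2\sigma_0}}{1-e^{-4\sigma_0}}\left(\frac1{e^{\sigma_0}-1}+\frac1{1-e^{-2\sigma_0}}\right),\ \frac2{1-e^{-\sigma_1}}\max\left\{\frac1{|\sin\beta_m|}:0<m\le m_0\right\}\right],$$ where the inner maximum is read as $1$ if $m_0=0$, and $\rho_u:=\sum_{|m|>m_0}w(m)|u(0,m)|$. *)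

theory Defs
  imports "HOL-Analysis.Analysis" "HOL-Library.Function_Algebras"
begin

text \<open>
  The exponent \<open>\<sigma>\<close> of the sequence spaces varies inside formulas, so a normed space cannot be
  a type here. It is a subspace of an ambient real vector space together with a norm on it.
\<close>

instantiation "fun" :: (type, real_vector) real_vector
begin

definition scaleR_fun :: "real \<Rightarrow> ('a \<Rightarrow> 'b) \<Rightarrow> 'a \<Rightarrow> 'b" where
  "scaleR_fun r f = (\<lambda>x. r *\<^sub>R f x)"

instance
  by standard (simp_all add: scaleR_fun_def fun_eq_iff scaleR_add_right scaleR_add_left)

end

record 'a nspace =
  vecs :: "'a set"
  nrm :: "'a \<Rightarrow> real"

definition euclid :: "'a::real_normed_vector nspace" where
  "euclid = \<lparr>vecs = UNIV, nrm = norm\<rparr>"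

text \<open>
  Bounded real-linear operators from \<open>X\<close> to \<open>Y\<close> with the operator norm. The value of an operator
  outside \<open>vecs X\<close> is irrelevant, so \<open>nrm (blinop X Y)\<close> is a norm up to equality on \<open>vecs X\<close>.
\<close>

definition blinop :: "'a::real_vector nspace \<Rightarrow> 'b::real_vector nspace \<Rightarrow> ('a \<Rightarrow> 'b) nspace" where
  "blinop X Y =
     \<lparr>vecs = {T. (\<forall>x\<in>vecs X. T x \<in> vecs Y) \<and>
                 (\<forall>x\<in>vecs X. \<forall>y\<in>vecs X. T (x + y) = T x + T y) \<and>
                 (\<forall>r. \<forall>x\<in>vecs X. T (r *\<^sub>R x) = r *\<^sub>R T x) \<and>
                 (\<exists>B. \<forall>x\<in>vecs X. nrm Y (T x) \<le> B * nrm X x)},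
      nrm = (\<lambda>T. SUP x\<in>{x\<in>vecs X. nrm X x \<le> 1}. nrm Y (T x))\<rparr>"

text \<open>Frechet derivative at \<open>x\<close> of \<open>f : S \<rightarrow> Y\<close> within \<open>S \<subseteq> X\<close>.\<close>

definition has_fderiv ::
  "'a::real_vector nspace \<Rightarrow> 'b::real_vector nspace \<Rightarrow> 'a set \<Rightarrow> ('a \<Rightarrow> 'b) \<Rightarrow> ('a \<Rightarrow> 'b) \<Rightarrow> 'a \<Rightarrow> bool" where
  "has_fderiv X Y S f T x \<longleftrightarrow>
     T \<in> vecs (blinop X Y) \<and>
     (\<forall>e>0. \<exists>d>0. \<forall>y\<in>S. nrm X (y - x) < d \<longrightarrow>
        nrm Y (f y - f x - T (y - x)) \<le> e * nrm X (y - x))"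

definition C1_deriv ::
  "'a::real_vector nspace \<Rightarrow> 'b::real_vector nspace \<Rightarrow> 'a set \<Rightarrow> ('a \<Rightarrow> 'b) \<Rightarrow> ('a \<Rightarrow> 'a \<Rightarrow> 'b) \<Rightarrow> bool" where
  "C1_deriv X Y S f f' \<longleftrightarrow>
     (\<forall>x\<in>S. f x \<in> vecs Y \<and> has_fderiv X Y S f (f' x) x) \<and>
     (\<forall>x\<in>S. \<forall>e>0. \<exists>d>0. \<forall>y\<in>S. nrm X (y - x) < d \<longrightarrow> nrm (blinop X Y) (f' y - f' x) < e)"

definition C1_map ::
  "'a::real_vector nspace \<Rightarrow> 'b::real_vector nspace \<Rightarrow> 'a set \<Rightarrow> ('a \<Rightarrow> 'b) \<Rightarrow> bool" where
  "C1_map X Y S f \<longleftrightarrow> (\<exists>f'. C1_deriv X Y S f f')"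

definition C2_deriv ::
  "'a::real_vector nspace \<Rightarrow> 'b::real_vector nspace \<Rightarrow> 'a set \<Rightarrow> ('a \<Rightarrow> 'b) \<Rightarrow>
     ('a \<Rightarrow> 'a \<Rightarrow> 'b) \<Rightarrow> ('a \<Rightarrow> 'a \<Rightarrow> 'a \<Rightarrow> 'b) \<Rightarrow> bool" where
  "C2_deriv X Y S f f' f'' \<longleftrightarrow> C1_deriv X Y S f f' \<and> C1_deriv X (blinop X Y) S f' f''"

lemma vecs_blinop_euclid_iff: "T \<in> vecs (blinop euclid euclid) \<longleftrightarrow> bounded_linear T"
proof
  assume T: "T \<in> vecs (blinop euclid euclid)"
  then obtain B where "\<forall>x. norm (T x) \<le> B * norm x"
    by (auto simp: blinop_def euclid_def)
  with T show "bounded_linear T"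
    by (intro bounded_linear_intro[where K = B]) (auto simp: blinop_def euclid_def mult.commute)
next
  assume "bounded_linear T"
  then interpret bounded_linear T .
  show "T \<in> vecs (blinop euclid euclid)"
    using bounded by (auto simp: blinop_def euclid_def add scaleR mult.commute)
qed

lemma has_fderiv_euclid_iff:
  "has_fderiv euclid euclid S f T x \<longleftrightarrow> (f has_derivative T) (at x within S)"
  unfolding has_fderiv_def vecs_blinop_euclid_iff has_derivative_within_alt
  by (simp add: euclid_def)

type_synonym seq = "nat \<Rightarrow> int \<Rightarrow> complex"

definition admissible_weight :: "(int \<Rightarrow> real) \<Rightarrow> bool" where
  "admissible_weight w \<longleftrightarrow> (\<forall>m. 1 \<le> w m) \<and> (\<forall>m n. w m \<le> w (m - n) * w n)"

definition Lsp :: "real \<Rightarrow> (int \<Rightarrow> real) \<Rightarrow> seq nspace" where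
  "Lsp \<sigma> w =
     \<lparr>vecs = {u. (\<forall>m. bdd_above (range (\<lambda>n. exp (\<sigma> * real n) * cmod (u n m)))) \<and>
                 (\<lambda>m. w m * (SUP n. exp (\<sigma> * real n) * cmod (u n m))) summable_on UNIV},
      nrm = (\<lambda>u. \<Sum>\<^sub>\<infinity>m. w m * (SUP n. exp (\<sigma> * real n) * cmod (u n m)))\<rparr>"

definition oball :: "real \<Rightarrow> (int \<Rightarrow> real) \<Rightarrow> real \<Rightarrow> seq set" where
  "oball \<sigma> w r = {u \<in> vecs (Lsp \<sigma> w). nrm (Lsp \<sigma> w) u < r}"

definition real_analytic_on :: "(real \<Rightarrow> real) \<Rightarrow> real set \<Rightarrow> bool" where
  "real_analytic_on F U \<longleftrightarrow>
     (\<forall>x\<in>U. \<exists>r>0. \<exists>a. \<forall>y. \<bar>y - x\<bar> < r \<longrightarrow> (\<lambda>k. a k * (y - x) ^ k) sums F y)"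

definition alpha :: "(real \<Rightarrow> real) \<Rightarrow> real \<Rightarrow> nat \<Rightarrow> real" where
  "alpha F c k = (deriv ^^ k) F (- c)"

definition rho :: "(real \<Rightarrow> real) \<Rightarrow> real \<Rightarrow> real" where
  "rho F c = real_of_ereal (min 1 (conv_radius (\<lambda>k. alpha F c k / fact k)))"

definition tri :: "seq \<Rightarrow> seq" where
  "tri u n m = (if n = 0 then 0 else u (n - 1) m - u n m)"

definition conv :: "(int \<Rightarrow> complex) \<Rightarrow> (int \<Rightarrow> complex) \<Rightarrow> int \<Rightarrow> complex" where
  "conv x y m = (\<Sum>\<^sub>\<infinity>l. x (m - l) * y l)"

definition convpow :: "(int \<Rightarrow> complex) \<Rightarrow> nat \<Rightarrow> int \<Rightarrow> complex" where
  "convpow x k = (conv x ^^ k) (\<lambda>m. if m = 0 then 1 else 0)"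

text \<open>All sums over \<open>k \<ge> 2\<close> below are written with the index shifted by 2.\<close>

definition Y :: "(real \<Rightarrow> real) \<Rightarrow> real \<Rightarrow> seq \<Rightarrow> seq \<Rightarrow> seq" where
  "Y F c u v n m =
     (if n = 0 then 0 else
        1 / of_real (alpha F c 1) *
        (\<Sum>k. of_real (alpha F c (k + 2) / fact (k + 2)) *
              (convpow (tri (u + v) n) (k + 2) m - convpow (tri u n) (k + 2) m)))"

definition W1 :: "(real \<Rightarrow> real) \<Rightarrow> real \<Rightarrow> seq \<Rightarrow> seq" where
  "W1 F c u n m =
     (if n = 0 then 0 else
        1 / of_real (alpha F c 1) *
        (\<Sum>k. of_real (alpha F c (k + 2) / fact (k + 2)) *
              (convpow (tri u n) (k + 2) m - convpow (tri u (n + 1)) (k + 2) m)))"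

definition W2 :: "(real \<Rightarrow> real) \<Rightarrow> real \<Rightarrow> seq \<Rightarrow> seq \<Rightarrow> seq" where
  "W2 F c u v n m = (if n = 0 then 0 else Y F c u v n m - Y F c u v (n + 1) m)"

text \<open>
  Termwise derivative of \<open>u \<mapsto> Y u v\<close> in direction \<open>x\<close>: the derivative of the \<open>k\<close>-fold convolution
  power of \<open>a\<close> in direction \<open>h\<close> is \<open>k\<close> times the convolution of the \<open>(k-1)\<close>-st power of \<open>a\<close> with \<open>h\<close>,
  and \<open>k / k! = 1 / (k-1)!\<close>.
\<close>

definition DuY :: "(real \<Rightarrow> real) \<Rightarrow> real \<Rightarrow> seq \<Rightarrow> seq \<Rightarrow> seq \<Rightarrow> seq" where
  "DuY F c u v x n m =
     (if n = 0 then 0 else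
        1 / of_real (alpha F c 1) *
        (\<Sum>k. of_real (alpha F c (k + 2) / fact (k + 1)) *
              conv (\<lambda>j. convpow (tri (u + v) n) (k + 1) j - convpow (tri u n) (k + 1) j) (tri x n) m))"

text \<open>
  \<open>C\<close> serves as the constant \<open>C\<^sub>F\<^sub>,\<^sub>c\<close>. The series converge absolutely on the balls used here because
  their arguments stay inside the disc of convergence, so this is not stated as a separate clause.
\<close>

definition CF_const :: "(real \<Rightarrow> real) \<Rightarrow> real \<Rightarrow> (int \<Rightarrow> real) \<Rightarrow> real \<Rightarrow> bool" where
  "CF_const F c w C \<longleftrightarrow>
     0 < C \<and>
     (\<forall>u\<in>oball 0 w (rho F c / 8).
        W1 F c u \<in> vecs (Lsp 0 w) \<and>
        nrm (Lsp 0 w) (W1 F c u) \<le> C * (nrm (Lsp 0 w) u)\<^sup>2) \<and>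
     (\<forall>\<sigma>. 0 \<le> \<sigma> \<and> \<sigma> \<le> 1 \<longrightarrow>
        (\<forall>u\<in>oball 0 w (rho F c / 8). \<forall>v\<in>oball \<sigma> w (rho F c / 8).
           Y F c u v \<in> vecs (Lsp \<sigma> w) \<and>
           nrm (Lsp \<sigma> w) (Y F c u v) \<le>
             C * nrm (Lsp \<sigma> w) v * max (nrm (Lsp 0 w) u) (nrm (Lsp 0 w) v)) \<and>
        (\<forall>u\<in>oball 0 w (rho F c / 8).
           \<exists>D D2. C2_deriv (Lsp \<sigma> w) (Lsp \<sigma> w) (oball \<sigma> w (rho F c / 8)) (Y F c u) D D2 \<and>
             (\<forall>v\<in>oball \<sigma> w (rho F c / 8).
                (\<forall>x\<in>vecs (Lsp \<sigma> w).
                   nrm (Lsp \<sigma> w) (D v x) \<le>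
                     C * max (nrm (Lsp 0 w) u) (nrm (Lsp 0 w) v) * nrm (Lsp \<sigma> w) x) \<and>
                (\<forall>x1\<in>vecs (Lsp \<sigma> w). \<forall>x2\<in>vecs (Lsp \<sigma> w).
                   nrm (Lsp \<sigma> w) (D2 v x1 x2) \<le>
                     C * nrm (Lsp \<sigma> w) x1 * nrm (Lsp \<sigma> w) x2))) \<and>
        (\<forall>v\<in>oball \<sigma> w (rho F c / 8).
           C1_deriv (Lsp 0 w) (Lsp \<sigma> w) (oball 0 w (rho F c / 8))
             (\<lambda>u. Y F c u v) (\<lambda>u. DuY F c u v)) \<and>
        (\<forall>u\<in>oball 0 w (rho F c / 8). \<forall>v\<in>oball \<sigma> w (rho F c / 8). \<forall>\<sigma>'.
           DuY F c u v \<in> vecs (blinop (Lsp \<sigma>' w) (Lsp (\<sigma> + \<sigma>') w)) \<and>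
           nrm (blinop (Lsp \<sigma>' w) (Lsp (\<sigma> + \<sigma>') w)) (DuY F c u v) \<le>
             (1 + exp \<sigma>') * C * max (nrm (Lsp 0 w) u) (nrm (Lsp \<sigma> w) v)) \<and>
        (\<forall>u\<in>oball 0 w (rho F c / 8). \<forall>\<sigma>'\<ge>0. \<forall>x\<in>vecs (Lsp (- \<sigma>') w).
           \<exists>D. C1_deriv (Lsp \<sigma> w) (Lsp (\<sigma> - \<sigma>') w) (oball \<sigma> w (rho F c / 8))
                 (\<lambda>v. DuY F c u v x) D \<and>
             (\<forall>v\<in>oball \<sigma> w (rho F c / 8). \<forall>z\<in>vecs (Lsp \<sigma> w).
                nrm (Lsp (\<sigma> - \<sigma>') w) (D v z) \<le>
                  C * nrm (Lsp (- \<sigma>') w) x * nrm (Lsp \<sigma> w) z)))"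

definition delta :: "(real \<Rightarrow> real) \<Rightarrow> real \<Rightarrow> real \<Rightarrow> int \<Rightarrow> real" where
  "delta F c \<gamma> m = - 2 + (of_int m * \<gamma>)\<^sup>2 / deriv F (- c)"

definition m0 :: "(real \<Rightarrow> real) \<Rightarrow> real \<Rightarrow> real \<Rightarrow> int" where
  "m0 F c \<gamma> = Max {m. 0 \<le> (of_int m * \<gamma>)\<^sup>2 / deriv F (- c) \<and> (of_int m * \<gamma>)\<^sup>2 / deriv F (- c) \<le> 4}"

definition zroot :: "(real \<Rightarrow> real) \<Rightarrow> real \<Rightarrow> real \<Rightarrow> int \<Rightarrow> real" where
  "zroot F c \<gamma> m = - delta F c \<gamma> m / 2 + sqrt ((delta F c \<gamma> m)\<^sup>2 / 4 - 1)"

definition beta :: "(real \<Rightarrow> real) \<Rightarrow> real \<Rightarrow> real \<Rightarrow> int \<Rightarrow> real" where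
  "beta F c \<gamma> m = - of_int (sgn m) * arccos (- delta F c \<gamma> m / 2)"

definition sigma0 :: "(real \<Rightarrow> real) \<Rightarrow> real \<Rightarrow> real \<Rightarrow> real" where
  "sigma0 F c \<gamma> = min 1 (- (1 / 2) * ln \<bar>zroot F c \<gamma> (m0 F c \<gamma> + 1)\<bar>)"

definition sigma1 :: "(real \<Rightarrow> real) \<Rightarrow> real \<Rightarrow> real \<Rightarrow> real" where
  "sigma1 F c \<gamma> = sigma0 F c \<gamma> / 4"

definition CK :: "(real \<Rightarrow> real) \<Rightarrow> real \<Rightarrow> real \<Rightarrow> real" where
  "CK F c \<gamma> =
     (let s0 = sigma0 F c \<gamma>; s1 = sigma1 F c \<gamma> in
      max ((1 + exp (- 2 * s0)) / (1 - exp (- 4 * s0)) *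
             (1 / (exp s0 - 1) + 1 / (1 - exp (- 2 * s0))))
          (2 / (1 - exp (- s1)) *
             (if m0 F c \<gamma> = 0 then 1
              else Max ((\<lambda>m. 1 / \<bar>sin (beta F c \<gamma> m)\<bar>) ` {0<..m0 F c \<gamma>}))))"

definition c1const :: "(real \<Rightarrow> real) \<Rightarrow> real \<Rightarrow> real \<Rightarrow> real \<Rightarrow> real" where
  "c1const F c \<gamma> CF = min (1 / (4 * CK F c \<gamma> * CF)) (rho F c / 8)"

definition rho_u :: "(real \<Rightarrow> real) \<Rightarrow> real \<Rightarrow> real \<Rightarrow> (int \<Rightarrow> real) \<Rightarrow> seq \<Rightarrow> real" where
  "rho_u F c \<gamma> w u = (\<Sum>\<^sub>\<infinity>m\<in>{m. \<bar>m\<bar> > m0 F c \<gamma>}. w m * cmod (u 0 m))"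

definition is_corrector ::
  "(real \<Rightarrow> real) \<Rightarrow> real \<Rightarrow> real \<Rightarrow> (int \<Rightarrow> real) \<Rightarrow> (int \<Rightarrow> complex) \<Rightarrow> real \<Rightarrow> seq \<Rightarrow> real \<Rightarrow> seq \<Rightarrow> bool" where
  "is_corrector F c \<gamma> w b CF u \<epsilon> v \<longleftrightarrow>
     v \<in> vecs (Lsp (sigma0 F c \<gamma>) w) \<and>
     (\<forall>m. \<forall>n\<ge>1. v (n - 1) m + of_real (delta F c \<gamma> m) * v n m + v (n + 1) m + W2 F c u v n m = 0) \<and>
     (nrm (Lsp (sigma0 F c \<gamma>) w) v \<le> 2 * (rho_u F c \<gamma> w u + \<bar>\<epsilon>\<bar>) \<and>
      2 * (rho_u F c \<gamma> w u + \<bar>\<epsilon>\<bar>) \<le> c1const F c \<gamma> CF \<and>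
      c1const F c \<gamma> CF \<le> rho F c / 8) \<and>
     (\<forall>m. \<bar>m\<bar> > m0 F c \<gamma> \<longrightarrow> v 0 m = of_real \<epsilon> * b m - u 0 m)"

end

theory Submission
  imports Defs
begin

text \<open>
  For each Fourier mode \<open>m\<close> the corrector equation is a linear recursion of second order in \<open>n\<close>, perturbed by
  \<open>W2 = Y(n) - Y(n + 1)\<close>. In the finitely many modes \<open>\<bar>m\<bar> \<le> m0\<close> the characteristic roots lie on the unit circle,
  so there is at most one decaying solution, and it is obtained by summation from infinity. In the other modes the
  roots are \<open>z\<close> and \<open>1 / z\<close> with \<open>\<bar>z\<bar> < 1\<close>, and a decaying solution is determined by its value at \<open>n = 0\<close>, which
  condition (iii) prescribes. Inverting the linear part turns the problem into the fixed point equation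
  \<open>v = Sop h + Kop (Y u v)\<close> with boundary data \<open>h = \<epsilon> b - u(0)\<close> (\<open>linear_problem_unique\<close>,
  \<open>is_corrector_iff_fixed_point\<close>). Summation by parts moves the difference from \<open>Y\<close> to the Green's function;
  the resulting kernels have norm at most \<open>CK\<close> for all exponents between \<open>\<sigma>1\<close> and \<open>\<sigma>0\<close> (\<open>Kop_bd\<close>), and \<open>Sop h\<close> has
  norm at most \<open>rho_u + \<bar>\<epsilon>\<bar>\<close>. On the ball of radius \<open>2 (rho_u + \<bar>\<epsilon>\<bar>)\<close>, which lies below \<open>c1\<close>, the nonlinear term has
  the Lipschitz constant \<open>CF c1\<close>, and \<open>CK CF c1 \<le> 1/4\<close>. So Banach's theorem gives existence, uniqueness and,
  applied to the closed set of symmetric sequences, the reality condition (iv) (\<open>corrector_exists_unique\<close>).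

  The rows of the sequences form a commutative ring under convolution, and \<open>Y u v = G(u + v) - G(u)\<close> for a power series
  \<open>G\<close> in the row differences. All differentiability used below is proved for \<open>G\<close> termwise, from bounds for Taylor
  remainders of powers, with some finite constant. Only the contraction constant has to be the given one. It is
  extracted from the bound on the derivative of \<open>v \<mapsto> Y u v\<close> that defines \<open>CF\<close>, by difference quotients and then by
  approximation from the open ball, since \<open>u(q)\<close> may have the extreme norm \<open>rho F c / 8\<close> (\<open>DGs_CF\<close>,
  \<open>Gs_lipschitz_CF\<close>).

  For (v) the difficulty is that \<open>q \<mapsto> u(q)\<close> is differentiable only in the larger space with exponent \<open>- \<sigma>1\<close>, whose
  elements may grow. What helps is that exponents add up under products (\<open>bd_mult\<close>), and that increments of \<open>u\<close> enter \<open>Y\<close>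
  only multiplied by the corrector, which has the exponent \<open>\<sigma>0 = 4 \<sigma>1\<close>, or by one of its increments, which have
  \<open>2 \<sigma>1\<close>. The corrector turns out to be Lipschitz with exponent \<open>2 \<sigma>1\<close> (\<open>V_lipschitz\<close>). Its derivative solves the
  linearized fixed point equation, again by contraction, and the linearization error consists of products of two
  increments with total exponent at least \<open>\<sigma>1\<close> (\<open>V_differentiable\<close>, \<open>dV_continuous\<close>).
\<close>

text \<open>
  The infix \<open>abs_summable_on\<close> denotes absolute summability in the sense of \<open>infsum\<close>, the sum in
  which \<open>conv\<close> and \<open>Lsp\<close> are stated.
\<close>

no_notation Infinite_Set_Sum.abs_summable_on (infix \<open>abs'_summable'_on\<close> 50)
notation Infinite_Sum.abs_summable_on (infixr \<open>abs'_summable'_on\<close> 46)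

section \<open>The convolution ring of row-summable sequences\<close>

text \<open>
  The map \<open>(m, l) \<mapsto> (m - l, l)\<close> is a bijection of pairs of integers, so convolution terms are
  summable because the products \<open>x j * y l\<close> are. Real \<open>x\<close> and \<open>y\<close> are admitted because the same fact,
  applied to weighted majorants, gives the norm inequality \<open>bd_mult\<close>.
\<close>

lemma pair_shift_summable:
  fixes x y :: "int \<Rightarrow> 'a::{banach,real_normed_div_algebra}"
  assumes "x abs_summable_on UNIV" "y abs_summable_on UNIV"
  shows "(\<lambda>(m,l). x (m - l) * y l) abs_summable_on UNIV \<times> UNIV"
proof -
  have "(\<lambda>(j,l). x j * y l) abs_summable_on UNIV \<times> UNIV"
  proof (subst Infinite_Sum.abs_summable_on_Sigma_iff, intro conjI ballI)
    fix j show "(\<lambda>l. case (j,l) of (j,l) \<Rightarrow> x j * y l) abs_summable_on UNIV"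
      using assms(2) by (simp add: norm_mult summable_on_cmult_right)
  next
    have "(\<lambda>j. norm (x j) * (\<Sum>\<^sub>\<infinity>l. norm (y l))) summable_on UNIV"
      using assms(1) by (intro summable_on_cmult_left)
    then show "(\<lambda>j. \<Sum>\<^sub>\<infinity>l. norm (case (j,l) of (j,l) \<Rightarrow> x j * y l)) abs_summable_on UNIV"
      by (simp add: norm_mult infsum_cmult_right' abs_mult infsum_nonneg)
  qed
  also have "?this \<longleftrightarrow> ?thesis"
    by (rule summable_on_reindex_bij_witness[where i = "\<lambda>(m,l). (m-l,l)" and j = "\<lambda>(j,l). (j+l,l)"]) auto
  finally show ?thesis .
qed

lemma shift_summable_row:
  fixes x y :: "int \<Rightarrow> 'a::{banach,real_normed_div_algebra}"
  assumes "x abs_summable_on UNIV" "y abs_summable_on UNIV"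
  shows "(\<lambda>l. x (m - l) * y l) abs_summable_on UNIV"
  using pair_shift_summable[OF assms] unfolding Infinite_Sum.abs_summable_on_Sigma_iff by auto

lemma shift_summable_sum:
  fixes x y :: "int \<Rightarrow> 'a::{banach,real_normed_div_algebra}"
  assumes "x abs_summable_on UNIV" "y abs_summable_on UNIV"
  shows "(\<lambda>m. \<Sum>\<^sub>\<infinity>l. x (m - l) * y l) abs_summable_on UNIV"
proof -
  have 1: "(\<lambda>m. \<Sum>\<^sub>\<infinity>l. norm (x (m - l) * y l)) summable_on UNIV"
    using pair_shift_summable[OF assms] unfolding Infinite_Sum.abs_summable_on_Sigma_iff
    by (auto simp: abs_of_nonneg infsum_nonneg)
  show ?thesis
  proof (rule Infinite_Sum.abs_summable_on_comparison_test'[OF 1])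
    fix m show "norm (\<Sum>\<^sub>\<infinity>l. x (m - l) * y l) \<le> (\<Sum>\<^sub>\<infinity>l. norm (x (m - l) * y l))"
      using shift_summable_row[OF assms, of m] by (rule norm_infsum_bound)
  qed
qed

lemma infsum_shift_int: "(\<Sum>\<^sub>\<infinity>m::int. f (m - l)) = (\<Sum>\<^sub>\<infinity>m. f m)"
  by (rule infsum_reindex_bij_witness[where i = "\<lambda>m. m + l" and j = "\<lambda>m. m - l"]) auto

lemma infsum_shift_product:
  fixes x y :: "int \<Rightarrow> 'a::{banach,real_normed_div_algebra}"
  assumes "x abs_summable_on UNIV" "y abs_summable_on UNIV"
  shows "(\<Sum>\<^sub>\<infinity>m. \<Sum>\<^sub>\<infinity>l. x (m - l) * y l) = (\<Sum>\<^sub>\<infinity>m. x m) * (\<Sum>\<^sub>\<infinity>l. y l)"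
proof -
  have "(\<lambda>(m,l). x (m - l) * y l) summable_on UNIV \<times> UNIV"
    using pair_shift_summable[OF assms] by (rule abs_summable_summable)
  then have "(\<Sum>\<^sub>\<infinity>m. \<Sum>\<^sub>\<infinity>l. x (m - l) * y l) = (\<Sum>\<^sub>\<infinity>l. \<Sum>\<^sub>\<infinity>m. x (m - l) * y l)"
    by (rule infsum_swap_banach)
  also have "\<dots> = (\<Sum>\<^sub>\<infinity>l. (\<Sum>\<^sub>\<infinity>m. x m) * y l)"
  proof (rule infsum_cong)
    fix l show "(\<Sum>\<^sub>\<infinity>m. x (m - l) * y l) = (\<Sum>\<^sub>\<infinity>m. x m) * y l"
      using infsum_shift_int[of "\<lambda>m. x m * y l" l] by (simp add: infsum_cmult_left' )
  qed
  also have "\<dots> = (\<Sum>\<^sub>\<infinity>m. x m) * (\<Sum>\<^sub>\<infinity>l. y l)" by (simp add: infsum_cmult_right')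
  finally show ?thesis .
qed

lemma conv_abs_summable:
  "x abs_summable_on UNIV \<Longrightarrow> y abs_summable_on UNIV \<Longrightarrow> conv x y abs_summable_on UNIV"
  unfolding conv_def[abs_def] by (rule shift_summable_sum)

lemma conv_commute: "conv x y = conv y x"
proof
  fix m show "conv x y m = conv y x m"
    unfolding conv_def
    by (rule infsum_reindex_bij_witness[where i = "\<lambda>l. m - l" and j = "\<lambda>l. m - l"]) (auto simp: mult.commute)
qed

lemma conv_summable_row:
  assumes "x abs_summable_on UNIV" "y abs_summable_on UNIV"
  shows "(\<lambda>l::int. x (m - l) * y l :: complex) summable_on UNIV"
  using shift_summable_row[OF assms, of m] by (rule Infinite_Sum.abs_summable_summable)

lemma conv_add_left:
  assumes "x abs_summable_on UNIV" "y abs_summable_on UNIV" "z abs_summable_on UNIV"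
  shows "conv (\<lambda>l. x l + y l) z m = conv x z m + conv y z m"
  using infsum_add[OF conv_summable_row[OF assms(1,3), of m] conv_summable_row[OF assms(2,3), of m]]
  by (simp add: conv_def distrib_right)

lemma conv_assoc:
  assumes x: "x abs_summable_on UNIV" and y: "y abs_summable_on UNIV" and z: "z abs_summable_on UNIV"
  shows "conv (conv x y) z = conv x (conv y z)"
proof
  fix m
  \<comment> \<open>Boundedness of \<open>x\<close> reduces the interchange of the two sums to summability over pairs for \<open>y\<close> and \<open>z\<close>.\<close>
  have bx: "norm (x j) \<le> (\<Sum>\<^sub>\<infinity>j. norm (x j))" for j
    using finite_sum_le_infsum[of "\<lambda>j. norm (x j)" UNIV "{j}"] x by simp
  have pair: "(\<lambda>(i,l). y (i - l) * z l) abs_summable_on UNIV \<times> UNIV"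
    by (rule pair_shift_summable[OF y z])
  have "(\<lambda>(i,l). x (m - i) * (y (i - l) * z l)) abs_summable_on UNIV \<times> UNIV"
  proof (rule Infinite_Sum.abs_summable_on_comparison_test')
    show "(\<lambda>p. (\<Sum>\<^sub>\<infinity>j. norm (x j)) * norm (case p of (i,l) \<Rightarrow> y (i - l) * z l)) summable_on UNIV \<times> UNIV"
      using pair by (rule summable_on_cmult_right)
  qed (simp add: norm_mult case_prod_unfold mult_right_mono bx)
  then have S: "(\<lambda>(i,l). x (m - i) * (y (i - l) * z l)) summable_on UNIV \<times> UNIV"
    by (rule abs_summable_summable)
  have "conv x (conv y z) m = (\<Sum>\<^sub>\<infinity>i. \<Sum>\<^sub>\<infinity>l. x (m - i) * (y (i - l) * z l))"
    unfolding conv_def by (simp add: infsum_cmult_right')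
  also have "\<dots> = (\<Sum>\<^sub>\<infinity>l. \<Sum>\<^sub>\<infinity>i. x (m - i) * (y (i - l) * z l))"
    by (rule infsum_swap_banach[OF S])
  also have "\<dots> = (\<Sum>\<^sub>\<infinity>l. (\<Sum>\<^sub>\<infinity>j. x (m - l - j) * y j) * z l)"
  proof (rule infsum_cong)
    fix l
    have "(\<Sum>\<^sub>\<infinity>i. x (m - i) * (y (i - l) * z l)) =
        (\<Sum>\<^sub>\<infinity>i. x (m - l - (i - l)) * y (i - l) * z l)"
      by (simp add: mult.assoc)
    also have "\<dots> = (\<Sum>\<^sub>\<infinity>j. x (m - l - j) * y j * z l)"
      by (rule infsum_shift_int[of "\<lambda>j. x (m - l - j) * y j * z l" l])
    also have "\<dots> = (\<Sum>\<^sub>\<infinity>j. x (m - l - j) * y j) * z l"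
      by (rule infsum_cmult_left')
    finally show "(\<Sum>\<^sub>\<infinity>i. x (m - i) * (y (i - l) * z l)) =
        (\<Sum>\<^sub>\<infinity>j. x (m - l - j) * y j) * z l" .
  qed
  finally show "conv (conv x y) z m = conv x (conv y z) m" by (simp add: conv_def)
qed

lemma conv_unit: "conv (\<lambda>m. if m = 0 then 1 else 0) x = x"
proof
  fix m
  let ?f = "\<lambda>l. (if m - l = 0 then 1 else 0) * x l"
  have "infsum ?f UNIV = infsum x {m}"
  proof (rule infsum_cong_neutral)
    show "?f l = 0" if "l \<in> UNIV - {m}" for l using that by simp
    show "x l = 0" if "l \<in> {m} - UNIV" for l using that by simp
    show "?f l = x l" if "l \<in> UNIV \<inter> {m}" for l using that by simp
  qed
  then show "conv (\<lambda>m. if m = 0 then 1 else 0) x m = x m" by (simp add: conv_def)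
qed

lemma abs_summable_add:
  "x abs_summable_on A \<Longrightarrow> y abs_summable_on A \<Longrightarrow> (\<lambda>m. x m + y m) abs_summable_on A"
  by (rule Infinite_Sum.abs_summable_on_comparison_test'[where g = "\<lambda>m. norm (x m) + norm (y m)"])
     (simp_all add: summable_on_add norm_triangle_ineq)

lemma abs_summable_diff:
  "x abs_summable_on A \<Longrightarrow> y abs_summable_on A \<Longrightarrow> (\<lambda>m. x m - y m) abs_summable_on A"
  by (rule Infinite_Sum.abs_summable_on_comparison_test'[where g = "\<lambda>m. norm (x m) + norm (y m)"])
     (simp_all add: summable_on_add norm_triangle_ineq4)

text \<open>
  With summable rows, row-wise convolution is the product of a commutative ring. Powers of the rows
  then obey the ring laws, and Taylor remainders can be handled by algebra. The ring carries no norm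
  and no topology of its own: one sequence has to be measured with many exponents \<open>\<sigma>\<close>.
\<close>

typedef aseq = "{u::seq. \<forall>n. u n abs_summable_on UNIV}"
  by (rule exI[of _ "\<lambda>n m. 0"]) simp

setup_lifting type_definition_aseq

lemma unit_row_summable: "(\<lambda>m::int. if m = 0 then 1 else 0 :: complex) abs_summable_on UNIV"
proof (rule finite_nonzero_values_imp_summable_on)
  have "{m::int \<in> UNIV. norm (if m = 0 then 1 else 0 :: complex) \<noteq> 0} = {0}" by auto
  then show "finite {m::int \<in> UNIV. norm (if m = 0 then 1 else 0 :: complex) \<noteq> 0}" by (simp only: finite.emptyI finite.insertI)
qed

instantiation aseq :: comm_ring_1
begin
lift_definition zero_aseq :: aseq is "\<lambda>n m. 0" by simp
lift_definition one_aseq :: aseq is "\<lambda>n m. if m = 0 then 1 else 0"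
  by (rule unit_row_summable)
lift_definition plus_aseq :: "aseq \<Rightarrow> aseq \<Rightarrow> aseq" is "\<lambda>u v n m. u n m + v n m"
  by (intro allI abs_summable_add) auto
lift_definition uminus_aseq :: "aseq \<Rightarrow> aseq" is "\<lambda>u n m. - u n m" by simp
lift_definition minus_aseq :: "aseq \<Rightarrow> aseq \<Rightarrow> aseq" is "\<lambda>u v n m. u n m - v n m"
  by (intro allI abs_summable_diff) auto
lift_definition times_aseq :: "aseq \<Rightarrow> aseq \<Rightarrow> aseq" is "\<lambda>u v n. conv (u n) (v n)"
  by (rule conv_abs_summable) auto
instance
proof
  fix a b c :: aseq
  show "a * b * c = a * (b * c)" by transfer (intro ext fun_cong[OF conv_assoc]; blast)
  show "a * b = b * a" by transfer (intro ext fun_cong[OF conv_commute])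
  show "1 * a = a" by transfer (intro ext fun_cong[OF conv_unit])
  show "(a + b) * c = a * c + b * c"
    by transfer (intro ext conv_add_left; blast)
  show "(0::aseq) \<noteq> 1" 
  proof transfer
    have "(0::complex) \<noteq> (if (0::int) = 0 then 1 else 0)" by simp
    then show "(\<lambda>(n::nat) (m::int). 0::complex) \<noteq> (\<lambda>n m. if m = 0 then 1 else 0)" by meson
  qed
  show "a + b + c = a + (b + c)" by transfer (simp add: add.assoc)
  show "a + b = b + a" by transfer (simp add: add.commute)
  show "0 + a = a" by transfer simp
  show "- a + a = 0" by transfer simp
  show "a - b = a + - b" by transfer simp
qed
end

abbreviation sq :: "aseq \<Rightarrow> seq" where "sq \<equiv> Rep_aseq"

lemma sq_add: "sq (a + b) = sq a + sq b" by (intro ext) (simp add: plus_aseq.rep_eq)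
lemma sq_diff: "sq (a - b) = sq a - sq b" by (intro ext) (simp add: minus_aseq.rep_eq)
lemma sq_zero: "sq 0 = 0" by (intro ext) (simp add: zero_aseq.rep_eq)
lemma sq_mult: "sq (a * b) n = conv (sq a n) (sq b n)" by (simp add: times_aseq.rep_eq)

lemma sq_power: "sq (a ^ k) n = convpow (sq a n) k"
proof (induction k)
  case 0 show ?case by (simp add: convpow_def one_aseq.rep_eq)
next
  case (Suc k) then show ?case by (simp add: sq_mult convpow_def)
qed

lemma sq_of_nat_mult: "sq (of_nat j * a) n m = of_nat j * sq a n m"
  by (induction j) (auto simp: sq_zero sq_add algebra_simps)

section \<open>The weighted norm as a bound on finite selections\<close>

locale weighted =
  fixes w :: "int \<Rightarrow> real"
  assumes admissible: "admissible_weight w"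
begin

lemma w_ge_1: "1 \<le> w m"
  using admissible by (simp add: admissible_weight_def)

lemma w_nonneg: "0 \<le> w m"
  using w_ge_1[of m] by simp

lemma w_submult: "w m \<le> w (m - n) * w n"
  using admissible by (simp add: admissible_weight_def)

text \<open>
  \<open>bd \<sigma> x r\<close> says that \<open>x\<close> lies in \<open>Lsp \<sigma> w\<close> with norm at most \<open>r\<close> (\<open>bd_iff\<close>). The supremum over
  \<open>n\<close> in every column \<open>m\<close> is replaced by an arbitrary choice \<open>s m\<close> of a row, and the sum over \<open>m\<close> by
  its finite partial sums \<open>sel\<close>. No summability has to be carried along, the triangle inequality is
  that of finite sums, and bounds pass to entrywise limits.
\<close>

abbreviation sel :: "real \<Rightarrow> seq \<Rightarrow> (int \<Rightarrow> nat) \<Rightarrow> int set \<Rightarrow> real" where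
  "sel \<sigma> x s A \<equiv> \<Sum>m\<in>A. w m * (exp (\<sigma> * real (s m)) * cmod (x (s m) m))"

definition bd :: "real \<Rightarrow> seq \<Rightarrow> real \<Rightarrow> bool" where
  "bd \<sigma> x r \<longleftrightarrow>
     (\<forall>A s. finite A \<longrightarrow> sel \<sigma> x s A \<le> r)"

lemma bdI:
  "(\<And>A s. finite A \<Longrightarrow> sel \<sigma> x s A \<le> r) \<Longrightarrow> bd \<sigma> x r"
  by (simp add: bd_def)

lemma bdD:
  "bd \<sigma> x r \<Longrightarrow> finite A \<Longrightarrow> sel \<sigma> x s A \<le> r"
  by (simp add: bd_def)

lemma bd_nonneg: "bd \<sigma> x r \<Longrightarrow> 0 \<le> r"
  using bdD[of \<sigma> x r "{}"] by simp

lemma bd_mono: "bd \<sigma> x r \<Longrightarrow> r \<le> r' \<Longrightarrow> bd \<sigma> x r'"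
  by (meson bdI bdD order_trans)

lemma bd_exponent_mono:
  assumes "bd \<tau> x r" "\<sigma> \<le> \<tau>" shows "bd \<sigma> x r"
proof (rule bdI)
  fix A :: "int set" and s assume "finite A"
  have "sel \<sigma> x s A \<le>
        sel \<tau> x s A"
    by (intro sum_mono mult_left_mono mult_right_mono) (simp_all add: w_nonneg assms mult_right_mono)
  also have "\<dots> \<le> r" using bdD[OF assms(1) \<open>finite A\<close>] .
  finally show "sel \<sigma> x s A \<le> r" .
qed

lemma bd_zero: "bd \<sigma> 0 0"
  by (rule bdI) simp

lemma bd_add:
  assumes "bd \<sigma> x r" "bd \<sigma> y r'" shows "bd \<sigma> (x + y) (r + r')"
proof (rule bdI)
  fix A :: "int set" and s assume A: "finite A"
  have "sel \<sigma> (x + y) s A \<le>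
        (\<Sum>m\<in>A. w m * (exp (\<sigma> * real (s m)) * cmod (x (s m) m)) + w m * (exp (\<sigma> * real (s m)) * cmod (y (s m) m)))"
    unfolding distrib_left[symmetric]
    by (intro sum_mono mult_left_mono) (simp_all add: w_nonneg norm_triangle_ineq)
  also have "\<dots> \<le> r + r'"
    unfolding sum.distrib by (intro add_mono bdD assms A)
  finally show "sel \<sigma> (x + y) s A \<le> r + r'" .
qed

lemma bd_scaleR:
  assumes "bd \<sigma> x r" shows "bd \<sigma> (c *\<^sub>R x) (\<bar>c\<bar> * r)"
proof (rule bdI)
  fix A :: "int set" and s assume A: "finite A"
  have "sel \<sigma> (c *\<^sub>R x) s A =
        \<bar>c\<bar> * sel \<sigma> x s A"
    unfolding sum_distrib_left by (rule sum.cong) (simp_all add: scaleR_fun_def)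
  also have "\<dots> \<le> \<bar>c\<bar> * r" by (intro mult_left_mono bdD assms A) simp
  finally show "sel \<sigma> (c *\<^sub>R x) s A \<le> \<bar>c\<bar> * r" .
qed

lemma bd_uminus: "bd \<sigma> x r \<Longrightarrow> bd \<sigma> (- x) r"
  unfolding bd_def by simp

lemma bd_diff: "bd \<sigma> x r \<Longrightarrow> bd \<sigma> y r' \<Longrightarrow> bd \<sigma> (x - y) (r + r')"
  using bd_add[of \<sigma> x r "- y" r'] bd_uminus[of \<sigma> y r'] by simp

lemma bd_point_weighted:
  assumes "bd \<sigma> x r" shows "w m * (exp (\<sigma> * real n) * cmod (x n m)) \<le> r"
  using bdD[OF assms, of "{m}" "\<lambda>_. n"] by simp

lemma bd_point:
  assumes "bd \<sigma> x r" shows "exp (\<sigma> * real n) * cmod (x n m) \<le> r"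
proof -
  have "1 * (exp (\<sigma> * real n) * cmod (x n m)) \<le> w m * (exp (\<sigma> * real n) * cmod (x n m))"
    by (intro mult_right_mono w_ge_1) simp
  also have "\<dots> \<le> r" by (rule bd_point_weighted[OF assms])
  finally show ?thesis by simp
qed

lemma bd_point':
  assumes "bd \<sigma> x r" shows "cmod (x n m) \<le> exp (- \<sigma> * real n) * r"
proof -
  have "cmod (x n m) = exp (- \<sigma> * real n) * (exp (\<sigma> * real n) * cmod (x n m))"
    unfolding mult.assoc[symmetric] exp_add[symmetric] by simp
  also have "\<dots> \<le> exp (- \<sigma> * real n) * r"
    by (intro mult_left_mono bd_point assms) simp
  finally show ?thesis .
qed

text \<open>Each defining inequality of \<open>bd\<close> involves finitely many entries, so bounds survive entrywise limits.\<close>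

lemma bd_limit:
  assumes "\<And>i. bd \<sigma> (X i) (R i)" "R \<longlonglongrightarrow> r" "\<And>n m. (\<lambda>i. X i n m) \<longlonglongrightarrow> x n m"
  shows "bd \<sigma> x r"
proof (rule bdI)
  fix A :: "int set" and s assume A: "finite A"
  have "(\<lambda>i. \<Sum>m\<in>A. w m * (exp (\<sigma> * real (s m)) * cmod (X i (s m) m)))
        \<longlonglongrightarrow> sel \<sigma> x s A"
    by (intro tendsto_intros assms(3))
  from LIMSEQ_le[OF this assms(2)]
  show "sel \<sigma> x s A \<le> r"
    using bdD[OF assms(1) A] by blast
qed

lemma bd_Lsp:
  assumes "bd \<sigma> x r"
  shows "x \<in> vecs (Lsp \<sigma> w)" "nrm (Lsp \<sigma> w) x \<le> r"
proof -
  define f where "f m = (SUP n. exp (\<sigma> * real n) * cmod (x n m))" for m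
  have bdd: "bdd_above (range (\<lambda>n. exp (\<sigma> * real n) * cmod (x n m)))" for m
    by (rule bdd_aboveI[of _ r]) (use bd_point[OF assms] in blast)
  have f_ge: "exp (\<sigma> * real n) * cmod (x n m) \<le> f m" for n m
    unfolding f_def by (rule cSUP_upper[OF _ bdd]) simp
  have f0: "0 \<le> f m" for m
    by (rule order_trans[OF _ f_ge[of 0 m]]) simp
  have fin: "(\<Sum>m\<in>A. w m * f m) \<le> r" if A: "finite A" for A
  proof (rule field_le_epsilon)
    fix e :: real assume e: "0 < e"
    define d where "d = e / (1 + (\<Sum>m\<in>A. w m))"
    have W: "0 \<le> (\<Sum>m\<in>A. w m)" by (intro sum_nonneg w_nonneg)
    have d: "0 < d" unfolding d_def using W e by (intro divide_pos_pos) auto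
    have "\<exists>n. f m - d < exp (\<sigma> * real n) * cmod (x n m)" for m
    proof -
      have "f m - d < (SUP n. exp (\<sigma> * real n) * cmod (x n m))" using d by (simp add: f_def)
      then show ?thesis using less_cSUP_iff[OF UNIV_not_empty bdd] by blast
    qed
    \<comment> \<open>The rows \<open>s m\<close> nearly attain the suprema, with total error at most \<open>e\<close> on \<open>A\<close>.\<close>
    then obtain s where s: "f m - d < exp (\<sigma> * real (s m)) * cmod (x (s m) m)" for m
      by metis
    have "(\<Sum>m\<in>A. w m * f m) \<le> (\<Sum>m\<in>A. w m * (exp (\<sigma> * real (s m)) * cmod (x (s m) m)) + d * w m)"
    proof (rule sum_mono)
      fix m
      have "w m * f m \<le> w m * (exp (\<sigma> * real (s m)) * cmod (x (s m) m) + d)"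
        using s[of m] by (intro mult_left_mono w_nonneg) simp
      then show "w m * f m \<le> w m * (exp (\<sigma> * real (s m)) * cmod (x (s m) m)) + d * w m"
        by (simp add: algebra_simps)
    qed
    also have "\<dots> \<le> r + d * (\<Sum>m\<in>A. w m)"
      unfolding sum.distrib sum_distrib_left[symmetric] using bdD[OF assms A] by simp
    also have "d * (\<Sum>m\<in>A. w m) \<le> d * (1 + (\<Sum>m\<in>A. w m))" using d by simp
    also have "d * (1 + (\<Sum>m\<in>A. w m)) = e" using W unfolding d_def by simp
    finally show "(\<Sum>m\<in>A. w m * f m) \<le> r + e" by simp
  qed
  have sm: "(\<lambda>m. w m * f m) summable_on UNIV"
    by (rule nonneg_bdd_above_summable_on) (auto intro!: bdd_aboveI[of _ r] fin simp: w_nonneg f0)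
  show "x \<in> vecs (Lsp \<sigma> w)"
    using bdd sm unfolding f_def by (simp add: Lsp_def)
  have "infsum (\<lambda>m. w m * f m) UNIV \<le> r"
    by (rule infsum_le_finite_sums[OF sm]) (rule fin)
  then show "nrm (Lsp \<sigma> w) x \<le> r" unfolding f_def by (simp add: Lsp_def)
qed

lemma Lsp_majorant:
  assumes "x \<in> vecs (Lsp \<sigma> w)"
  obtains f where "\<And>n m. exp (\<sigma> * real n) * cmod (x n m) \<le> f m" "\<And>m. 0 \<le> f m"
    "(\<lambda>m. w m * f m) summable_on UNIV" "(\<Sum>\<^sub>\<infinity>m. w m * f m) = nrm (Lsp \<sigma> w) x"
proof
  let ?f = "\<lambda>m. SUP n. exp (\<sigma> * real n) * cmod (x n m)"
  have bdd: "bdd_above (range (\<lambda>n. exp (\<sigma> * real n) * cmod (x n m)))" for m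
    using assms by (simp add: Lsp_def)
  show ge: "exp (\<sigma> * real n) * cmod (x n m) \<le> ?f m" for n m
    by (rule cSUP_upper[OF _ bdd]) simp
  show "0 \<le> ?f m" for m by (rule order_trans[OF _ ge[of 0 m]]) simp
  show "(\<lambda>m. w m * ?f m) summable_on UNIV" "(\<Sum>\<^sub>\<infinity>m. w m * ?f m) = nrm (Lsp \<sigma> w) x"
    using assms by (simp_all add: Lsp_def)
qed

lemma bd_majorantI:
  assumes "\<And>n m. exp (\<sigma> * real n) * cmod (x n m) \<le> f m"
    "(\<lambda>m. w m * f m) summable_on UNIV" "(\<Sum>\<^sub>\<infinity>m. w m * f m) \<le> r"
  shows "bd \<sigma> x r"
proof (rule bdI)
  fix A :: "int set" and s assume A: "finite A"
  have f0: "0 \<le> f m" for m by (rule order_trans[OF _ assms(1)[of 0 m]]) simp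
  have "sel \<sigma> x s A \<le> (\<Sum>m\<in>A. w m * f m)"
    by (intro sum_mono mult_left_mono assms w_nonneg)
  also have "\<dots> \<le> (\<Sum>\<^sub>\<infinity>m. w m * f m)"
    by (rule finite_sum_le_infsum) (simp_all add: assms A w_nonneg f0)
  also have "\<dots> \<le> r" by fact
  finally show "sel \<sigma> x s A \<le> r" .
qed

lemma bd_iff: "bd \<sigma> x r \<longleftrightarrow> x \<in> vecs (Lsp \<sigma> w) \<and> nrm (Lsp \<sigma> w) x \<le> r"
proof
  assume R: "x \<in> vecs (Lsp \<sigma> w) \<and> nrm (Lsp \<sigma> w) x \<le> r"
  from Lsp_majorant[OF conjunct1[OF this]] obtain f where
    "\<And>n m. exp (\<sigma> * real n) * cmod (x n m) \<le> f m"
    "(\<lambda>m. w m * f m) summable_on UNIV" "(\<Sum>\<^sub>\<infinity>m. w m * f m) = nrm (Lsp \<sigma> w) x" by metis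
  then show "bd \<sigma> x r" using R by (intro bd_majorantI) auto
qed (simp add: bd_Lsp)

lemma bd_majorant:
  assumes "bd \<sigma> x r"
  obtains f where "\<And>n m. exp (\<sigma> * real n) * cmod (x n m) \<le> f m" "\<And>m. 0 \<le> f m"
    "(\<lambda>m. w m * f m) summable_on UNIV" "(\<Sum>\<^sub>\<infinity>m. w m * f m) \<le> r"
  using Lsp_majorant[OF bd_Lsp(1)[OF assms]] bd_Lsp(2)[OF assms] by metis

lemma bd_row_summable:
  assumes "bd \<sigma> x r" shows "x n abs_summable_on UNIV"
proof -
  from bd_majorant[OF assms] obtain f where f: "\<And>n m. exp (\<sigma> * real n) * cmod (x n m) \<le> f m"
    "\<And>m. 0 \<le> f m" "(\<lambda>m. w m * f m) summable_on UNIV" by metis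
  show ?thesis
  proof (rule Infinite_Sum.abs_summable_on_comparison_test'[where g = "\<lambda>m. exp (- \<sigma> * real n) * (w m * f m)"])
    show "(\<lambda>m. exp (- \<sigma> * real n) * (w m * f m)) summable_on UNIV"
      by (rule summable_on_cmult_right[OF f(3)])
    fix m
    have "cmod (x n m) = exp (- \<sigma> * real n) * (1 * (exp (\<sigma> * real n) * cmod (x n m)))"
      unfolding mult_1 mult.assoc[symmetric] exp_add[symmetric] by simp
    also have "\<dots> \<le> exp (- \<sigma> * real n) * (w m * f m)"
      by (intro mult_left_mono mult_mono f w_ge_1 w_nonneg) simp_all
    finally show "norm (x n m) \<le> exp (- \<sigma> * real n) * (w m * f m)" .
  qed
qed

text \<open>
  Convolution acts only on \<open>m\<close>, so for each \<open>n\<close> the factor \<open>exp ((\<sigma> + \<tau>) * n)\<close> can be distributed over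
  the two factors: the exponents of decay add up. Hence a product is still controlled when one factor
  grows in \<open>n\<close>, provided the other one decays. In \<open>m\<close> the bound is Young's inequality, in which
  \<open>w m \<le> w (m - l) * w l\<close> splits the weight.
\<close>

lemma bd_mult:
  assumes "bd \<sigma> (sq a) r" "bd \<tau> (sq b) s"
  shows "bd (\<sigma> + \<tau>) (sq (a * b)) (r * s)"
proof -
  from bd_majorant[OF assms(1)] obtain f where f: "\<And>n m. exp (\<sigma> * real n) * cmod (sq a n m) \<le> f m"
    "\<And>m. 0 \<le> f m" "(\<lambda>m. w m * f m) summable_on UNIV" "(\<Sum>\<^sub>\<infinity>m. w m * f m) \<le> r" by metis
  from bd_majorant[OF assms(2)] obtain g where g: "\<And>n m. exp (\<tau> * real n) * cmod (sq b n m) \<le> g m"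
    "\<And>m. 0 \<le> g m" "(\<lambda>m. w m * g m) summable_on UNIV" "(\<Sum>\<^sub>\<infinity>m. w m * g m) \<le> s" by metis
  define F where "F m = w m * f m" for m
  define G where "G m = w m * g m" for m
  have F0: "0 \<le> F m" and G0: "0 \<le> G m" for m by (simp_all add: F_def G_def f g w_nonneg)
  have Fs: "F abs_summable_on UNIV" "G abs_summable_on UNIV"
    using f(3) g(3) by (simp_all add: F_def G_def f g w_nonneg abs_mult abs_of_nonneg)
  have row: "(\<lambda>l. F (m - l) * G l) summable_on UNIV" for m
    using Infinite_Sum.abs_summable_summable[OF shift_summable_row[OF Fs, of m]] .
  have le_FG: "w m * (f (m - l) * g l) \<le> F (m - l) * G l" for m l
  proof -
    have "w m * (f (m - l) * g l) \<le> (w (m - l) * w l) * (f (m - l) * g l)"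
      by (intro mult_right_mono w_submult mult_nonneg_nonneg f g)
    then show ?thesis by (simp add: F_def G_def mult_ac)
  qed
  have fgF: "f (m - l) * g l \<le> F (m - l) * G l" for m l
  proof -
    have "1 * (f (m - l) * g l) \<le> w m * (f (m - l) * g l)"
      by (intro mult_right_mono w_ge_1 mult_nonneg_nonneg f g)
    then show ?thesis using le_FG[of m l] by simp
  qed
  have fgs: "(\<lambda>l. f (m - l) * g l) summable_on UNIV" for m
    by (rule summable_on_comparison_test[OF row[of m]]) (simp_all add: fgF f g)
  define h where "h m = (\<Sum>\<^sub>\<infinity>l. f (m - l) * g l)" for m
  have wh: "w m * h m \<le> (\<Sum>\<^sub>\<infinity>l. F (m - l) * G l)" for m
  proof -
    have "w m * h m = (\<Sum>\<^sub>\<infinity>l. w m * (f (m - l) * g l))"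
      unfolding h_def by (simp add: infsum_cmult_right')
    also have "\<dots> \<le> (\<Sum>\<^sub>\<infinity>l. F (m - l) * G l)"
      by (rule infsum_mono[OF summable_on_cmult_right[OF fgs] row]) (rule le_FG)
    finally show ?thesis .
  qed
  have h0: "0 \<le> h m" for m unfolding h_def by (intro infsum_nonneg mult_nonneg_nonneg f g)
  have FGs: "(\<lambda>m. \<Sum>\<^sub>\<infinity>l. F (m - l) * G l) summable_on UNIV"
    using Infinite_Sum.abs_summable_summable[OF shift_summable_sum[OF Fs]] .
  have whs: "(\<lambda>m. w m * h m) summable_on UNIV"
    by (rule summable_on_comparison_test[OF FGs]) (simp_all add: wh h0 w_nonneg)
  show ?thesis
  proof (rule bd_majorantI[OF _ whs])
    have "(\<Sum>\<^sub>\<infinity>m. w m * h m) \<le> (\<Sum>\<^sub>\<infinity>m. \<Sum>\<^sub>\<infinity>l. F (m - l) * G l)"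
      by (rule infsum_mono[OF whs FGs wh])
    also have "\<dots> = (\<Sum>\<^sub>\<infinity>m. F m) * (\<Sum>\<^sub>\<infinity>l. G l)" by (rule infsum_shift_product[OF Fs])
    also have "\<dots> \<le> r * s"
      using f(4) g(4) bd_nonneg[OF assms(1)] unfolding F_def G_def
      by (intro mult_mono infsum_nonneg) (simp_all add: w_nonneg g)
    finally show "(\<Sum>\<^sub>\<infinity>m. w m * h m) \<le> r * s" .
  next
    fix n m
    let ?e = "exp ((\<sigma> + \<tau>) * real n)"
    have pt: "norm (?e * (sq a n (m - l) * sq b n l)) \<le> f (m - l) * g l" for l
    proof -
      have "norm (?e * (sq a n (m - l) * sq b n l)) =
          (exp (\<sigma> * real n) * cmod (sq a n (m - l))) * (exp (\<tau> * real n) * cmod (sq b n l))"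
        by (simp add: norm_mult distrib_right exp_add)
      also have "\<dots> \<le> f (m - l) * g l" by (intro mult_mono f g) simp_all
      finally show ?thesis .
    qed
    have S: "(\<lambda>l. ?e * (sq a n (m - l) * sq b n l)) abs_summable_on UNIV"
      by (rule Infinite_Sum.abs_summable_on_comparison_test'[OF fgs[of m] pt])
    have "?e * cmod (sq (a * b) n m) = norm (\<Sum>\<^sub>\<infinity>l. ?e * (sq a n (m - l) * sq b n l))"
      by (simp add: sq_mult conv_def infsum_cmult_right' norm_mult)
    also have "\<dots> \<le> (\<Sum>\<^sub>\<infinity>l. norm (?e * (sq a n (m - l) * sq b n l)))"
      by (rule norm_infsum_bound[OF S])
    also have "\<dots> \<le> h m"
      unfolding h_def by (rule infsum_mono[OF S fgs pt])
    finally show "?e * cmod (sq (a * b) n m) \<le> h m" .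
  qed
qed

lemma bd_series:
  assumes f: "\<And>k. bd \<sigma> (f k) (B k)" and B: "summable (\<lambda>k. \<bar>a k\<bar> * B k)"
  shows "summable (\<lambda>k. of_real (a k) * f k n m)"
    and "bd \<sigma> (\<lambda>n m. \<Sum>k. of_real (a k) * f k n m) (\<Sum>k. \<bar>a k\<bar> * B k)"
proof -
  have sm: "summable (\<lambda>k. of_real (a k) * f k n m)" for n m
  proof (rule summable_comparison_test)
    show "summable (\<lambda>k. exp (- \<sigma> * real n) * (\<bar>a k\<bar> * B k))" by (rule summable_mult[OF B])
    have "norm (of_real (a k) * f k n m) \<le> exp (- \<sigma> * real n) * (\<bar>a k\<bar> * B k)" for k
      using mult_left_mono[OF bd_point'[OF f, of k n m], of "\<bar>a k\<bar>"] by (simp add: norm_mult mult_ac)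
    then show "\<exists>N. \<forall>k\<ge>N. norm (of_real (a k) * f k n m) \<le> exp (- \<sigma> * real n) * (\<bar>a k\<bar> * B k)" by blast
  qed
  then show "summable (\<lambda>k. of_real (a k) * f k n m)" .
  have part: "bd \<sigma> (\<lambda>n m. \<Sum>k<N. of_real (a k) * f k n m) (\<Sum>k<N. \<bar>a k\<bar> * B k)" for N
  proof (induction N)
    case 0 then show ?case using bd_zero by (simp add: zero_fun_def)
  next
    case (Suc N)
    have "(\<lambda>n m. \<Sum>k<Suc N. of_real (a k) * f k n m) =
        (\<lambda>n m. \<Sum>k<N. of_real (a k) * f k n m) + a N *\<^sub>R f N"
      by (intro ext) (simp add: scaleR_fun_def scaleR_conv_of_real)
    then show ?case using bd_add[OF Suc bd_scaleR[OF f, of "a N" N]] by simp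
  qed
  show "bd \<sigma> (\<lambda>n m. \<Sum>k. of_real (a k) * f k n m) (\<Sum>k. \<bar>a k\<bar> * B k)"
    by (rule bd_limit[OF part summable_LIMSEQ[OF B] summable_LIMSEQ[OF sm]])
qed

lemma bd_of_nat_mult: "bd \<sigma> (sq a) r \<Longrightarrow> bd \<sigma> (sq (of_nat j * a)) (real j * r)"
proof -
  assume "bd \<sigma> (sq a) r"
  have "sq (of_nat j * a) = real j *\<^sub>R sq a"
    by (intro ext) (simp add: sq_of_nat_mult scaleR_fun_def scaleR_conv_of_real)
  then show ?thesis using bd_scaleR[OF \<open>bd \<sigma> (sq a) r\<close>, of "real j"] by simp
qed

end

section \<open>Taylor remainders of powers\<close>

text \<open>
  With \<open>P = (x + d)\<^sup>N\<close> and \<open>X\<close> the power of \<open>x\<close> with exponent \<open>N - 1\<close>, this expresses the first-order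
  Taylor remainder of the power \<open>N + 1\<close> by that of the power \<open>N\<close>.
\<close>

lemma power_remainder_step:
  fixes x d P X N :: "'a::comm_ring_1"
  shows "(x + d) * P - x * (x * X) - (N + 1) * (x * X) * d =
         (x + d) * (P - x * X - N * X * d) + N * X * (d * d)"
  by (simp add: algebra_simps)

context weighted
begin

lemma bd_eq: "bd \<sigma> (sq a) r \<Longrightarrow> a = b \<Longrightarrow> r = s \<Longrightarrow> bd \<sigma> (sq b) s"
  by simp

lemma bd_mult_left: "bd 0 (sq a) r \<Longrightarrow> bd \<tau> (sq b) s \<Longrightarrow> bd \<tau> (sq (a * b)) (r * s)"
  using bd_mult[of 0 a r \<tau> b s] by simp

lemma bd_sq_add: "bd \<sigma> (sq a) r \<Longrightarrow> bd \<sigma> (sq b) s \<Longrightarrow> bd \<sigma> (sq (a + b)) (r + s)"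
  by (simp add: sq_add bd_add)

text \<open>
  Only positive powers are bounded: the norm of the unit of the ring is \<open>w 0\<close>, which may exceed 1.
  For the same reason the inductions below start at the lowest degree in which the remainder in
  question is a multiple of \<open>d\<close>, \<open>d * d\<close>, \<open>y * d\<close> or \<open>y * d * d\<close>, and never introduce a unit.
\<close>

lemma bd_power: "bd 0 (sq x) r \<Longrightarrow> bd 0 (sq (x ^ Suc k)) (r ^ Suc k)"
proof (induction k)
  case (Suc k)
  then show ?case using bd_mult_left[of x r 0 "x ^ Suc k" "r ^ Suc k"] by simp
qed simp

text \<open>
  In this and the next three lemmas \<open>r\<close> bounds all points between which differences are taken, in the
  exponent 0. The increments \<open>d\<close> and \<open>y\<close> are measured in exponents of their own, which add up in the
  result, and the coefficients are those of the corresponding derivative of the power.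
\<close>

lemma bd_power_diff:
  assumes x: "bd 0 (sq x) r" and xd: "bd 0 (sq (x + d)) r" and d: "bd \<sigma> (sq d) s"
  shows "bd \<sigma> (sq ((x + d) ^ Suc k - x ^ Suc k)) (real (Suc k) * r ^ k * s)"
proof (induction k)
  case 0 then show ?case using d by simp
next
  case (Suc k)
  show ?case
    by (rule bd_eq[OF bd_sq_add[OF bd_mult_left[OF xd Suc.IH] bd_mult_left[OF bd_power[OF x, of k] d]]])
       (simp_all add: algebra_simps)
qed

lemma bd_power_remainder:
  assumes x: "bd 0 (sq x) r" and xd: "bd 0 (sq (x + d)) r" and d: "bd \<tau> (sq d) s"
  shows "bd (\<tau> + \<tau>) (sq ((x + d) ^ (k + 2) - x ^ (k + 2) - of_nat (k + 2) * x ^ (k + 1) * d))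
           (real ((k + 2) * (k + 1)) * r ^ k * (s * s))"
proof (induction k)
  case 0
  have "bd (\<tau> + \<tau>) (sq (d * d)) (2 * (s * s))"
    using bd_mono[OF bd_mult[OF d d]] bd_nonneg[OF d] by simp
  then show ?case by (rule bd_eq) (simp_all add: algebra_simps power2_eq_square)
next
  case (Suc k)
  let ?R = "(x + d) ^ (k + 2) - x ^ (k + 2) - of_nat (k + 2) * x ^ (k + 1) * d"
  have *: "(x + d) ^ (Suc k + 2) - x ^ (Suc k + 2) - of_nat (Suc k + 2) * x ^ (Suc k + 1) * d =
      (x + d) * ?R + of_nat (k + 2) * (x ^ Suc k * (d * d))"
    using power_remainder_step[of x d "(x + d) ^ (k + 2)" "x ^ (k + 1)" "of_nat (k + 2)"]
    by (simp add: mult.assoc add.commute)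
  have r0: "0 \<le> r" by (rule bd_nonneg[OF x])
  have "bd (\<tau> + \<tau>) (sq ((x + d) * ?R + of_nat (k + 2) * (x ^ Suc k * (d * d))))
     (r * (real ((k + 2) * (k + 1)) * r ^ k * (s * s)) + real (k + 2) * (r ^ Suc k * (s * s)))"
    by (rule bd_sq_add[OF bd_mult_left[OF xd Suc.IH] bd_of_nat_mult[OF bd_mult_left[OF bd_power[OF x] bd_mult[OF d d]]]])
  then have "bd (\<tau> + \<tau>) (sq ((x + d) * ?R + of_nat (k + 2) * (x ^ Suc k * (d * d))))
      (real ((Suc k + 2) * (Suc k + 1)) * r ^ Suc k * (s * s))"
  proof (rule bd_mono)
    have "real (k + 2) * real (k + 2) * (r ^ Suc k * (s * s)) \<le> real ((Suc k + 2) * (Suc k + 1)) * (r ^ Suc k * (s * s))"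
      using r0 bd_nonneg[OF d] by (intro mult_right_mono) (simp_all add: algebra_simps)
    then show "r * (real ((k + 2) * (k + 1)) * r ^ k * (s * s)) + real (k + 2) * (r ^ Suc k * (s * s))
        \<le> real ((Suc k + 2) * (Suc k + 1)) * r ^ Suc k * (s * s)"
      by (simp add: algebra_simps)
  qed
  then show ?case by (simp only: *)
qed

lemma bd_power_mixed:
  assumes x: "bd 0 (sq x) r" and xd: "bd 0 (sq (x + d)) r" and xy: "bd 0 (sq (x + y)) r"
    and xdy: "bd 0 (sq (x + d + y)) r" and d: "bd \<tau> (sq d) t" and y: "bd \<sigma> (sq y) s"
  shows "bd (\<sigma> + \<tau>) (sq ((x + d + y) ^ (k + 2) - (x + d) ^ (k + 2) - (x + y) ^ (k + 2) + x ^ (k + 2)))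
           (real ((k + 2) * (k + 1)) * r ^ k * (s * t))"
proof (induction k)
  case 0
  have "bd (\<sigma> + \<tau>) (sq (of_nat 2 * (y * d))) (real 2 * (s * t))"
    by (rule bd_of_nat_mult[OF bd_mult[OF y d]])
  then show ?case by (rule bd_eq) (simp_all add: algebra_simps power2_eq_square)
next
  case (Suc k)
  let ?D = "(x + d + y) ^ (k + 2) - (x + d) ^ (k + 2) - (x + y) ^ (k + 2) + x ^ (k + 2)"
  have *: "(x + d + y) ^ (Suc k + 2) - (x + d) ^ (Suc k + 2) - (x + y) ^ (Suc k + 2) + x ^ (Suc k + 2) =
     (x + d + y) * ?D + (y * ((x + d) ^ Suc (Suc k) - x ^ Suc (Suc k)) + d * ((x + y) ^ Suc (Suc k) - x ^ Suc (Suc k)))"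
    by (simp add: algebra_simps)
  have "bd (\<sigma> + \<tau>) (sq (d * ((x + y) ^ Suc (Suc k) - x ^ Suc (Suc k)))) (t * (real (Suc (Suc k)) * r ^ Suc k * s))"
    using bd_mult[OF d bd_power_diff[OF x xy y, of "Suc k"]] by (simp add: add.commute)
  from bd_sq_add[OF bd_mult_left[OF xdy Suc.IH] bd_sq_add[OF bd_mult[OF y bd_power_diff[OF x xd d, of "Suc k"]] this]]
  show ?case unfolding * by (rule bd_eq) (simp_all add: algebra_simps)
qed

lemma bd_power_remainder_diff:
  assumes x: "bd 0 (sq x) r" and xd: "bd 0 (sq (x + d)) r" and xy: "bd 0 (sq (x + y)) r"
    and xyd: "bd 0 (sq (x + y + d)) r" and d: "bd \<tau> (sq d) t" and y: "bd \<sigma> (sq y) s"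
  shows "bd (\<sigma> + (\<tau> + \<tau>)) (sq (((x + y + d) ^ (k + 3) - (x + y) ^ (k + 3) - of_nat (k + 3) * (x + y) ^ (k + 2) * d)
             - ((x + d) ^ (k + 3) - x ^ (k + 3) - of_nat (k + 3) * x ^ (k + 2) * d)))
           (real ((k + 3) * (k + 2) * (k + 1)) * r ^ k * (s * (t * t)))"
proof (induction k)
  case 0
  have "bd (\<sigma> + (\<tau> + \<tau>)) (sq (of_nat 3 * (y * (d * d)))) (6 * (s * (t * t)))"
    using bd_mono[OF bd_of_nat_mult[OF bd_mult[OF y bd_mult[OF d d]], of 3]] bd_nonneg[OF d] bd_nonneg[OF y] by simp
  then show ?case by (rule bd_eq) (simp_all add: algebra_simps power3_eq_cube power2_eq_square)
next
  case (Suc k)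
  let ?R = "\<lambda>x j. (x + d) ^ (j + 1) - x ^ (j + 1) - of_nat (j + 1) * x ^ j * d"
  have step: "?R z (Suc k + 2) = (z + d) * ?R z (k + 2) + of_nat (k + 3) * (z ^ Suc (Suc k) * (d * d))" for z
    using power_remainder_step[of z d "(z + d) ^ (k + 3)" "z ^ (k + 2)" "of_nat (k + 3)"]
    by (simp add: mult.assoc add.commute numeral_eq_Suc)
  have *: "?R (x + y) (Suc k + 2) - ?R x (Suc k + 2) =
      (x + d) * (?R (x + y) (k + 2) - ?R x (k + 2)) +
      (y * ?R (x + y) (k + 2) + of_nat (k + 3) * (((x + y) ^ Suc (Suc k) - x ^ Suc (Suc k)) * (d * d)))"
    unfolding step by (simp only: algebra_simps)
  have r0: "0 \<le> r" by (rule bd_nonneg[OF x])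
  have IH: "bd (\<sigma> + (\<tau> + \<tau>)) (sq (?R (x + y) (k + 2) - ?R x (k + 2))) (real ((k + 3) * (k + 2) * (k + 1)) * r ^ k * (s * (t * t)))"
    using Suc.IH by (simp add: numeral_eq_Suc)
  have R: "bd (\<tau> + \<tau>) (sq (?R (x + y) (k + 2))) (real ((Suc k + 2) * (Suc k + 1)) * r ^ Suc k * (t * t))"
    using bd_power_remainder[OF xy xyd d, of "Suc k"] by (simp add: numeral_eq_Suc)
  note b = bd_sq_add[OF bd_mult_left[OF xd IH] bd_sq_add[OF bd_mult[OF y R]
     bd_of_nat_mult[OF bd_mult[OF bd_power_diff[OF x xy y, of "Suc k"] bd_mult[OF d d]], of "k + 3"]]]
  have "bd (\<sigma> + (\<tau> + \<tau>)) (sq (?R (x + y) (Suc k + 2) - ?R x (Suc k + 2)))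
     (real ((Suc k + 3) * (Suc k + 2) * (Suc k + 1)) * r ^ Suc k * (s * (t * t)))"
    unfolding *
  proof (rule bd_mono[OF b])
    have p: "0 \<le> r ^ Suc k * (s * (t * t))" using r0 bd_nonneg[OF y] by simp
    have "real (k + 3) * (real (k + 2) * real (k + 3)) * (r ^ Suc k * (s * (t * t)))
        \<le> real ((Suc k + 3) * (Suc k + 2) * (Suc k + 1)) * (r ^ Suc k * (s * (t * t)))"
      using p by (intro mult_right_mono) (simp_all add: algebra_simps)
    then show "r * (real ((k + 3) * (k + 2) * (k + 1)) * r ^ k * (s * (t * t))) +
      (s * (real ((Suc k + 2) * (Suc k + 1)) * r ^ Suc k * (t * t)) +
       real (k + 3) * (real (Suc (Suc k)) * r ^ Suc k * s * (t * t)))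
      \<le> real ((Suc k + 3) * (Suc k + 2) * (Suc k + 1)) * r ^ Suc k * (s * (t * t))"
      by (simp add: algebra_simps)
  qed
  then show ?case by (simp add: numeral_eq_Suc)
qed

end

section \<open>Power series of row differences\<close>

text \<open>
  All series have coefficients \<open>a k\<close> and terms in the convolution ring, and are summed entry by entry.
  With \<open>a\<close> the Taylor coefficients from degree 2 on, \<open>Gs a u\<close> is the nonlinearity applied to the row
  differences of \<open>u\<close>, so that \<open>Y u v = Gs a (u + v) - Gs a u\<close>, and \<open>DGs a u x\<close> is its derivative at \<open>u\<close> in
  direction \<open>x\<close>. The direction may grow in \<open>n\<close>, since the sum is not taken in a Banach algebra.
\<close>

definition ser :: "(nat \<Rightarrow> real) \<Rightarrow> (nat \<Rightarrow> aseq) \<Rightarrow> seq" where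
  "ser a f n m = (\<Sum>k. of_real (a k) * sq (f k) n m)"

definition dtri :: "seq \<Rightarrow> aseq" where "dtri u = Abs_aseq (tri u)"

definition Gs :: "(nat \<Rightarrow> real) \<Rightarrow> seq \<Rightarrow> seq" where
  "Gs a u = ser a (\<lambda>k. dtri u ^ (k + 2))"

definition DGs :: "(nat \<Rightarrow> real) \<Rightarrow> seq \<Rightarrow> seq \<Rightarrow> seq" where
  "DGs a u x = ser a (\<lambda>k. of_nat (k + 2) * dtri u ^ (k + 1) * dtri x)"

definition rows_summable :: "seq \<Rightarrow> bool" where
  "rows_summable u \<longleftrightarrow> (\<forall>n. u n abs_summable_on UNIV)"

lemma rows_summable_add: "rows_summable u \<Longrightarrow> rows_summable v \<Longrightarrow> rows_summable (u + v)"
  unfolding rows_summable_def plus_fun_def using abs_summable_add by blast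

lemma rows_summable_diff: "rows_summable u \<Longrightarrow> rows_summable v \<Longrightarrow> rows_summable (u - v)"
  unfolding rows_summable_def fun_diff_def using abs_summable_diff by blast

lemma rows_summable_scaleR:
  assumes "rows_summable u" shows "rows_summable (c *\<^sub>R u)"
proof -
  have "(\<lambda>m. \<bar>c\<bar> * norm (u n m)) summable_on UNIV" for n
    using assms by (intro summable_on_cmult_right) (simp add: rows_summable_def)
  then show ?thesis by (simp add: rows_summable_def scaleR_fun_def)
qed

lemma rows_summable_tri:
  assumes "rows_summable u" shows "rows_summable (tri u)"
  unfolding rows_summable_def
proof
  fix n
  have "(\<lambda>m. u (n - 1) m - u n m) abs_summable_on UNIV"
    using assms by (intro abs_summable_diff) (auto simp: rows_summable_def)
  then show "tri u n abs_summable_on UNIV"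
    by (cases "n = 0") (simp_all add: tri_def)
qed

lemma sq_dtri: "rows_summable u \<Longrightarrow> sq (dtri u) = tri u"
  unfolding dtri_def using rows_summable_tri by (intro Abs_aseq_inverse) (auto simp: rows_summable_def)

lemma dtri_add:
  assumes "rows_summable u" "rows_summable v" shows "dtri (u + v) = dtri u + dtri v"
proof -
  have "sq (dtri (u + v)) = sq (dtri u + dtri v)"
    unfolding sq_add sq_dtri[OF assms(1)] sq_dtri[OF assms(2)] sq_dtri[OF rows_summable_add[OF assms]]
    by (intro ext) (simp add: tri_def)
  then show ?thesis by (simp add: Rep_aseq_inject)
qed

lemma dtri_diff:
  assumes "rows_summable u" "rows_summable v" shows "dtri (u - v) = dtri u - dtri v"
  using dtri_add[OF rows_summable_diff[OF assms] assms(2)] by simp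

lemma tri_scaleR: "tri (c *\<^sub>R u) = c *\<^sub>R tri u"
  by (intro ext) (simp add: tri_def scaleR_fun_def scaleR_diff_right)

lemma conv_scaleR_right: "conv x (\<lambda>m. c *\<^sub>R y m) m = c *\<^sub>R conv x y m"
  unfolding conv_def mult_scaleR_right by (rule infsum_scaleR_right)

text \<open>
  The symmetry of Fourier coefficients of real-valued functions.
\<close>

definition csym :: "seq \<Rightarrow> bool" where
  "csym x \<longleftrightarrow> (\<forall>n m. x n (- m) = cnj (x n m))"

lemma conv_cnj:
  assumes "\<And>m. x (- m) = cnj (x m)" "\<And>m. y (- m) = cnj (y m)"
  shows "conv x y (- m) = cnj (conv x y m)"
proof -
  have "conv x y (- m) = (\<Sum>\<^sub>\<infinity>l. cnj (x (m - l) * y l))"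
    unfolding conv_def
  proof (rule infsum_reindex_bij_witness[where i = uminus and j = uminus])
    fix l
    have e: "- m - l = - (m + l)" by simp
    have "x (- m - l) = cnj (x (m + l))" unfolding e by (rule assms(1))
    then show "cnj (x (m - - l) * y (- l)) = x (- m - l) * y l" by (simp add: assms(2))
  qed auto
  then show ?thesis unfolding conv_def infsum_cnj .
qed

lemma csym_mult: "csym (sq a) \<Longrightarrow> csym (sq b) \<Longrightarrow> csym (sq (a * b))"
  unfolding csym_def by (simp add: sq_mult conv_cnj)

lemma csym_power: "csym (sq a) \<Longrightarrow> csym (sq (a ^ Suc k))"
proof (induction k)
  case (Suc k) then show ?case using csym_mult[of a "a ^ Suc k"] by simp
qed simp

lemma csym_dtri: "rows_summable u \<Longrightarrow> csym u \<Longrightarrow> csym (sq (dtri u))"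
  unfolding csym_def by (simp add: sq_dtri tri_def)

lemma csym_add: "csym x \<Longrightarrow> csym y \<Longrightarrow> csym (x + y)"
  and csym_diff: "csym x \<Longrightarrow> csym y \<Longrightarrow> csym (x - y)"
  unfolding csym_def by simp_all

context weighted
begin

lemma bd_rows_summable: "bd \<sigma> x r \<Longrightarrow> rows_summable x"
  unfolding rows_summable_def using bd_row_summable by blast

lemma bd_tri:
  assumes "bd \<sigma> x r" shows "bd \<sigma> (tri x) ((1 + exp \<sigma>) * r)"
proof -
  from bd_majorant[OF assms] obtain f where f: "\<And>n m. exp (\<sigma> * real n) * cmod (x n m) \<le> f m"
    "\<And>m. 0 \<le> f m" "(\<lambda>m. w m * f m) summable_on UNIV" "(\<Sum>\<^sub>\<infinity>m. w m * f m) \<le> r" by metis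
  have s: "(\<lambda>m. w m * ((1 + exp \<sigma>) * f m)) summable_on UNIV"
    using summable_on_cmult_right[OF f(3), of "1 + exp \<sigma>"] by (simp add: mult_ac)
  show ?thesis
  proof (rule bd_majorantI[OF _ s])
    fix n m
    show "exp (\<sigma> * real n) * cmod (tri x n m) \<le> (1 + exp \<sigma>) * f m"
    proof (cases n)
      case 0 then show ?thesis using f(2)[of m] by (simp add: tri_def)
    next
      case (Suc j)
      have "exp (\<sigma> * real n) * cmod (tri x n m) \<le> exp (\<sigma> * real n) * (cmod (x j m) + cmod (x n m))"
        using Suc by (intro mult_left_mono) (simp_all add: tri_def norm_triangle_ineq4)
      also have "\<dots> = exp \<sigma> * (exp (\<sigma> * real j) * cmod (x j m)) + exp (\<sigma> * real n) * cmod (x n m)"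
        using Suc by (simp add: algebra_simps exp_add)
      also have "\<dots> \<le> exp \<sigma> * f m + f m"
        by (intro add_mono mult_left_mono f) simp
      finally show ?thesis by (simp add: algebra_simps)
    qed
  next
    have "(\<Sum>\<^sub>\<infinity>m. w m * ((1 + exp \<sigma>) * f m)) = (1 + exp \<sigma>) * (\<Sum>\<^sub>\<infinity>m. w m * f m)"
      by (simp add: infsum_cmult_right'[symmetric] mult_ac)
    also have "\<dots> \<le> (1 + exp \<sigma>) * r" by (intro mult_left_mono f) (simp add: add_nonneg_nonneg)
    finally show "(\<Sum>\<^sub>\<infinity>m. w m * ((1 + exp \<sigma>) * f m)) \<le> (1 + exp \<sigma>) * r" .
  qed
qed

text \<open>
  The constant comes from \<open>1 + exp 1 \<le> 4\<close>. It is uniform in the exponents that occur, all at most 1.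
\<close>

lemma bd_dtri:
  assumes "bd \<sigma> x s" "\<sigma> \<le> 1" shows "bd \<sigma> (sq (dtri x)) (4 * s)"
proof -
  have "exp \<sigma> \<le> exp 1" using assms(2) by simp
  also have "exp (1::real) \<le> 3" by (rule exp_le)
  finally have "(1 + exp \<sigma>) * s \<le> 4 * s"
    using bd_nonneg[OF assms(1)] by (intro mult_right_mono) simp_all
  then show ?thesis
    using bd_mono[OF bd_tri[OF assms(1)]] sq_dtri[OF bd_rows_summable[OF assms(1)]] by simp
qed

end

text \<open>
  The radius \<open>r\<close> lies inside the disc of convergence of the series with coefficients \<open>a\<close>. The estimates
  below involve at most three increments; every one of them costs a derivative of a power of degree
  \<open>k + 2\<close>. The factor \<open>(k + 2)\<^sup>3\<close> and the exponent \<open>k - 1\<close> allow for all cases at once, by \<open>r \<le> 1\<close>.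
\<close>

locale weighted_series = weighted +
  fixes a :: "nat \<Rightarrow> real" and r :: real
  assumes r_pos: "0 < r" and r_le_1: "r \<le> 1"
    and summable_coeff: "summable (\<lambda>k. \<bar>a k\<bar> * (real (k + 2) ^ 3 * r ^ (k - 1)))"
begin

definition maj :: "nat \<Rightarrow> real" where "maj k = real (k + 2) ^ 3 * r ^ (k - 1)"

text \<open>
  Each increment passes through \<open>dtri\<close> and contributes a factor 4; three of them give 64.
\<close>

definition MM :: real where "MM = 64 * (\<Sum>k. \<bar>a k\<bar> * maj k)"

lemma maj_nonneg: "0 \<le> maj k"
  unfolding maj_def using r_pos by simp

lemma MM_nonneg: "0 \<le> MM"
proof -
  have "summable (\<lambda>k. \<bar>a k\<bar> * maj k)" using summable_coeff unfolding maj_def .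
  then have "0 \<le> (\<Sum>k. \<bar>a k\<bar> * maj k)" by (rule suminf_nonneg) (simp add: maj_nonneg)
  then show ?thesis unfolding MM_def by simp
qed

lemma maj_ge:
  assumes "c \<le> real (k + 2) ^ 3" "k - 1 \<le> j" "0 \<le> c" shows "c * r ^ j \<le> maj k"
  unfolding maj_def using assms r_pos r_le_1
  by (intro mult_mono power_decreasing) simp_all

lemma cube_ge1: "1 \<le> real (k + 2) ^ 3"
  by (rule one_le_power) simp

lemma cube_ge2: "real (k + 2) \<le> real (k + 2) ^ 3"
  using power_increasing[of 1 3 "real (k + 2)"] by simp

lemma cube_ge3: "real ((k + 2) * (k + 1)) \<le> real (k + 2) ^ 3"
proof -
  have "(k + 2) * (k + 1) \<le> (k + 2) ^ 3" by (simp add: power3_eq_cube algebra_simps)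
  then have "real ((k + 2) * (k + 1)) \<le> real ((k + 2) ^ 3)" by (simp only: of_nat_le_iff)
  then show ?thesis by (simp only: of_nat_power)
qed

lemma cube_ge4: "real ((k + 2) * ((k + 1) * k)) \<le> real (k + 2) ^ 3"
proof -
  have "(k + 2) * ((k + 1) * k) \<le> (k + 2) ^ 3" by (simp add: power3_eq_cube algebra_simps)
  then have "real ((k + 2) * ((k + 1) * k)) \<le> real ((k + 2) ^ 3)" by (simp only: of_nat_le_iff)
  then show ?thesis by (simp only: of_nat_power)
qed

definition dominated :: "(nat \<Rightarrow> aseq) \<Rightarrow> bool" where
  "dominated f \<longleftrightarrow> (\<exists>\<sigma> s. \<forall>k. bd \<sigma> (sq (f k)) (maj k * s))"

lemma dominatedI: "(\<And>k. bd \<sigma> (sq (f k)) (maj k * s)) \<Longrightarrow> dominated f"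
  unfolding dominated_def by blast

lemma summable_maj: "summable (\<lambda>k. \<bar>a k\<bar> * (maj k * s))"
  using summable_mult2[OF summable_coeff, of s] by (simp add: maj_def mult.assoc)

lemma ser_summable:
  assumes "dominated f" shows "summable (\<lambda>k. of_real (a k) * sq (f k) n m)"
proof -
  from assms obtain \<sigma> s where "\<And>k. bd \<sigma> (sq (f k)) (maj k * s)" unfolding dominated_def by blast
  from bd_series(1)[of \<sigma> "\<lambda>k. sq (f k)" "\<lambda>k. maj k * s" a, OF this summable_maj] show ?thesis .
qed

lemma ser_bd:
  assumes "\<And>k. bd \<sigma> (sq (f k)) (maj k * (64 * s))" shows "bd \<sigma> (ser a f) (MM * s)"
proof -
  have "(\<Sum>k. \<bar>a k\<bar> * (maj k * (64 * s))) = MM * s"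
    using suminf_mult2[OF summable_coeff, of "64 * s"] by (simp add: MM_def maj_def mult_ac)
  then show ?thesis
    using bd_series(2)[of \<sigma> "\<lambda>k. sq (f k)" "\<lambda>k. maj k * (64 * s)" a, OF assms summable_maj]
    unfolding ser_def[abs_def] by simp
qed

lemma dominated_diff:
  assumes "dominated f" "dominated g" shows "dominated (\<lambda>k. f k - g k)"
proof -
  from assms obtain \<sigma> s \<tau> t where f: "\<And>k. bd \<sigma> (sq (f k)) (maj k * s)" and g: "\<And>k. bd \<tau> (sq (g k)) (maj k * t)"
    unfolding dominated_def by blast
  have "bd (min \<sigma> \<tau>) (sq (f k - g k)) (maj k * (s + t))" for k
    using bd_diff[OF bd_exponent_mono[OF f[of k], of "min \<sigma> \<tau>"] bd_exponent_mono[OF g[of k], of "min \<sigma> \<tau>"]]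
    by (simp add: sq_diff distrib_left)
  then show ?thesis by (rule dominatedI)
qed

lemma ser_diff:
  assumes "dominated f" "dominated g" shows "ser a (\<lambda>k. f k - g k) = ser a f - ser a g"
proof (intro ext)
  fix n m
  show "ser a (\<lambda>k. f k - g k) n m = (ser a f - ser a g) n m"
    using suminf_diff[OF ser_summable[OF assms(1)] ser_summable[OF assms(2)], of n m n m]
    by (simp add: ser_def sq_diff algebra_simps)
qed

text \<open>
  Row differences at most double the norm for the exponent 0, so they stay within the radius \<open>r\<close>.
\<close>

definition in_disc :: "seq \<Rightarrow> bool" where "in_disc u \<longleftrightarrow> bd 0 u (r / 2)"

lemma in_disc_rows: "in_disc u \<Longrightarrow> rows_summable u"
  unfolding in_disc_def by (rule bd_rows_summable)

lemma in_disc_dtri: "in_disc u \<Longrightarrow> bd 0 (sq (dtri u)) r"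
  using bd_tri[of 0 u "r / 2"] sq_dtri[OF in_disc_rows] unfolding in_disc_def by simp

lemma bd_weaken: "bd \<sigma> (sq x) c \<Longrightarrow> c \<le> c' \<Longrightarrow> x = y \<Longrightarrow> bd \<sigma> (sq y) c'"
  using bd_mono by blast

lemma bd_le: "c * p \<le> e \<Longrightarrow> 0 \<le> t \<Longrightarrow> t \<le> s \<Longrightarrow> 0 \<le> c * p \<Longrightarrow> c * p * t \<le> e * (s::real)"
  by (rule mult_mono) auto

lemma Gs_term_bd:
  assumes "in_disc u" shows "bd 0 (sq (dtri u ^ (k + 2))) (maj k * 1)"
  using maj_ge[of 1 k "k + 2"] cube_ge1[of k]
  by (intro bd_weaken[OF bd_power[OF in_disc_dtri[OF assms], of "k + 1"]]) (simp_all add: numeral_eq_Suc)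

lemma Gs_dominated: "in_disc u \<Longrightarrow> dominated (\<lambda>k. dtri u ^ (k + 2))"
  by (rule dominatedI, rule Gs_term_bd)

lemma DGs_term_bd:
  assumes "in_disc u" "bd \<sigma> x s" "\<sigma> \<le> 1"
  shows "bd \<sigma> (sq (of_nat (k + 2) * dtri u ^ (k + 1) * dtri x)) (maj k * (64 * s))"
proof -
  have s0: "0 \<le> s" using bd_nonneg[OF assms(2)] .
  have b: "bd \<sigma> (sq (of_nat (k + 2) * (dtri u ^ Suc k * dtri x))) (real (k + 2) * (r ^ Suc k * (4 * s)))"
    by (rule bd_of_nat_mult[OF bd_mult_left[OF bd_power[OF in_disc_dtri[OF assms(1)]] bd_dtri[OF assms(2,3)]]])
  have "real (k + 2) * r ^ Suc k * (4 * s) \<le> maj k * (64 * s)"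
    using s0 r_pos by (intro bd_le maj_ge cube_ge2) simp_all
  then show ?thesis by (intro bd_weaken[OF b]) (simp_all add: mult_ac)
qed

lemma DGs_dominated:
  "in_disc u \<Longrightarrow> bd \<sigma> x s \<Longrightarrow> \<sigma> \<le> 1 \<Longrightarrow> dominated (\<lambda>k. of_nat (k + 2) * dtri u ^ (k + 1) * dtri x)"
  by (rule dominatedI, rule DGs_term_bd)

lemma DGs_diff_arg:
  assumes "in_disc u" "bd \<sigma> x s" "\<sigma> \<le> 1" "bd \<sigma> y t"
  shows "DGs a u (x - y) = DGs a u x - DGs a u y"
  unfolding DGs_def ser_diff[OF DGs_dominated[OF assms(1,2,3)] DGs_dominated[OF assms(1,4,3)], symmetric]
    dtri_diff[OF bd_rows_summable[OF assms(2)] bd_rows_summable[OF assms(4)]]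
  by (simp add: algebra_simps)

lemma DGs_scaleR:
  assumes "in_disc u" "bd \<sigma> x s" "\<sigma> \<le> 1"
  shows "DGs a u (c *\<^sub>R x) = c *\<^sub>R DGs a u x"
proof (intro ext)
  fix n m
  have rx: "rows_summable x" by (rule bd_rows_summable[OF assms(2)])
  have d: "sq (dtri (c *\<^sub>R x)) n = (\<lambda>m. c *\<^sub>R sq (dtri x) n m)" for n
    unfolding sq_dtri[OF rows_summable_scaleR[OF rx]] sq_dtri[OF rx] tri_scaleR by (simp add: scaleR_fun_def)
  have t: "of_real (a k) * sq (of_nat (k + 2) * dtri u ^ (k + 1) * dtri (c *\<^sub>R x)) n m =
      c *\<^sub>R (of_real (a k) * sq (of_nat (k + 2) * dtri u ^ (k + 1) * dtri x) n m)" for k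
    unfolding sq_mult[of "of_nat (k + 2) * dtri u ^ (k + 1)"] d conv_scaleR_right by simp
  have o: "(c *\<^sub>R DGs a u x) n m = c *\<^sub>R DGs a u x n m" by (simp add: scaleR_fun_def)
  have "DGs a u (c *\<^sub>R x) n m = c *\<^sub>R DGs a u x n m"
    unfolding DGs_def ser_def t
    by (rule suminf_scaleR_right[symmetric, OF ser_summable[OF DGs_dominated[OF assms]]])
  then show "DGs a u (c *\<^sub>R x) n m = (c *\<^sub>R DGs a u x) n m" by (simp only: o)
qed

lemma DGs_add_arg:
  assumes "in_disc u" "bd \<sigma> x s" "\<sigma> \<le> 1" "bd \<sigma> y t"
  shows "DGs a u (x + y) = DGs a u x + DGs a u y"
  using DGs_diff_arg[OF assms(1) bd_add[OF assms(2,4)] assms(3,4)] by simp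

text \<open>
  Each of the following estimates is one of the bounds on powers, applied to every term of the series.
  The last two measure how a derivative or a Taylor remainder at \<open>u\<close> changes when \<open>v\<close> is added to the
  base point: they gain the decay of \<open>v\<close>, which is what makes up for the growth of increments of \<open>u\<close>.
\<close>

lemma DGs_diff_bd:
  assumes u: "in_disc u" and u': "in_disc u'" and d: "bd \<sigma> (u' - u) d" "\<sigma> \<le> 1" and x: "bd \<tau> x s" "\<tau> \<le> 1"
  shows "bd (\<sigma> + \<tau>) (DGs a u' x - DGs a u x) (MM * (d * s))"
proof -
  let ?X = "dtri u" and ?D = "dtri (u' - u)" and ?Z = "dtri x"
  have XD: "dtri u' = ?X + ?D" using dtri_diff[OF in_disc_rows[OF u'] in_disc_rows[OF u]] by simp
  have d0: "0 \<le> d" "0 \<le> s" using bd_nonneg d x by blast+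
  have "bd (\<sigma> + \<tau>) (ser a (\<lambda>k. of_nat (k + 2) * dtri u' ^ (k + 1) * ?Z - of_nat (k + 2) * ?X ^ (k + 1) * ?Z)) (MM * (d * s))"
  proof (rule ser_bd)
    fix k
    have b: "bd (\<sigma> + \<tau>) (sq (of_nat (k + 2) * (((?X + ?D) ^ Suc k - ?X ^ Suc k) * ?Z)))
       (real (k + 2) * (real (Suc k) * r ^ k * (4 * d) * (4 * s)))"
      by (intro bd_of_nat_mult bd_mult bd_power_diff in_disc_dtri u bd_dtri d x) (simp add: XD[symmetric] in_disc_dtri u')
    have "real ((k + 2) * (k + 1)) * r ^ k * (16 * (d * s)) \<le> maj k * (64 * (d * s))"
      using d0 r_pos by (intro bd_le maj_ge cube_ge3) simp_all
    then show "bd (\<sigma> + \<tau>) (sq (of_nat (k + 2) * dtri u' ^ (k + 1) * ?Z - of_nat (k + 2) * ?X ^ (k + 1) * ?Z)) (maj k * (64 * (d * s)))"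
      by (intro bd_weaken[OF b]) (simp_all add: XD algebra_simps)
  qed
  then show ?thesis
    unfolding DGs_def ser_diff[OF DGs_dominated[OF u' x] DGs_dominated[OF u x]] .
qed

lemma Gs_remainder_bd:
  assumes u: "in_disc u" and u': "in_disc u'" and d: "bd \<sigma> (u' - u) d" "\<sigma> \<le> 1"
  shows "bd (\<sigma> + \<sigma>) (Gs a u' - Gs a u - DGs a u (u' - u)) (MM * (d * d))"
proof -
  let ?X = "dtri u" and ?D = "dtri (u' - u)"
  have XD: "dtri u' = ?X + ?D" using dtri_diff[OF in_disc_rows[OF u'] in_disc_rows[OF u]] by simp
  have "bd (\<sigma> + \<sigma>) (ser a (\<lambda>k. dtri u' ^ (k + 2) - ?X ^ (k + 2) - of_nat (k + 2) * ?X ^ (k + 1) * ?D)) (MM * (d * d))"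
  proof (rule ser_bd)
    fix k
    have b: "bd (\<sigma> + \<sigma>) (sq ((?X + ?D) ^ (k + 2) - ?X ^ (k + 2) - of_nat (k + 2) * ?X ^ (k + 1) * ?D))
       (real ((k + 2) * (k + 1)) * r ^ k * ((4 * d) * (4 * d)))"
      by (intro bd_power_remainder in_disc_dtri u bd_dtri d) (simp add: XD[symmetric] in_disc_dtri u')
    have "real ((k + 2) * (k + 1)) * r ^ k * (16 * (d * d)) \<le> maj k * (64 * (d * d))"
      using r_pos by (intro bd_le maj_ge cube_ge3) simp_all
    then show "bd (\<sigma> + \<sigma>) (sq (dtri u' ^ (k + 2) - ?X ^ (k + 2) - of_nat (k + 2) * ?X ^ (k + 1) * ?D)) (maj k * (64 * (d * d)))"
      by (intro bd_weaken[OF b]) (simp_all add: XD mult_ac)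
  qed
  then show ?thesis
    unfolding DGs_def Gs_def
      ser_diff[OF Gs_dominated[OF u'] Gs_dominated[OF u], symmetric]
      ser_diff[OF dominated_diff[OF Gs_dominated[OF u'] Gs_dominated[OF u]] DGs_dominated[OF u d], symmetric] .
qed

lemma Gs_mixed_bd:
  assumes u: "in_disc u" and u': "in_disc u'" and uv: "in_disc (u + v)" and u'v: "in_disc (u' + v)"
    and d: "bd \<tau> (u' - u) t" "\<tau> \<le> 1" and v: "bd \<sigma> v s" "\<sigma> \<le> 1"
  shows "bd (\<sigma> + \<tau>) ((Gs a (u' + v) - Gs a u') - (Gs a (u + v) - Gs a u)) (MM * (s * t))"
proof -
  let ?X = "dtri u" and ?D = "dtri (u' - u)" and ?V = "dtri v"
  have rv: "rows_summable v" by (rule bd_rows_summable[OF v(1)])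
  have XD: "dtri u' = ?X + ?D" using dtri_diff[OF in_disc_rows[OF u'] in_disc_rows[OF u]] by simp
  have UV: "dtri (u + v) = ?X + ?V" "dtri (u' + v) = ?X + ?D + ?V"
    using dtri_add[OF in_disc_rows[OF u] rv] dtri_add[OF in_disc_rows[OF u'] rv] XD by simp_all
  have st: "0 \<le> s" "0 \<le> t" using bd_nonneg d v by blast+
  have "bd (\<sigma> + \<tau>) (ser a (\<lambda>k. (dtri (u' + v) ^ (k + 2) - dtri u' ^ (k + 2)) - (dtri (u + v) ^ (k + 2) - ?X ^ (k + 2)))) (MM * (s * t))"
  proof (rule ser_bd)
    fix k
    have b: "bd (\<sigma> + \<tau>) (sq ((?X + ?D + ?V) ^ (k + 2) - (?X + ?D) ^ (k + 2) - (?X + ?V) ^ (k + 2) + ?X ^ (k + 2)))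
       (real ((k + 2) * (k + 1)) * r ^ k * ((4 * s) * (4 * t)))"
      using in_disc_dtri[OF u] in_disc_dtri[OF u'] in_disc_dtri[OF uv] in_disc_dtri[OF u'v] unfolding XD UV
      by (intro bd_power_mixed bd_dtri d v)
    have "real ((k + 2) * (k + 1)) * r ^ k * (16 * (s * t)) \<le> maj k * (64 * (s * t))"
      using r_pos st by (intro bd_le maj_ge cube_ge3) simp_all
    then show "bd (\<sigma> + \<tau>) (sq ((dtri (u' + v) ^ (k + 2) - dtri u' ^ (k + 2)) - (dtri (u + v) ^ (k + 2) - ?X ^ (k + 2)))) (maj k * (64 * (s * t)))"
      by (intro bd_weaken[OF b]) (simp_all add: XD UV mult_ac)
  qed
  then show ?thesis
    unfolding Gs_def ser_diff[OF Gs_dominated[OF u'v] Gs_dominated[OF u'], symmetric]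
      ser_diff[OF Gs_dominated[OF uv] Gs_dominated[OF u], symmetric]
      ser_diff[OF dominated_diff[OF Gs_dominated[OF u'v] Gs_dominated[OF u']]
         dominated_diff[OF Gs_dominated[OF uv] Gs_dominated[OF u]], symmetric] .
qed

lemma DGs_mixed_bd:
  assumes u: "in_disc u" and u': "in_disc u'" and uv: "in_disc (u + v)" and u'v: "in_disc (u' + v)"
    and d: "bd \<tau> (u' - u) t" "\<tau> \<le> 1" and v: "bd \<sigma> v s" "\<sigma> \<le> 1" and x: "bd \<kappa> x p" "\<kappa> \<le> 1"
  shows "bd (\<sigma> + \<tau> + \<kappa>) ((DGs a (u' + v) x - DGs a u' x) - (DGs a (u + v) x - DGs a u x)) (MM * (s * t * p))"
proof -
  let ?X = "dtri u" and ?D = "dtri (u' - u)" and ?V = "dtri v" and ?Z = "dtri x"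
  have rv: "rows_summable v" by (rule bd_rows_summable[OF v(1)])
  have XD: "dtri u' = ?X + ?D" using dtri_diff[OF in_disc_rows[OF u'] in_disc_rows[OF u]] by simp
  have UV: "dtri (u + v) = ?X + ?V" "dtri (u' + v) = ?X + ?D + ?V"
    using dtri_add[OF in_disc_rows[OF u] rv] dtri_add[OF in_disc_rows[OF u'] rv] XD by simp_all
  have st: "0 \<le> s" "0 \<le> t" "0 \<le> p" using bd_nonneg d v x by blast+
  let ?f = "\<lambda>u k. of_nat (k + 2) * dtri u ^ (k + 1) * ?Z"
  have "bd (\<sigma> + \<tau> + \<kappa>) (ser a (\<lambda>k. (?f (u' + v) k - ?f u' k) - (?f (u + v) k - ?f u k))) (MM * (s * t * p))"
  proof (rule ser_bd)
    fix k
    show "bd (\<sigma> + \<tau> + \<kappa>) (sq ((?f (u' + v) k - ?f u' k) - (?f (u + v) k - ?f u k))) (maj k * (64 * (s * t * p)))"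
    proof (cases k)
      case 0
      then have "(?f (u' + v) k - ?f u' k) - (?f (u + v) k - ?f u k) = 0" by (simp add: XD UV algebra_simps)
      then show ?thesis using st maj_nonneg[of k] bd_mono[OF bd_zero] by (simp add: sq_zero)
    next
      case (Suc j)
      have b: "bd (\<sigma> + \<tau> + \<kappa>) (sq (of_nat (k + 2) * (((?X + ?D + ?V) ^ (j + 2) - (?X + ?D) ^ (j + 2) - (?X + ?V) ^ (j + 2) + ?X ^ (j + 2)) * ?Z)))
         (real (k + 2) * ((real ((j + 2) * (j + 1)) * r ^ j * ((4 * s) * (4 * t))) * (4 * p)))"
        using in_disc_dtri[OF u] in_disc_dtri[OF u'] in_disc_dtri[OF uv] in_disc_dtri[OF u'v] unfolding XD UV
        by (intro bd_of_nat_mult bd_mult bd_power_mixed bd_dtri d v x)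
      have "real ((k + 2) * ((k + 1) * k)) * r ^ j * (64 * (s * t * p)) \<le> maj k * (64 * (s * t * p))"
        using r_pos st Suc by (intro bd_le maj_ge cube_ge4) simp_all
      moreover have "real (k + 2) * ((real ((j + 2) * (j + 1)) * r ^ j * ((4 * s) * (4 * t))) * (4 * p)) =
          real ((k + 2) * ((k + 1) * k)) * r ^ j * (64 * (s * t * p))"
        using Suc by (simp add: algebra_simps)
      ultimately show ?thesis
        by (intro bd_weaken[OF b]) (use Suc in \<open>simp_all add: XD UV algebra_simps\<close>)
    qed
  qed
  then show ?thesis
    unfolding DGs_def ser_diff[OF DGs_dominated[OF u'v x] DGs_dominated[OF u' x], symmetric]
      ser_diff[OF DGs_dominated[OF uv x] DGs_dominated[OF u x], symmetric]
      ser_diff[OF dominated_diff[OF DGs_dominated[OF u'v x] DGs_dominated[OF u' x]]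
         dominated_diff[OF DGs_dominated[OF uv x] DGs_dominated[OF u x]], symmetric] .
qed

lemma Gs_remainder_diff_bd:
  assumes u: "in_disc u" and u': "in_disc u'" and uv: "in_disc (u + v)" and u'v: "in_disc (u' + v)"
    and d: "bd \<tau> (u' - u) t" "\<tau> \<le> 1" and v: "bd \<sigma> v s" "\<sigma> \<le> 1"
  shows "bd (\<sigma> + (\<tau> + \<tau>)) ((Gs a (u' + v) - Gs a (u + v) - DGs a (u + v) (u' - u))
           - (Gs a u' - Gs a u - DGs a u (u' - u))) (MM * (s * (t * t)))"
proof -
  let ?X = "dtri u" and ?D = "dtri (u' - u)" and ?V = "dtri v"
  have rv: "rows_summable v" by (rule bd_rows_summable[OF v(1)])
  have XD: "dtri u' = ?X + ?D" using dtri_diff[OF in_disc_rows[OF u'] in_disc_rows[OF u]] by simp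
  have UV: "dtri (u + v) = ?X + ?V" "dtri (u' + v) = ?X + ?V + ?D"
    using dtri_add[OF in_disc_rows[OF u] rv] dtri_add[OF in_disc_rows[OF u'] rv] XD by simp_all
  have st: "0 \<le> s" "0 \<le> t" using bd_nonneg d v by blast+
  let ?R = "\<lambda>u u' k. dtri u' ^ (k + 2) - dtri u ^ (k + 2) - of_nat (k + 2) * dtri u ^ (k + 1) * ?D"
  have "bd (\<sigma> + (\<tau> + \<tau>)) (ser a (\<lambda>k. ?R (u + v) (u' + v) k - ?R u u' k)) (MM * (s * (t * t)))"
  proof (rule ser_bd)
    fix k
    show "bd (\<sigma> + (\<tau> + \<tau>)) (sq (?R (u + v) (u' + v) k - ?R u u' k)) (maj k * (64 * (s * (t * t))))"
    proof (cases k)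
      case 0
      then have "?R (u + v) (u' + v) k - ?R u u' k = 0" by (simp add: XD UV algebra_simps power2_eq_square)
      then show ?thesis using st maj_nonneg[of k] bd_mono[OF bd_zero] by (simp add: sq_zero)
    next
      case (Suc j)
      have b: "bd (\<sigma> + (\<tau> + \<tau>)) (sq (((?X + ?V + ?D) ^ (j + 3) - (?X + ?V) ^ (j + 3) - of_nat (j + 3) * (?X + ?V) ^ (j + 2) * ?D)
             - ((?X + ?D) ^ (j + 3) - ?X ^ (j + 3) - of_nat (j + 3) * ?X ^ (j + 2) * ?D)))
         (real ((j + 3) * (j + 2) * (j + 1)) * r ^ j * ((4 * s) * ((4 * t) * (4 * t))))"
        using in_disc_dtri[OF u] in_disc_dtri[OF u'] in_disc_dtri[OF uv] in_disc_dtri[OF u'v] unfolding XD UV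
        by (intro bd_power_remainder_diff bd_dtri d v)
      have "real ((k + 2) * ((k + 1) * k)) * r ^ j * (64 * (s * (t * t))) \<le> maj k * (64 * (s * (t * t)))"
        using r_pos st Suc by (intro bd_le maj_ge cube_ge4) simp_all
      moreover have "(j + 3) * (j + 2) * (j + 1) = (k + 2) * ((k + 1) * k)"
        using Suc by (simp add: algebra_simps)
      moreover have "(4 * s) * ((4 * t) * (4 * t)) = 64 * (s * (t * t))" by simp
      ultimately have "real ((j + 3) * (j + 2) * (j + 1)) * r ^ j * ((4 * s) * ((4 * t) * (4 * t))) \<le> maj k * (64 * (s * (t * t)))"
        by (simp only:)
      then show ?thesis
        by (rule bd_weaken[OF b]) (use Suc in \<open>simp add: XD UV numeral_eq_Suc\<close>)
    qed
  qed
  then show ?thesis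
    unfolding DGs_def Gs_def
      ser_diff[OF Gs_dominated[OF u'v] Gs_dominated[OF uv], symmetric]
      ser_diff[OF Gs_dominated[OF u'] Gs_dominated[OF u], symmetric]
      ser_diff[OF dominated_diff[OF Gs_dominated[OF u'v] Gs_dominated[OF uv]] DGs_dominated[OF uv d], symmetric]
      ser_diff[OF dominated_diff[OF Gs_dominated[OF u'] Gs_dominated[OF u]] DGs_dominated[OF u d], symmetric]
      ser_diff[OF dominated_diff[OF dominated_diff[OF Gs_dominated[OF u'v] Gs_dominated[OF uv]] DGs_dominated[OF uv d]]
         dominated_diff[OF dominated_diff[OF Gs_dominated[OF u'] Gs_dominated[OF u]] DGs_dominated[OF u d]], symmetric] .
qed

lemma csym_Gs:
  assumes "in_disc u" "csym u" shows "csym (Gs a u)"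
  unfolding csym_def
proof (intro allI)
  fix n m
  have c: "sq (dtri u ^ (k + 2)) n (- m) = cnj (sq (dtri u ^ (k + 2)) n m)" for k
    using csym_power[OF csym_dtri[OF in_disc_rows[OF assms(1)] assms(2)], of "k + 1"] by (simp add: csym_def)
  have "(\<lambda>k. cnj (of_real (a k) * sq (dtri u ^ (k + 2)) n m)) sums cnj (Gs a u n m)"
    unfolding Gs_def ser_def sums_cnj by (rule summable_sums[OF ser_summable[OF Gs_dominated[OF assms(1)]]])
  then have "(\<lambda>k. of_real (a k) * sq (dtri u ^ (k + 2)) n (- m)) sums cnj (Gs a u n m)"
    by (simp only: complex_cnj_mult complex_cnj_complex_of_real c[symmetric])
  then show "Gs a u n (- m) = cnj (Gs a u n m)"
    unfolding Gs_def ser_def by (rule sums_unique[symmetric])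
qed

end

section \<open>The nonlinear term\<close>

text \<open>
  Reading \<open>F\<close> as a formal power series at \<open>x\<close>, iterated differentiation acts on the formal series, whose
  constant coefficient gives the derivatives.
\<close>

lemma taylor_coefficients:
  assumes "0 < r" "\<And>y. \<bar>y - x\<bar> < r \<Longrightarrow> (\<lambda>k. a k * (y - x) ^ k) sums (F y :: real)"
  shows "(deriv ^^ k) F x / fact k = a k" and "0 < conv_radius a"
proof -
  define f where "f = F \<circ> (\<lambda>t. x + t)"
  have sums: "(\<lambda>k. a k * t ^ k) sums f t" if "\<bar>t\<bar> < r" for t
    using assms(2)[of "x + t"] that by (simp add: f_def)
  have "norm (r / 2) \<le> conv_radius a"
    by (rule conv_radius_geI, rule sums_summable, rule sums) (use assms(1) in simp)
  then show pos: "0 < conv_radius a"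
    using assms(1) by (intro less_le_trans[OF _ \<open>norm (r / 2) \<le> conv_radius a\<close>]) simp
  have "eventually (\<lambda>t. t \<in> ball 0 r) (nhds (0::real))"
    using assms(1) by (intro eventually_nhds_in_open) auto
  then have "eventually (\<lambda>t. eval_fps (Abs_fps a) t = f t) (nhds 0)"
  proof eventually_elim
    case (elim t)
    then have "(\<lambda>k. a k * t ^ k) sums f t" by (intro sums) (simp add: dist_real_def)
    then show ?case unfolding eval_fps_def fps_nth_Abs_fps by (rule sums_unique[symmetric])
  qed
  then have "f has_fps_expansion Abs_fps a"
    using pos by (simp add: has_fps_expansion_def fps_conv_radius_def fps_nth_Abs_fps)
  then have "(deriv ^^ k) f has_fps_expansion (fps_deriv ^^ k) (Abs_fps a)"
    by (induction k) (auto intro: has_fps_expansion_deriv)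
  then have "eval_fps ((fps_deriv ^^ k) (Abs_fps a)) 0 = (deriv ^^ k) f 0"
    unfolding has_fps_expansion_def by (auto dest: eventually_nhds_x_imp_x)
  then have "fact k * a k = (deriv ^^ k) f 0"
    by (simp add: eval_fps_at_0 fps_0th_higher_deriv)
  then show "(deriv ^^ k) F x / fact k = a k"
    unfolding f_def higher_deriv_shift_0[of k F x] by (simp add: field_simps)
qed

text \<open>
  From \<open>n = 18\<close> on, the ratio is at most \<open>(21/20)\<^sup>3 * (2/3) < 9/10\<close>.
\<close>

lemma summable_cube_geometric: "summable (\<lambda>k. real (k + 2) ^ 3 * (2 / 3) ^ k)"
proof (rule summable_ratio_test[of "9/10" 18])
  fix n :: nat assume n: "18 \<le> n"
  have "real (n + 3) ^ 3 \<le> (21 / 20 * real (n + 2)) ^ 3"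
    using n by (intro power_mono) simp_all
  then have "real (n + 3) ^ 3 \<le> 9261 / 8000 * real (n + 2) ^ 3"
    by (simp only: power_mult_distrib) (simp add: power3_eq_cube)
  also have "\<dots> \<le> 27 / 20 * real (n + 2) ^ 3" by simp
  finally have "real (n + 3) ^ 3 * (2 / 3 * (2 / 3) ^ n) \<le> 27 / 20 * real (n + 2) ^ 3 * (2 / 3 * (2 / 3) ^ n)"
    by (intro mult_right_mono) simp_all
  then show "norm (real (Suc n + 2) ^ 3 * (2 / 3) ^ Suc n) \<le> 9 / 10 * norm (real (n + 2) ^ 3 * (2 / 3) ^ n)"
    by (simp add: abs_mult power_abs numeral_eq_Suc[symmetric] add.commute mult_ac)
qed simp

lemma convpow_zero: "convpow (\<lambda>_. 0) (Suc k) m = 0"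
  by (simp add: convpow_def conv_def)

locale nonlinearity = weighted +
  fixes F :: "real \<Rightarrow> real" and c CF :: real
  assumes analytic: "\<exists>U. open U \<and> - c \<in> U \<and> real_analytic_on F U"
    and deriv_pos: "0 < deriv F (- c)" and CF: "CF_const F c w CF"
begin

abbreviation rh :: real where "rh \<equiv> rho F c"

lemma rho_props: "0 < rh" "rh \<le> 1" "ereal rh \<le> conv_radius (\<lambda>k. alpha F c k / fact k)"
proof -
  from analytic obtain U where "- c \<in> U" "real_analytic_on F U" by blast
  then obtain r a where "0 < r" "\<And>y. \<bar>y - - c\<bar> < r \<Longrightarrow> (\<lambda>k. a k * (y - - c) ^ k) sums F y"
    unfolding real_analytic_on_def by meson
  from taylor_coefficients[OF this]
  have e: "(\<lambda>k. alpha F c k / fact k) = a" and "0 < conv_radius a" by (auto simp: alpha_def)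
  then have "0 < min 1 (conv_radius a)" by simp
  then have pos: "0 < min 1 (conv_radius (\<lambda>k. alpha F c k / fact k))" by (subst e)
  have fin: "ereal rh = min 1 (conv_radius (\<lambda>k. alpha F c k / fact k))"
    unfolding rho_def by (rule ereal_real') (use pos in \<open>auto simp: min_def\<close>)
  then have "ereal 0 < ereal rh" "ereal rh \<le> ereal 1" "ereal rh \<le> conv_radius (\<lambda>k. alpha F c k / fact k)"
    using pos by (simp_all add: zero_ereal_def one_ereal_def)
  then show "0 < rh" "rh \<le> 1" "ereal rh \<le> conv_radius (\<lambda>k. alpha F c k / fact k)" by simp_all
qed

definition coeff :: "nat \<Rightarrow> real" where
  "coeff k = alpha F c (k + 2) / fact (k + 2) / alpha F c 1"

lemma alpha1: "0 < alpha F c 1"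
  using deriv_pos by (simp add: alpha_def)

lemma CF_pos: "0 < CF"
  using CF by (simp add: CF_const_def)

lemma coeff_summable: "summable (\<lambda>k. \<bar>coeff k\<bar> * (real (k + 2) ^ 3 * (rh / 2) ^ (k - 1)))"
proof -
  let ?b = "\<lambda>k. alpha F c k / fact k"
  \<comment> \<open>Between the radius \<open>rh / 2\<close> that is needed and the radius of convergence: the quotient
    \<open>(rh / 2) / q = 2 / 3\<close> leaves room for the cubic factor.\<close>
  define q where "q = 3 / 4 * rh"
  have q: "0 < q" using rho_props(1) by (simp add: q_def)
  have "ereal (norm q) < ereal rh" using rho_props(1) by (simp add: q_def)
  then have "ereal (norm q) < conv_radius ?b" using rho_props(3) by (rule less_le_trans)
  then have "summable (\<lambda>k. ?b k * q ^ k)" by (rule summable_in_conv_radius)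
  then have "(\<lambda>k. ?b k * q ^ k) \<longlonglongrightarrow> 0" by (rule summable_LIMSEQ_zero)
  then have "Bseq (\<lambda>k. ?b k * q ^ k)" by (auto intro: convergent_imp_Bseq convergentI)
  then obtain B where B: "0 < B" "\<And>k. norm (?b k * q ^ k) \<le> B" by (auto elim: BseqE)
  let ?K = "B / alpha F c 1 / q ^ 2 * (2 / rh)"
  show ?thesis
  proof (rule summable_comparison_test)
    show "summable (\<lambda>k. ?K * (real (k + 2) ^ 3 * (2 / 3) ^ k))"
      by (rule summable_mult[OF summable_cube_geometric])
    have "norm (\<bar>coeff k\<bar> * (real (k + 2) ^ 3 * (rh / 2) ^ (k - 1))) \<le> ?K * (real (k + 2) ^ 3 * (2 / 3) ^ k)" for k
    proof -
      have "\<bar>?b (k + 2)\<bar> * (q ^ k * q ^ 2) \<le> B"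
        using B(2)[of "k + 2"] q by (simp add: abs_mult power_add[symmetric])
      then have "\<bar>?b (k + 2)\<bar> \<le> B / (q ^ k * q ^ 2)" using q by (simp add: field_simps)
      then have c1: "\<bar>coeff k\<bar> \<le> B / (q ^ k * q ^ 2) / alpha F c 1"
        unfolding coeff_def abs_divide[of _ "alpha F c 1"] abs_of_pos[OF alpha1]
        by (rule divide_right_mono) (use alpha1 in simp)
      have p: "(rh / 2) ^ (k - 1) \<le> (rh / 2) ^ k * (2 / rh)"
      proof (cases k)
        case 0 then show ?thesis using rho_props(1,2) by (simp add: field_simps)
      next
        case (Suc j) then show ?thesis using rho_props(1) by simp
      qed
      have qk: "(2 / 3 :: real) ^ k = (rh / 2) ^ k / q ^ k"
        unfolding power_divide[symmetric] q_def using rho_props(1) by simp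
      have "\<bar>coeff k\<bar> * (real (k + 2) ^ 3 * (rh / 2) ^ (k - 1)) \<le>
          B / (q ^ k * q ^ 2) / alpha F c 1 * (real (k + 2) ^ 3 * ((rh / 2) ^ k * (2 / rh)))"
        using rho_props(1) B(1) q alpha1 by (intro mult_mono mult_left_mono c1 p) simp_all
      also have "\<dots> = ?K * (real (k + 2) ^ 3 * (2 / 3) ^ k)"
        unfolding qk by (simp add: mult_ac)
      finally show ?thesis using rho_props(1) by (simp add: abs_mult)
    qed
    then show "\<exists>N. \<forall>k\<ge>N. norm (\<bar>coeff k\<bar> * (real (k + 2) ^ 3 * (rh / 2) ^ (k - 1)))
        \<le> ?K * (real (k + 2) ^ 3 * (2 / 3) ^ k)" by blast
  qed
qed

sublocale weighted_series w coeff "rh / 2"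
  by unfold_locales (use rho_props coeff_summable in simp_all)

lemma Y_eq_Gs:
  assumes u: "in_disc u" and uv: "in_disc (u + v)"
  shows "Y F c u v = Gs coeff (u + v) - Gs coeff u"
proof (intro ext)
  fix n m
  have e: "sq (dtri x ^ (k + 2)) n m = convpow (tri x n) (k + 2) m" if "in_disc x" for x k
    by (simp only: sq_power sq_dtri[OF in_disc_rows[OF that]])
  have sm: "summable (\<lambda>k. of_real (coeff k) * convpow (tri x n) (k + 2) m)" if "in_disc x" for x
    using ser_summable[OF Gs_dominated[OF that], of n m] unfolding e[OF that] .
  have g: "Gs coeff x n m = (\<Sum>k. of_real (coeff k) * convpow (tri x n) (k + 2) m)" if "in_disc x" for x
    unfolding Gs_def ser_def e[OF that] ..
  show "Y F c u v n m = (Gs coeff (u + v) - Gs coeff u) n m"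
  proof (cases "n = 0")
    case True
    then have "tri x n = (\<lambda>_. 0)" for x by (simp add: tri_def fun_eq_iff)
    then show ?thesis using True g[OF u] g[OF uv] convpow_zero by (simp add: Y_def)
  next
    case False
    let ?D = "\<lambda>k. convpow (tri (u + v) n) (k + 2) m - convpow (tri u n) (k + 2) m"
    have sd: "summable (\<lambda>k. of_real (coeff k) * ?D k)"
      using summable_diff[OF sm[OF uv] sm[OF u]] by (simp add: algebra_simps)
    have c: "of_real (alpha F c (k + 2) / fact (k + 2)) = of_real (alpha F c 1) * (of_real (coeff k) :: complex)" for k
      using alpha1 by (simp add: coeff_def)
    have "(\<Sum>k. of_real (alpha F c (k + 2) / fact (k + 2)) * ?D k) = of_real (alpha F c 1) * (\<Sum>k. of_real (coeff k) * ?D k)"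
      unfolding c mult.assoc by (rule suminf_mult[OF sd])
    then have "Y F c u v n m = (\<Sum>k. of_real (coeff k) * ?D k)"
      using False alpha1 by (simp only: Y_def) simp
    also have "\<dots> = (Gs coeff (u + v) - Gs coeff u) n m"
      using suminf_diff[OF sm[OF uv] sm[OF u]] g[OF u] g[OF uv] by (simp add: right_diff_distrib)
    finally show ?thesis .
  qed
qed

lemma in_disc_add: "bd 0 u (rh / 8) \<Longrightarrow> bd 0 v (rh / 8) \<Longrightarrow> in_disc (u + v)"
  using bd_add[of 0 u "rh / 8" v "rh / 8"] by (simp add: in_disc_def)

lemma in_disc_self: "bd 0 u (rh / 8) \<Longrightarrow> in_disc u"
  using bd_mono[of 0 u "rh / 8" "rh / 4"] rho_props(1) by (simp add: in_disc_def)

lemma in_oball: "bd \<sigma> u s \<Longrightarrow> s < rh / 8 \<Longrightarrow> u \<in> oball \<sigma> w (rh / 8)"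
  unfolding oball_def bd_iff by auto

lemma tendsto_entries:
  assumes "\<And>i. bd 0 (X i - x) (e i)" "e \<longlonglongrightarrow> 0" shows "(\<lambda>i. X i n m) \<longlonglongrightarrow> x n m"
proof (rule Lim_transform2[OF tendsto_const])
  show "(\<lambda>i. x n m - X i n m) \<longlonglongrightarrow> 0"
  proof (rule Lim_null_comparison[OF _ assms(2)])
    have "norm (x n m - X i n m) \<le> e i" for i
      using bd_point[OF assms(1), of 0 n m] bd_point[OF assms(1), of n i m] by (simp add: norm_minus_commute)
    then show "\<forall>\<^sub>F i in sequentially. norm (x n m - X i n m) \<le> e i" by simp
  qed
qed

text \<open>
  The bound on the derivative of \<open>v \<mapsto> Y u v\<close> passes to the difference quotients of \<open>Gs\<close> up to an error \<open>e\<close>.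
  They converge entrywise to \<open>DGs\<close>, because the Taylor remainder of \<open>Gs\<close> is quadratic, and bounds survive
  entrywise limits.
\<close>

lemma DGs_CF_open:
  assumes u: "bd 0 u s0" "s0 < rh / 8" "s0 \<le> K" and v: "bd \<sigma> v s1" "s1 < rh / 8" "s1 \<le> K"
    and \<sigma>: "0 \<le> \<sigma>" "\<sigma> \<le> 1" and x: "bd \<sigma> x s"
  shows "bd \<sigma> (DGs coeff (u + v) x) (CF * K * s)"
proof -
  have uB: "u \<in> oball 0 w (rh / 8)" and vB: "v \<in> oball \<sigma> w (rh / 8)" using in_oball u v by blast+
  from CF \<sigma> uB obtain D D2 where
    D: "C2_deriv (Lsp \<sigma> w) (Lsp \<sigma> w) (oball \<sigma> w (rh / 8)) (Y F c u) D D2" and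
    Dbd: "\<And>x. x \<in> vecs (Lsp \<sigma> w) \<Longrightarrow> nrm (Lsp \<sigma> w) (D v x) \<le>
       CF * max (nrm (Lsp 0 w) u) (nrm (Lsp 0 w) v) * nrm (Lsp \<sigma> w) x"
    unfolding CF_const_def using vB by (metis (no_types, lifting))
  have fd: "has_fderiv (Lsp \<sigma> w) (Lsp \<sigma> w) (oball \<sigma> w (rh / 8)) (Y F c u) (D v) v"
    and Yv: "\<And>y. y \<in> oball \<sigma> w (rh / 8) \<Longrightarrow> Y F c u y \<in> vecs (Lsp \<sigma> w)"
    using D vB unfolding C2_deriv_def C1_deriv_def by blast+
  have lin: "\<And>x. x \<in> vecs (Lsp \<sigma> w) \<Longrightarrow> D v x \<in> vecs (Lsp \<sigma> w)"
    "\<And>t x. x \<in> vecs (Lsp \<sigma> w) \<Longrightarrow> D v (t *\<^sub>R x) = t *\<^sub>R D v x"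
    using fd unfolding has_fderiv_def blinop_def by auto
  have xv: "x \<in> vecs (Lsp \<sigma> w)" "nrm (Lsp \<sigma> w) x \<le> s" using x bd_iff by blast+
  have v0: "bd 0 v s1" by (rule bd_exponent_mono[OF v(1) \<sigma>(1)])
  have "bd \<sigma> (D v x) (CF * K * s)"
  proof -
    have "nrm (Lsp \<sigma> w) (D v x) \<le> CF * max (nrm (Lsp 0 w) u) (nrm (Lsp 0 w) v) * nrm (Lsp \<sigma> w) x"
      by (rule Dbd[OF xv(1)])
    also have "\<dots> \<le> CF * K * s"
    proof (rule mult_mono[OF mult_left_mono xv(2)])
      show "max (nrm (Lsp 0 w) u) (nrm (Lsp 0 w) v) \<le> K" using u v0 v(3) unfolding bd_iff by simp
      show "0 \<le> CF * K" using CF_pos bd_nonneg[OF u(1)] u(3) by simp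
      have "bd \<sigma> x (nrm (Lsp \<sigma> w) x)" using xv(1) by (simp add: bd_iff)
      then show "0 \<le> nrm (Lsp \<sigma> w) x" by (rule bd_nonneg)
    qed (use CF_pos in simp)
    finally show ?thesis using lin(1)[OF xv(1)] by (simp add: bd_iff)
  qed
  note Dx = this
  have s: "0 \<le> s" by (rule bd_nonneg[OF x])
  have x0: "bd 0 x s" by (rule bd_exponent_mono[OF x \<sigma>(1)])
  have u8: "bd 0 u (rh / 8)" using bd_mono u by fastforce
  have eps: "bd \<sigma> (DGs coeff (u + v) x) (CF * K * s + e * s)" if e: "0 < e" for e
  proof -
    from fd e obtain d where d: "0 < d" "\<And>y. y \<in> oball \<sigma> w (rh / 8) \<Longrightarrow> nrm (Lsp \<sigma> w) (y - v) < d \<Longrightarrow>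
        nrm (Lsp \<sigma> w) (Y F c u y - Y F c u v - D v (y - v)) \<le> e * nrm (Lsp \<sigma> w) (y - v)"
      unfolding has_fderiv_def by blast
    \<comment> \<open>Steps up to \<open>h\<close> keep \<open>v + t i * x\<close> in the open ball and within the distance \<open>d\<close> of \<open>v\<close>.\<close>
    define h where "h = min d (rh / 8 - s1) / (2 * (s + 1))"
    have h: "0 < h" "h * s < d" "s1 + h * s < rh / 8"
    proof -
      have m: "0 < min d (rh / 8 - s1)" using d v by simp
      then show "0 < h" using s by (simp add: h_def)
      have "s / (2 * (s + 1)) \<le> 1 / 2" using s by (simp add: field_simps)
      then have "min d (rh / 8 - s1) * (s / (2 * (s + 1))) \<le> min d (rh / 8 - s1) * (1 / 2)"
        using m by (intro mult_left_mono) simp_all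
      moreover have "min d (rh / 8 - s1) * (1 / 2) < min d (rh / 8 - s1)"
        using mult_strict_left_mono[OF _ m, of "1 / 2" 1] by simp
      moreover have "h * s = min d (rh / 8 - s1) * (s / (2 * (s + 1)))" by (simp add: h_def)
      ultimately have "h * s < min d (rh / 8 - s1)" by (simp only: order.strict_trans1)
      then show "h * s < d" "s1 + h * s < rh / 8" by simp_all
    qed
    define t where "t i = h / real (Suc i)" for i
    have t: "0 < t i" "t i \<le> h" for i
      using h(1) by (simp_all add: t_def divide_le_eq)
    have t0: "t \<longlonglongrightarrow> 0"
      unfolding t_def by (rule LIMSEQ_Suc[OF lim_const_over_n])
    define y where "y i = v + t i *\<^sub>R x" for i
    let ?X = "\<lambda>i. (1 / t i) *\<^sub>R (Gs coeff (u + y i) - Gs coeff (u + v))"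
    have yv: "y i - v = t i *\<^sub>R x" for i by (simp add: y_def)
    have tx: "bd \<sigma> (t i *\<^sub>R x) (t i * s)" for i using bd_scaleR[OF x, of "t i"] t[of i] by simp
    have ts: "t i * s \<le> h * s" for i using t[of i] s by (intro mult_right_mono) auto
    have y: "bd \<sigma> (y i) (s1 + t i * s)" for i unfolding y_def by (rule bd_add[OF v(1) tx])
    have yB: "y i \<in> oball \<sigma> w (rh / 8)" for i by (rule in_oball[OF y]) (use ts[of i] h in linarith)
    have y8: "bd 0 (y i) (rh / 8)" for i
      by (rule bd_mono[OF bd_exponent_mono[OF y \<sigma>(1)]]) (use ts[of i] h in linarith)
    have v8: "bd 0 v (rh / 8)" by (rule bd_mono[OF v0]) (use v in simp)
    show ?thesis
    proof (rule bd_limit[where X = ?X and R = "\<lambda>_. CF * K * s + e * s"])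
      fix i
      have ntx: "nrm (Lsp \<sigma> w) (y i - v) \<le> t i * s" using tx[of i] by (simp add: bd_iff yv)
      have tD: "bd \<sigma> (D v (t i *\<^sub>R x)) (t i * (CF * K * s))"
        unfolding lin(2)[OF xv(1)] using bd_scaleR[OF Dx, of "t i"] t[of i] by simp
      have Yy: "Y F c u (y i) = Gs coeff (u + y i) - Gs coeff u" "Y F c u v = Gs coeff (u + v) - Gs coeff u"
        by (rule Y_eq_Gs[OF in_disc_self[OF u8] in_disc_add[OF u8 y8]],
            rule Y_eq_Gs[OF in_disc_self[OF u8] in_disc_add[OF u8 v8]])
      let ?R = "Y F c u (y i) - Y F c u v - D v (t i *\<^sub>R x)"
      have "bd \<sigma> (Y F c u (y i)) (nrm (Lsp \<sigma> w) (Y F c u (y i)))" "bd \<sigma> (Y F c u v) (nrm (Lsp \<sigma> w) (Y F c u v))"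
        using Yv[OF yB] Yv[OF vB] by (simp_all add: bd_iff)
      from bd_diff[OF bd_diff[OF this] tD] have "?R \<in> vecs (Lsp \<sigma> w)" by (simp add: bd_iff)
      moreover have "nrm (Lsp \<sigma> w) ?R \<le> e * nrm (Lsp \<sigma> w) (y i - v)"
        unfolding yv[symmetric] by (rule d(2)[OF yB]) (use ntx ts[of i] h in linarith)
      moreover have "e * nrm (Lsp \<sigma> w) (y i - v) \<le> e * (t i * s)" using ntx e by simp
      ultimately have "bd \<sigma> ?R (e * (t i * s))" by (simp add: bd_iff)
      from bd_add[OF tD this]
      have "bd \<sigma> (Gs coeff (u + y i) - Gs coeff (u + v)) (t i * (CF * K * s) + e * (t i * s))"
        by (simp add: Yy)
      moreover have "\<bar>1 / t i\<bar> * (t i * (CF * K * s) + e * (t i * s)) = CF * K * s + e * s"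
        using t[of i] by (simp add: distrib_left)
      ultimately show "bd \<sigma> (?X i) (CF * K * s + e * s)"
        using bd_scaleR[of \<sigma> _ _ "1 / t i"] by metis
    next
      fix n m
      show "(\<lambda>i. ?X i n m) \<longlonglongrightarrow> DGs coeff (u + v) x n m"
      proof (rule tendsto_entries)
        fix i
        have yv': "(u + y i) - (u + v) = t i *\<^sub>R x" by (simp add: y_def)
        have "bd 0 ((u + y i) - (u + v)) (t i * s)" unfolding yv' by (rule bd_exponent_mono[OF tx \<sigma>(1)])
        from Gs_remainder_bd[OF in_disc_add[OF u8 v8] in_disc_add[OF u8 y8] this]
        have "bd 0 (Gs coeff (u + y i) - Gs coeff (u + v) - t i *\<^sub>R DGs coeff (u + v) x) (MM * ((t i * s) * (t i * s)))"
          unfolding yv' DGs_scaleR[OF in_disc_add[OF u8 v8] x0 zero_le_one] by simp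
        from bd_scaleR[OF this, of "1 / t i"]
        have "bd 0 ((1 / t i) *\<^sub>R (Gs coeff (u + y i) - Gs coeff (u + v) - t i *\<^sub>R DGs coeff (u + v) x)) (t i * (MM * (s * s)))"
          using t[of i] by (simp add: field_simps)
        then show "bd 0 (?X i - DGs coeff (u + v) x) (t i * (MM * (s * s)))"
          using t[of i] by (simp add: scaleR_diff_right)
      next
        show "(\<lambda>i. t i * (MM * (s * s))) \<longlonglongrightarrow> 0" by (rule tendsto_mult_left_zero[OF t0])
      qed
    qed simp
  qed
  show ?thesis
  proof (rule bd_limit[where X = "\<lambda>_. DGs coeff (u + v) x" and R = "\<lambda>i. CF * K * s + 1 / real (Suc i) * s"])
    show "bd \<sigma> (DGs coeff (u + v) x) (CF * K * s + 1 / real (Suc i) * s)" for i by (rule eps) simp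
    have "(\<lambda>i. CF * K * s + 1 / real (Suc i) * s) \<longlonglongrightarrow> CF * K * s + 0 * s"
      by (intro tendsto_intros LIMSEQ_Suc[OF lim_const_over_n])
    then show "(\<lambda>i. CF * K * s + 1 / real (Suc i) * s) \<longlonglongrightarrow> CF * K * s" by simp
  qed simp
qed

text \<open>
  The constant \<open>CF\<close> controls only arguments in the open ball of radius \<open>rh / 8\<close>, whereas \<open>u\<close> may lie on
  its boundary. There \<open>(1 - t) u\<close> with \<open>t \<rightarrow> 0\<close> is inside, and the series still converge in a neighbourhood,
  so the bound passes to the limit.
\<close>

lemma DGs_CF:
  assumes u: "bd 0 u K" "K \<le> rh / 8" and v: "bd \<sigma> v s1" "s1 < rh / 8" "s1 \<le> K"
    and \<sigma>: "0 \<le> \<sigma>" "\<sigma> \<le> 1" and x: "bd \<sigma> x s"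
  shows "bd \<sigma> (DGs coeff (u + v) x) (CF * K * s)"
proof -
  define t where "t i = 1 / real (i + 2)" for i
  have t: "0 < t i" "t i < 1" for i by (simp_all add: t_def)
  have t0: "t \<longlonglongrightarrow> 0"
    using LIMSEQ_ignore_initial_segment[OF lim_const_over_n[of 1], of 2] by (simp add: t_def[abs_def])
  have x0: "bd 0 x s" by (rule bd_exponent_mono[OF x \<sigma>(1)])
  have v0: "bd 0 v s1" by (rule bd_exponent_mono[OF v(1) \<sigma>(1)])
  have K0: "0 \<le> K" by (rule bd_nonneg[OF u(1)])
  have tu: "bd 0 ((1 - t i) *\<^sub>R u) ((1 - t i) * K)" for i
    using bd_scaleR[OF u(1), of "1 - t i"] t[of i] by simp
  have tK: "(1 - t i) * K \<le> K" "(1 - t i) * K < rh / 8" for i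
  proof -
    show "(1 - t i) * K \<le> K" using t[of i] K0 by (simp add: mult_left_le_one_le)
    show "(1 - t i) * K < rh / 8"
    proof (cases "K = 0")
      case True then show ?thesis using rho_props(1) by simp
    next
      case False
      then have "(1 - t i) * K < K" using t[of i] K0 by (simp add: algebra_simps)
      then show ?thesis using u(2) by simp
    qed
  qed
  have v8: "bd 0 v (rh / 8)" by (rule bd_mono[OF v0]) (use v in simp)
  have u8: "bd 0 u (rh / 8)" by (rule bd_mono[OF u])
  have tu8: "bd 0 ((1 - t i) *\<^sub>R u) (rh / 8)" for i
    by (rule bd_mono[OF tu]) (use tK[of i] in simp)
  show ?thesis
  proof (rule bd_limit[where X = "\<lambda>i. DGs coeff ((1 - t i) *\<^sub>R u + v) x" and R = "\<lambda>_. CF * K * s"])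
    show "bd \<sigma> (DGs coeff ((1 - t i) *\<^sub>R u + v) x) (CF * K * s)" for i
      by (rule DGs_CF_open[OF tu tK(2,1) v \<sigma> x])
    fix n m
    show "(\<lambda>i. DGs coeff ((1 - t i) *\<^sub>R u + v) x n m) \<longlonglongrightarrow> DGs coeff (u + v) x n m"
    proof (rule tendsto_entries)
      fix i
      have "bd 0 ((1 - t i) *\<^sub>R u + v - (u + v)) (t i * K)"
        using bd_scaleR[OF u(1), of "- t i"] t[of i] by (simp add: algebra_simps)
      from DGs_diff_bd[OF in_disc_add[OF u8 v8] in_disc_add[OF tu8 v8] this _ x0]
      show "bd 0 (DGs coeff ((1 - t i) *\<^sub>R u + v) x - DGs coeff (u + v) x) (t i * (MM * (K * s)))"
        by (simp add: mult_ac)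
    next
      show "(\<lambda>i. t i * (MM * (K * s))) \<longlonglongrightarrow> 0" by (rule tendsto_mult_left_zero[OF t0])
    qed
  qed simp
qed

text \<open>
  A mean value inequality with the sharp constant of the derivative: along the segment from \<open>v\<close> to \<open>v'\<close>,
  cut into \<open>Suc N\<close> pieces, the quadratic remainders add up to a multiple of \<open>1 / Suc N\<close>.
\<close>

lemma Gs_lipschitz_CF:
  assumes u: "bd 0 u K" "K \<le> rh / 8" and R: "R < rh / 8" "R \<le> K"
    and v: "bd \<sigma> v R" and v': "bd \<sigma> v' R"
    and \<sigma>: "0 \<le> \<sigma>" "\<sigma> \<le> 1" and d: "bd \<sigma> (v' - v) d"
  shows "bd \<sigma> (Gs coeff (u + v') - Gs coeff (u + v)) (CF * K * d)"
proof -
  let ?G = "\<lambda>v. Gs coeff (u + v)"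
  have d0: "0 \<le> d" by (rule bd_nonneg[OF d])
  have u8: "bd 0 u (rh / 8)" by (rule bd_mono[OF u])
  have fine: "bd \<sigma> (?G v' - ?G v) (CF * K * d + MM * (d * d) / real (Suc N))" for N
  proof -
    define h where "h = 1 / real (Suc N)"
    have h: "0 < h" "real (Suc N) * h = 1" by (simp_all add: h_def)
    define z where "z i = v + (real i * h) *\<^sub>R (v' - v)" for i
    have zR: "bd \<sigma> (z i) R" if "i \<le> Suc N" for i
    proof -
      have ih: "0 \<le> real i * h" "real i * h \<le> 1"
        using h mult_right_mono[of "real i" "real (Suc N)" h] that by simp_all
      have "z i = (1 - real i * h) *\<^sub>R v + (real i * h) *\<^sub>R v'"
        unfolding z_def by (simp add: algebra_simps)
      moreover have "bd \<sigma> ((1 - real i * h) *\<^sub>R v + (real i * h) *\<^sub>R v') ((1 - real i * h) * R + (real i * h) * R)"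
        using bd_add[OF bd_scaleR[OF v, of "1 - real i * h"] bd_scaleR[OF v', of "real i * h"]] ih by simp
      ultimately have "bd \<sigma> (z i) ((1 - real i * h) * R + (real i * h) * R)" by (simp only:)
      then show ?thesis by (simp add: algebra_simps)
    qed
    have z8: "bd 0 (z i) (rh / 8)" if "i \<le> Suc N" for i
      by (rule bd_mono[OF bd_exponent_mono[OF zR[OF that] \<sigma>(1)]]) (use R in simp)
    have step: "bd \<sigma> (?G (z (Suc i)) - ?G (z i)) (CF * K * (h * d) + MM * ((h * d) * (h * d)))" if "i \<le> N" for i
    proof -
      have diff: "u + z (Suc i) - (u + z i) = h *\<^sub>R (v' - v)"
        unfolding z_def by (simp add: algebra_simps)
      have hd: "bd \<sigma> (u + z (Suc i) - (u + z i)) (h * d)"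
        unfolding diff using bd_scaleR[OF d, of h] h by simp
      have p: "in_disc (u + z i)" "in_disc (u + z (Suc i))" using that by (auto intro!: in_disc_add[OF u8] z8)
      have "bd (\<sigma> + \<sigma>) (?G (z (Suc i)) - ?G (z i) - DGs coeff (u + z i) (u + z (Suc i) - (u + z i))) (MM * ((h * d) * (h * d)))"
        by (rule Gs_remainder_bd[OF p hd \<sigma>(2)])
      then have "bd \<sigma> (?G (z (Suc i)) - ?G (z i) - DGs coeff (u + z i) (u + z (Suc i) - (u + z i))) (MM * ((h * d) * (h * d)))"
        by (rule bd_exponent_mono) (use \<sigma> in simp)
      moreover have "bd \<sigma> (DGs coeff (u + z i) (u + z (Suc i) - (u + z i))) (CF * K * (h * d))"
        by (rule DGs_CF[OF u zR R \<sigma> hd]) (use that in simp)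
      ultimately show ?thesis using bd_add by fastforce
    qed
    define D where "D i = ?G (z i) - ?G (z 0)" for i
    have "i \<le> Suc N \<Longrightarrow> bd \<sigma> (D i) (real i * (CF * K * (h * d) + MM * ((h * d) * (h * d))))" for i
    proof (induction i)
      case 0 show ?case by (simp only: D_def diff_self of_nat_0 mult_zero_left bd_zero)
    next
      case (Suc i)
      then have IH: "bd \<sigma> (D i) (real i * (CF * K * (h * d) + MM * ((h * d) * (h * d))))" by linarith
      have D: "D (Suc i) = D i + (?G (z (Suc i)) - ?G (z i))" by (simp add: D_def)
      have "i \<le> N" using Suc.prems by simp
      from bd_add[OF IH step[OF this]] show ?case
        unfolding D by (rule bd_mono) (simp add: distrib_right)
    qed
    from this[of "Suc N"] have "bd \<sigma> (?G (z (Suc N)) - ?G (z 0)) (real (Suc N) * (CF * K * (h * d) + MM * ((h * d) * (h * d))))"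
      by (simp add: D_def)
    moreover have "real (Suc N) * (CF * K * (h * d) + MM * ((h * d) * (h * d))) =
        (real (Suc N) * h) * (CF * K * d) + (real (Suc N) * h) * (MM * (d * d) * h)"
      by (simp only: distrib_left mult_ac)
    moreover have "z (Suc N) = v'" "z 0 = v" unfolding z_def h(2) by simp_all
    ultimately show ?thesis unfolding h(2) by (simp add: h_def)
  qed
  show ?thesis
  proof (rule bd_limit[where X = "\<lambda>_. ?G v' - ?G v", OF fine])
    have "(\<lambda>N. CF * K * d + MM * (d * d) / real (Suc N)) \<longlonglongrightarrow> CF * K * d + 0"
      by (intro tendsto_intros LIMSEQ_Suc[OF lim_const_over_n])
    then show "(\<lambda>N. CF * K * d + MM * (d * d) / real (Suc N)) \<longlonglongrightarrow> CF * K * d" by simp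
  qed simp
qed

end

section \<open>The linear problem\<close>

subsection \<open>Kernels for one mode\<close>

text \<open>
  The solution of the homogeneous recursion with initial values 0 and 1. For \<open>\<delta> = - 2 cos b\<close> it is
  \<open>sin (j b) / sin b\<close>, and for \<open>\<delta> = - 2\<close> it is \<open>j\<close>.
\<close>

fun sine_seq :: "real \<Rightarrow> nat \<Rightarrow> real" where
  "sine_seq \<delta> 0 = 0"
| "sine_seq \<delta> (Suc 0) = 1"
| "sine_seq \<delta> (Suc (Suc n)) = - \<delta> * sine_seq \<delta> (Suc n) - sine_seq \<delta> n"

text \<open>
  The right-hand side of the linear problem is a difference \<open>y (n + 1) - y n\<close>. Summation by parts moves
  the difference to the Green's function, and the kernels below are the differenced ones. This makes
  them bounded uniformly in the elliptic case, even for \<open>\<delta> = - 2\<close>, where the Green's function itself grows.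
  In the elliptic case the solution is built from infinity, because no decaying homogeneous solution
  exists. In the hyperbolic case \<open>z\<close> and \<open>1 / z\<close> are the characteristic roots, and the reflected term with
  \<open>n + k\<close> makes the solution vanish at \<open>n = 0\<close>.
\<close>

definition elliptic_kernel :: "real \<Rightarrow> nat \<Rightarrow> nat \<Rightarrow> real" where
  "elliptic_kernel \<delta> n k = (if n < k then sine_seq \<delta> (k - n - 1) - sine_seq \<delta> (k - n) else 0)"

definition hyperbolic_kernel :: "real \<Rightarrow> nat \<Rightarrow> nat \<Rightarrow> real" where
  "hyperbolic_kernel z n k =
     (if k = 0 then 0
      else if k \<le> n then z / (1 + z) * (z ^ (n - k) + z ^ (n + k - 1))
      else - (z / (1 + z)) * (z ^ (k - 1 - n) - z ^ (n + k - 1)))"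

definition kernel_eq :: "real \<Rightarrow> (nat \<Rightarrow> nat \<Rightarrow> real) \<Rightarrow> bool" where
  "kernel_eq \<delta> \<kappa> \<longleftrightarrow> (\<forall>n k. \<kappa> n k + \<delta> * \<kappa> (Suc n) k + \<kappa> (Suc (Suc n)) k =
     (if k = Suc (Suc n) then 1 else 0) - (if k = Suc n then 1 else 0))"

text \<open>
  Schur's test for one column in the norm with weight \<open>exp (\<sigma> n)\<close>. The summable majorant \<open>g\<close> spares the
  evaluation of the exact sum.
\<close>

definition kernel_bound :: "(nat \<Rightarrow> nat \<Rightarrow> real) \<Rightarrow> real \<Rightarrow> real \<Rightarrow> bool" where
  "kernel_bound \<kappa> \<sigma> C \<longleftrightarrow> (\<forall>n. \<exists>g. (\<forall>k. \<bar>\<kappa> n k\<bar> * exp (\<sigma> * (real n - real k)) \<le> g k) \<and> summable g \<and> suminf g \<le> C)"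

lemma elliptic_kernel_eq: "kernel_eq \<delta> (elliptic_kernel \<delta>)"
  unfolding kernel_eq_def
proof (intro allI)
  fix n k
  consider "k \<le> n" | "k = Suc n" | "k = Suc (Suc n)" | j where "k = Suc (Suc (Suc n)) + j"
    by (metis le_Suc_eq le_iff_add nle_le)
  then show "elliptic_kernel \<delta> n k + \<delta> * elliptic_kernel \<delta> (Suc n) k + elliptic_kernel \<delta> (Suc (Suc n)) k =
     (if k = Suc (Suc n) then 1 else 0) - (if k = Suc n then 1 else 0)"
  proof cases
    case 4
    have K: "elliptic_kernel \<delta> i k = sine_seq \<delta> l - sine_seq \<delta> (Suc l)" if "k = Suc (i + l)" for i l
      using that by (simp add: elliptic_kernel_def)
    have "elliptic_kernel \<delta> n k = sine_seq \<delta> (Suc (Suc j)) - sine_seq \<delta> (Suc (Suc (Suc j)))"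
      "elliptic_kernel \<delta> (Suc n) k = sine_seq \<delta> (Suc j) - sine_seq \<delta> (Suc (Suc j))"
      "elliptic_kernel \<delta> (Suc (Suc n)) k = sine_seq \<delta> j - sine_seq \<delta> (Suc j)"
      by (rule K; simp add: 4)+
    then show ?thesis using 4 by (simp only: sine_seq.simps) (simp add: algebra_simps)
  qed (simp_all add: elliptic_kernel_def Suc_diff_le)
qed

lemma hyperbolic_kernel_ring:
  fixes C y z u x :: real
  shows "- C * (1 - y) + - (z + u) * (C * (1 + z * y)) + C * (z + z * (z * y)) =
      - (C * (1 + u)) + C * (y + - (z + u) * (z * y) + z * (z * y))"
    and "- C * (z - y) + - (z + u) * (- C * (1 - z * y)) + C * (1 + z * (z * y)) =
      C * (1 + u) + C * (y + - (z + u) * (z * y) + z * (z * y))"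
    and "- C * (z * (z * x) - y) + - (z + u) * (- C * (z * x - z * y)) + - C * (x - z * (z * y)) =
      - C * (x + - (z + u) * (z * x) + z * (z * x)) + C * (y + - (z + u) * (z * y) + z * (z * y))"
  by (simp_all add: algebra_simps)

lemma hyperbolic_kernel_eq:
  assumes z: "z \<noteq> 0" "1 + z \<noteq> 0" shows "kernel_eq (- (z + 1 / z)) (hyperbolic_kernel z)"
  unfolding kernel_eq_def
proof (intro allI)
  fix n k
  let ?C = "z / (1 + z)"
  have rec: "x + - (z + 1 / z) * (z * x) + z * (z * x) = 0" for x
    using z by (simp add: field_simps)
  have "1 + 1 / z = (1 + z) / z" using z by (simp add: field_simps)
  then have C1: "?C * (1 + 1 / z) = 1" using z by simp
  consider "k = 0" | j where "k = Suc j" "j < n" | "k = Suc n" | "k = Suc (Suc n)" | j where "k = Suc (Suc (Suc n)) + j"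
    by (metis add_Suc_right less_add_Suc1 less_iff_Suc_add not0_implies_Suc linorder_neqE_nat less_Suc_eq add_Suc)
  then show "hyperbolic_kernel z n k + - (z + 1 / z) * hyperbolic_kernel z (Suc n) k + hyperbolic_kernel z (Suc (Suc n)) k =
     (if k = Suc (Suc n) then 1 else 0) - (if k = Suc n then 1 else 0)"
  proof cases
    case 1 then show ?thesis by (simp add: hyperbolic_kernel_def)
  next
    case 2
    then have *: "Suc n - k = Suc (n - k)" "Suc (Suc n) - k = Suc (Suc (n - k))" by simp_all
    let ?x = "z ^ (n - k)" and ?y = "z ^ (n + j)"
    have "hyperbolic_kernel z n k = ?C * (?x + ?y)" "hyperbolic_kernel z (Suc n) k = ?C * (z * ?x + z * ?y)"
      "hyperbolic_kernel z (Suc (Suc n)) k = ?C * (z * (z * ?x) + z * (z * ?y))"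
      using 2 * by (simp_all add: hyperbolic_kernel_def)
    moreover have "?C * (?x + ?y) + - (z + 1 / z) * (?C * (z * ?x + z * ?y)) + ?C * (z * (z * ?x) + z * (z * ?y)) =
      ?C * (?x + - (z + 1 / z) * (z * ?x) + z * (z * ?x)) + ?C * (?y + - (z + 1 / z) * (z * ?y) + z * (z * ?y))"
      by (simp only: algebra_simps)
    ultimately show ?thesis unfolding rec using 2 by simp
  next
    case 3
    let ?y = "z ^ (n + n)"
    have "hyperbolic_kernel z n k = - ?C * (1 - ?y)" "hyperbolic_kernel z (Suc n) k = ?C * (1 + z * ?y)"
      "hyperbolic_kernel z (Suc (Suc n)) k = ?C * (z + z * (z * ?y))"
      using 3 by (simp_all add: hyperbolic_kernel_def)
    moreover have "- ?C * (1 - ?y) + - (z + 1 / z) * (?C * (1 + z * ?y)) + ?C * (z + z * (z * ?y)) =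
      - (?C * (1 + 1 / z)) + ?C * (?y + - (z + 1 / z) * (z * ?y) + z * (z * ?y))"
      by (rule hyperbolic_kernel_ring)
    ultimately show ?thesis unfolding rec C1 using 3 by simp
  next
    case 4
    let ?y = "z ^ (n + Suc n)"
    have "hyperbolic_kernel z n k = - ?C * (z - ?y)" "hyperbolic_kernel z (Suc n) k = - ?C * (1 - z * ?y)"
      "hyperbolic_kernel z (Suc (Suc n)) k = ?C * (1 + z * (z * ?y))"
      using 4 by (simp_all add: hyperbolic_kernel_def)
    moreover have "- ?C * (z - ?y) + - (z + 1 / z) * (- ?C * (1 - z * ?y)) + ?C * (1 + z * (z * ?y)) =
      ?C * (1 + 1 / z) + ?C * (?y + - (z + 1 / z) * (z * ?y) + z * (z * ?y))"
      by (rule hyperbolic_kernel_ring)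
    ultimately show ?thesis unfolding rec C1 using 4 by simp
  next
    case 5
    let ?x = "z ^ j" and ?y = "z ^ (n + (n + 2 + j))"
    have "hyperbolic_kernel z n k = - ?C * (z * (z * ?x) - ?y)" "hyperbolic_kernel z (Suc n) k = - ?C * (z * ?x - z * ?y)"
      "hyperbolic_kernel z (Suc (Suc n)) k = - ?C * (?x - z * (z * ?y))"
      using 5 by (simp_all add: hyperbolic_kernel_def Suc_diff_le)
    moreover have "- ?C * (z * (z * ?x) - ?y) + - (z + 1 / z) * (- ?C * (z * ?x - z * ?y)) + - ?C * (?x - z * (z * ?y)) =
      - ?C * (?x + - (z + 1 / z) * (z * ?x) + z * (z * ?x)) + ?C * (?y + - (z + 1 / z) * (z * ?y) + z * (z * ?y))"
      by (rule hyperbolic_kernel_ring)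
    ultimately show ?thesis unfolding rec using 5 by simp
  qed
qed

lemma kernel_solves:
  fixes y :: "nat \<Rightarrow> complex"
  assumes \<kappa>: "kernel_eq \<delta> \<kappa>" and s: "\<And>n. summable (\<lambda>k. of_real (\<kappa> n k) * y k)"
  defines "v \<equiv> \<lambda>n. \<Sum>k. of_real (\<kappa> n k) * y k"
  shows "v n + of_real \<delta> * v (Suc n) + v (Suc (Suc n)) = y (Suc (Suc n)) - y (Suc n)"
proof -
  have S: "(\<lambda>k. of_real (\<kappa> n k) * y k) sums v n" for n
    unfolding v_def by (rule summable_sums[OF s])
  have "(\<lambda>k. of_real (\<kappa> n k) * y k + of_real \<delta> * (of_real (\<kappa> (Suc n) k) * y k) + of_real (\<kappa> (Suc (Suc n)) k) * y k)
     sums (v n + of_real \<delta> * v (Suc n) + v (Suc (Suc n)))"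
    by (intro sums_add sums_mult S)
  moreover have "of_real (\<kappa> n k) * y k + of_real \<delta> * (of_real (\<kappa> (Suc n) k) * y k) + of_real (\<kappa> (Suc (Suc n)) k) * y k
     = (if k = Suc (Suc n) then y k else 0) - (if k = Suc n then y k else 0)" for k
  proof -
    have "of_real (\<kappa> n k) * y k + of_real \<delta> * (of_real (\<kappa> (Suc n) k) * y k) + of_real (\<kappa> (Suc (Suc n)) k) * y k
       = of_real (\<kappa> n k + \<delta> * \<kappa> (Suc n) k + \<kappa> (Suc (Suc n)) k) * y k"
      by (simp add: algebra_simps)
    then show ?thesis using \<kappa> unfolding kernel_eq_def by simp
  qed
  ultimately have "(\<lambda>k. (if k = Suc (Suc n) then y k else 0) - (if k = Suc n then y k else 0))
     sums (v n + of_real \<delta> * v (Suc n) + v (Suc (Suc n)))" by simp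
  moreover have "(\<lambda>k. (if k = Suc (Suc n) then y k else 0) - (if k = Suc n then y k else 0))
     sums (y (Suc (Suc n)) - y (Suc n))"
    by (intro sums_diff sums_single)
  ultimately show ?thesis by (rule sums_unique2)
qed

lemma kernel_bound_apply:
  fixes y :: "nat \<Rightarrow> complex"
  assumes \<kappa>: "kernel_bound \<kappa> \<sigma> C" and y: "\<And>k. exp (\<sigma> * real k) * cmod (y k) \<le> f"
  shows "summable (\<lambda>k. of_real (\<kappa> n k) * y k)"
    and "exp (\<sigma> * real n) * cmod (\<Sum>k. of_real (\<kappa> n k) * y k) \<le> C * f"
proof -
  have f: "0 \<le> f" by (rule order_trans[OF _ y[of 0]]) simp
  from \<kappa> obtain g where g: "\<And>k. \<bar>\<kappa> n k\<bar> * exp (\<sigma> * (real n - real k)) \<le> g k" "summable g" "suminf g \<le> C"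
    unfolding kernel_bound_def by blast
  have t: "exp (\<sigma> * real n) * norm (of_real (\<kappa> n k) * y k) \<le> g k * f" for k
  proof -
    have "exp (\<sigma> * real n) = exp (\<sigma> * (real n - real k)) * exp (\<sigma> * real k)"
      by (simp add: exp_add[symmetric] algebra_simps)
    then have "exp (\<sigma> * real n) * norm (of_real (\<kappa> n k) * y k) =
        (\<bar>\<kappa> n k\<bar> * exp (\<sigma> * (real n - real k))) * (exp (\<sigma> * real k) * cmod (y k))"
      by (simp add: norm_mult mult_ac)
    also have "\<dots> \<le> g k * f"
      by (intro mult_mono g y order_trans[OF _ g(1)]) simp_all
    finally show ?thesis .
  qed
  have gf: "summable (\<lambda>k. g k * f)" by (rule summable_mult2[OF g(2)])
  have ns: "summable (\<lambda>k. exp (\<sigma> * real n) * norm (of_real (\<kappa> n k) * y k))"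
    by (rule summable_comparison_test[OF _ gf]) (use t in auto)
  then have n1: "summable (\<lambda>k. norm (of_real (\<kappa> n k) * y k))"
    by (simp add: summable_cmult_iff)
  then show "summable (\<lambda>k. of_real (\<kappa> n k) * y k)" by (rule summable_norm_cancel)
  have "exp (\<sigma> * real n) * cmod (\<Sum>k. of_real (\<kappa> n k) * y k) \<le> exp (\<sigma> * real n) * (\<Sum>k. norm (of_real (\<kappa> n k) * y k))"
    by (intro mult_left_mono summable_norm n1) simp
  also have "\<dots> = (\<Sum>k. exp (\<sigma> * real n) * norm (of_real (\<kappa> n k) * y k))"
    by (rule suminf_mult[OF n1, symmetric])
  also have "\<dots> \<le> (\<Sum>k. g k * f)" by (rule suminf_le[OF t ns gf])
  also have "\<dots> = suminf g * f" by (rule suminf_mult2[OF g(2), symmetric])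
  also have "\<dots> \<le> C * f" by (rule mult_right_mono[OF g(3) f])
  finally show "exp (\<sigma> * real n) * cmod (\<Sum>k. of_real (\<kappa> n k) * y k) \<le> C * f" .
qed

lemma tail_geometric_sums:
  fixes x :: real
  assumes "0 \<le> x" "x < 1"
  shows "(\<lambda>k. if n < k then x ^ (k - n) else 0) sums (x / (1 - x))"
proof -
  let ?f = "\<lambda>k. if n < k then x ^ (k - n) else 0"
  have "(\<lambda>j. x * x ^ j) sums (x * (1 / (1 - x)))"
    by (intro sums_mult geometric_sums) (use assms in simp)
  then have "(\<lambda>j. ?f (j + Suc n)) sums (x / (1 - x))" by simp
  moreover have "(\<Sum>i<Suc n. ?f i) = 0" by (rule sum.neutral) auto
  ultimately show ?thesis using sums_iff_shift[of ?f "Suc n" "x / (1 - x)"] by simp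
qed

lemma elliptic_kernel_bound:
  assumes D: "\<And>j. \<bar>sine_seq \<delta> (Suc j) - sine_seq \<delta> j\<bar> \<le> D" and \<sigma>: "0 < \<sigma>1" "\<sigma>1 \<le> \<sigma>"
  shows "kernel_bound (elliptic_kernel \<delta>) \<sigma> (D / (1 - exp (- \<sigma>1)))"
  unfolding kernel_bound_def
proof (intro allI exI conjI)
  fix n k
  let ?s = "exp (- \<sigma>)"
  let ?g = "\<lambda>k. D * (if n < k then ?s ^ (k - n) else 0)"
  have D0: "0 \<le> D" by (rule order_trans[OF _ D[of 0]]) simp
  have s: "0 \<le> ?s" "?s < 1" using \<sigma> by simp_all
  show "\<bar>elliptic_kernel \<delta> n k\<bar> * exp (\<sigma> * (real n - real k)) \<le> ?g k"
  proof (cases "n < k")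
    case True
    then obtain j where j: "k = Suc (n + j)" by (metis less_iff_Suc_add)
    have "exp (\<sigma> * (real n - real k)) = ?s ^ (k - n)"
      unfolding exp_of_nat_mult[symmetric] using True by (simp add: of_nat_diff algebra_simps)
    moreover have "\<bar>elliptic_kernel \<delta> n k\<bar> \<le> D"
      using D[of j] j by (simp add: elliptic_kernel_def abs_minus_commute)
    ultimately show ?thesis using True by (simp add: mult_right_mono)
  next
    case False then show ?thesis using D0 by (simp add: elliptic_kernel_def)
  qed
  have g: "?g sums (D * (?s / (1 - ?s)))" by (intro sums_mult tail_geometric_sums s)
  then show "summable ?g" by (rule sums_summable)
  have le: "?s \<le> exp (- \<sigma>1)" using \<sigma> by simp
  have "?s / (1 - ?s) \<le> 1 / (1 - exp (- \<sigma>1))"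
    using \<sigma> s le by (intro frac_le) simp_all
  then have "D * (?s / (1 - ?s)) \<le> D * (1 / (1 - exp (- \<sigma>1)))" using D0 by (rule mult_left_mono)
  then show "suminf ?g \<le> D / (1 - exp (- \<sigma>1))" using sums_unique[OF g] by simp
qed

lemma finite_geometric:
  "(1 - s) * (\<Sum>k=1..n. s ^ (2 + n - k)) = s\<^sup>2 * (1 - s ^ n)" for s :: real
proof (induction n)
  case (Suc n)
  have "(\<Sum>k=1..n. s ^ (2 + Suc n - k)) = s * (\<Sum>k=1..n. s ^ (2 + n - k))"
    unfolding sum_distrib_left
  proof (rule sum.cong)
    fix k assume "k \<in> {1..n}"
    then have "2 + Suc n - k = Suc (2 + n - k)" by (simp add: Suc_diff_le)
    then show "s ^ (2 + Suc n - k) = s * s ^ (2 + n - k)" by simp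
  qed simp
  then have "(1 - s) * (\<Sum>k=1..Suc n. s ^ (2 + Suc n - k)) = s * ((1 - s) * (\<Sum>k=1..n. s ^ (2 + n - k))) + (1 - s) * s\<^sup>2"
    by (simp add: algebra_simps)
  then show ?case unfolding Suc.IH by (simp add: algebra_simps power2_eq_square)
qed simp

text \<open>
  Put \<open>s = exp (- \<sigma>0)\<close> and \<open>q = s\<^sup>2\<close>, so that \<open>\<bar>z\<bar> \<le> q\<close>. Up to the factor \<open>1 / (1 - q)\<close> the row \<open>n\<close> of the
  weighted kernel consists of three geometric parts: \<open>A\<close> for \<open>k \<le> n\<close>, \<open>E\<close> for \<open>k > n\<close>, and the
  reflected part \<open>B\<close>. The finite sum of \<open>A\<close> misses \<open>s\<^sup>n * s\<^sup>2 / (1 - s)\<close> of the full geometric series, and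
  this deficit absorbs \<open>B\<close>. So the bound is uniform in \<open>n\<close> and equals the one for \<open>A\<close> and \<open>E\<close> alone.
\<close>

lemma hyperbolic_kernel_bound:
  assumes z: "- 1 < z" "z < 0" "\<bar>z\<bar> \<le> exp (- 2 * \<sigma>0)" and \<sigma>: "0 \<le> \<sigma>" "\<sigma> \<le> \<sigma>0" "0 < \<sigma>0"
  shows "kernel_bound (hyperbolic_kernel z) \<sigma>
    ((1 + exp (- 2 * \<sigma>0)) / (1 - exp (- 4 * \<sigma>0)) * (1 / (exp \<sigma>0 - 1) + 1 / (1 - exp (- 2 * \<sigma>0))))"
proof -
  define s where "s = exp (- \<sigma>0)"
  define q where "q = s\<^sup>2"
  define p where "p = \<bar>z\<bar>"
  have s: "0 < s" "s < 1" using \<sigma> by (simp_all add: s_def)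
  have q: "0 < q" "q < 1" "q \<le> s"
    using s power_strict_decreasing[of 0 2 s] power_decreasing[of 1 2 s] by (simp_all add: q_def)
  have eq: "exp (- 2 * \<sigma>0) = q" "exp (- 4 * \<sigma>0) = q\<^sup>2" "exp \<sigma>0 = 1 / s"
    unfolding q_def s_def by (simp_all add: exp_of_nat_mult[symmetric] power_mult[symmetric] exp_minus field_simps)
  have p: "0 < p" "p < 1" "p \<le> q" using z eq by (simp_all add: p_def)
  have pe: "p * exp \<sigma> \<le> s"
  proof -
    have "p * exp \<sigma> \<le> q * exp \<sigma>0" using p q \<sigma> by (intro mult_mono) simp_all
    also have "\<dots> = s" using s by (simp add: eq q_def power2_eq_square)
    finally show ?thesis .
  qed
  have pe': "p * exp (- \<sigma>) \<le> q" using mult_mono[of p q "exp (- \<sigma>)" 1] p q \<sigma> by simp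
  let ?c = "1 / (1 - q)"
  have T: "?c * (s\<^sup>2 / (1 - s) + q / (1 - q)) \<le>
     (1 + exp (- 2 * \<sigma>0)) / (1 - exp (- 4 * \<sigma>0)) * (1 / (exp \<sigma>0 - 1) + 1 / (1 - exp (- 2 * \<sigma>0)))"
  proof -
    have "1 - q\<^sup>2 = (1 + q) * (1 - q)" by (simp add: power2_eq_square algebra_simps)
    then have e1: "(1 + q) / (1 - q\<^sup>2) = ?c" using q by simp
    have e2: "1 / (1 / s - 1) = s / (1 - s)" using s by (simp add: field_simps)
    have "s\<^sup>2 / (1 - s) \<le> s / (1 - s)" using s q by (intro divide_right_mono) (simp_all add: q_def)
    moreover have "q / (1 - q) \<le> 1 / (1 - q)" using q by (intro divide_right_mono) simp_all
    ultimately show ?thesis unfolding eq e1 e2 using q by (intro mult_left_mono add_mono) simp_all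
  qed
  show ?thesis
    unfolding kernel_bound_def
  proof
    fix n
    let ?A = "\<lambda>k. if k \<in> {1..n} then s ^ (2 + n - k) else 0"
    let ?B = "\<lambda>k. s ^ n * (if 0 < k then q ^ (k - 0) else 0)"
    let ?E = "\<lambda>k. if n < k then q ^ (k - n) else 0"
    let ?g = "\<lambda>k. ?c * (?A k + ?B k + ?E k)"
    have gs: "?g sums (?c * ((\<Sum>k=1..n. s ^ (2 + n - k)) + s ^ n * (q / (1 - q)) + q / (1 - q)))"
      by (intro sums_mult sums_add tail_geometric_sums sums_If_finite_set) (use q in simp_all)
    have "(\<Sum>k=1..n. s ^ (2 + n - k)) = s\<^sup>2 * (1 - s ^ n) / (1 - s)"
      using finite_geometric[of s n] s by (simp add: field_simps)
    moreover have "s ^ n * (q / (1 - q)) \<le> s ^ n * (s\<^sup>2 / (1 - s))"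
      unfolding q_def[symmetric] using s q by (intro mult_left_mono divide_left_mono mult_pos_pos) simp_all
    ultimately have "(\<Sum>k=1..n. s ^ (2 + n - k)) + s ^ n * (q / (1 - q)) \<le> s\<^sup>2 * (1 - s ^ n) / (1 - s) + s ^ n * (s\<^sup>2 / (1 - s))"
      by simp
    also have "\<dots> = s\<^sup>2 / (1 - s)" by (simp add: diff_divide_distrib algebra_simps)
    finally have "?c * ((\<Sum>k=1..n. s ^ (2 + n - k)) + s ^ n * (q / (1 - q)) + q / (1 - q)) \<le> ?c * (s\<^sup>2 / (1 - s) + q / (1 - q))"
      using q by (intro mult_left_mono add_mono) simp_all
    note le = order_trans[OF this T]
    have ptw: "\<bar>hyperbolic_kernel z n k\<bar> * exp (\<sigma> * (real n - real k)) \<le> ?g k" for k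
    proof (cases "k = 0")
      case True then show ?thesis using q by (simp add: hyperbolic_kernel_def)
    next
      case False
      let ?e = "exp (\<sigma> * (real n - real k))"
      have C: "\<bar>z / (1 + z)\<bar> = p / (1 - p)" using z by (simp add: p_def abs_divide)
      have c: "1 / (1 - p) \<le> ?c" using p q by (intro divide_left_mono) simp_all
      have y: "p ^ (n + k) * ?e \<le> s ^ n * q ^ k"
      proof -
        have "p ^ (n + k) * ?e = (p * exp \<sigma>) ^ n * (p * exp (- \<sigma>)) ^ k"
          unfolding power_mult_distrib exp_of_nat_mult[symmetric] power_add
          by (simp add: algebra_simps exp_add[symmetric] exp_diff exp_minus divide_inverse)
        also have "\<dots> \<le> s ^ n * q ^ k" using p s by (intro mult_mono power_mono pe pe') simp_all
        finally show ?thesis .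
      qed
      have pk: "p * p ^ (n + k - 1) = p ^ (n + k)" using False by (cases k) simp_all
      have za: "\<bar>z ^ j\<bar> = p ^ j" for j by (simp add: p_def power_abs)
      show ?thesis
      proof (cases "k \<le> n")
        case True
        have x: "p ^ Suc (n - k) * ?e \<le> s ^ (2 + n - k)"
        proof -
          have "p ^ Suc (n - k) * ?e = p * (p * exp \<sigma>) ^ (n - k)"
            unfolding power_mult_distrib exp_of_nat_mult[symmetric] using True by (simp add: of_nat_diff mult_ac)
          also have "\<dots> \<le> s\<^sup>2 * s ^ (n - k)" using p s by (intro mult_mono power_mono pe) (simp_all add: q_def)
          also have "\<dots> = s ^ (2 + (n - k))" by (simp only: power_add)
          also have "2 + (n - k) = 2 + n - k" using True by simp
          finally show ?thesis .
        qed
        have "\<bar>hyperbolic_kernel z n k\<bar> = p / (1 - p) * \<bar>z ^ (n - k) + z ^ (n + k - 1)\<bar>"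
          unfolding C[symmetric] abs_mult[symmetric] using True False by (simp add: hyperbolic_kernel_def)
        also have "\<dots> \<le> p / (1 - p) * (p ^ (n - k) + p ^ (n + k - 1))"
          unfolding za[symmetric] using p by (intro mult_left_mono abs_triangle_ineq) simp
        also have "\<dots> = 1 / (1 - p) * (p ^ Suc (n - k) + p ^ (n + k))"
          using pk by (simp add: distrib_left add_divide_distrib)
        finally have "\<bar>hyperbolic_kernel z n k\<bar> * ?e \<le> 1 / (1 - p) * (p ^ Suc (n - k) + p ^ (n + k)) * ?e"
          by (rule mult_right_mono) simp
        also have "\<dots> = 1 / (1 - p) * (p ^ Suc (n - k) * ?e + p ^ (n + k) * ?e)" by (simp only: mult.assoc distrib_right)
        also have "\<dots> \<le> ?c * (s ^ (2 + n - k) + s ^ n * q ^ k)"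
          using p q by (intro mult_mono c add_mono x y add_nonneg_nonneg) simp_all
        finally show ?thesis using True False by simp
      next
        case nk: False
        have x: "p ^ (k - n) * ?e \<le> q ^ (k - n)"
        proof -
          have "p ^ (k - n) * ?e = (p * exp (- \<sigma>)) ^ (k - n)"
            unfolding power_mult_distrib exp_of_nat_mult[symmetric] using nk by (simp add: of_nat_diff algebra_simps)
          also have "\<dots> \<le> q ^ (k - n)" using p by (intro power_mono pe') simp
          finally show ?thesis .
        qed
        have pk2: "p * p ^ (k - 1 - n) = p ^ (k - n)"
          unfolding power_Suc[symmetric] using nk False by (intro arg_cong[where f = "\<lambda>j. p ^ j"]) simp
        have "\<bar>hyperbolic_kernel z n k\<bar> = p / (1 - p) * \<bar>z ^ (k - 1 - n) - z ^ (n + k - 1)\<bar>"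
          unfolding C[symmetric] abs_mult[symmetric] using nk False by (simp add: hyperbolic_kernel_def)
        also have "\<dots> \<le> p / (1 - p) * (p ^ (k - 1 - n) + p ^ (n + k - 1))"
          unfolding za[symmetric] using p by (intro mult_left_mono abs_triangle_ineq4) simp
        also have "\<dots> = 1 / (1 - p) * (p ^ (k - n) + p ^ (n + k))"
          using pk pk2 by (simp add: distrib_left add_divide_distrib)
        finally have "\<bar>hyperbolic_kernel z n k\<bar> * ?e \<le> 1 / (1 - p) * (p ^ (k - n) + p ^ (n + k)) * ?e"
          by (rule mult_right_mono) simp
        also have "\<dots> = 1 / (1 - p) * (p ^ (k - n) * ?e + p ^ (n + k) * ?e)" by (simp only: mult.assoc distrib_right)
        also have "\<dots> \<le> ?c * (q ^ (k - n) + s ^ n * q ^ k)"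
          using p q by (intro mult_mono c add_mono x y add_nonneg_nonneg) simp_all
        finally show ?thesis using nk False by (simp add: add.commute)
      qed
    qed
    show "\<exists>g. (\<forall>k. \<bar>hyperbolic_kernel z n k\<bar> * exp (\<sigma> * (real n - real k)) \<le> g k) \<and> summable g \<and>
       suminf g \<le> (1 + exp (- 2 * \<sigma>0)) / (1 - exp (- 4 * \<sigma>0)) * (1 / (exp \<sigma>0 - 1) + 1 / (1 - exp (- 2 * \<sigma>0)))"
      using le unfolding sums_unique[OF gs] by (intro exI[of _ ?g] conjI allI ptw sums_summable[OF gs])
  qed
qed

text \<open>
  The value at \<open>n\<close> is a combination of those at \<open>n + j\<close> and \<open>n + j + 1\<close> with coefficients that grow at
  most linearly in \<open>j\<close>, while the values decay exponentially.
\<close>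

lemma elliptic_homogeneous_zero:
  fixes f :: "nat \<Rightarrow> complex"
  assumes eq: "\<And>n. f n + of_real \<delta> * f (Suc n) + f (Suc (Suc n)) = 0"
    and D: "\<And>j. \<bar>sine_seq \<delta> (Suc j) - sine_seq \<delta> j\<bar> \<le> D"
    and \<sigma>: "0 < \<sigma>" and B: "\<And>n. cmod (f n) \<le> exp (- \<sigma> * real n) * B"
  shows "f n = 0"
proof -
  let ?H = "sine_seq \<delta>" and ?s = "exp (- \<sigma>)"
  have D0: "0 \<le> D" by (rule order_trans[OF _ D[of 0]]) simp
  have B0: "0 \<le> B" using order_trans[OF norm_ge_zero B[of 0]] by simp
  have H: "\<bar>?H j\<bar> \<le> D * real j" for j
  proof (induction j)
    case (Suc j)
    have "\<bar>?H (Suc j)\<bar> \<le> \<bar>?H (Suc j) - ?H j\<bar> + \<bar>?H j\<bar>" by simp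
    also have "\<dots> \<le> D + D * real j" by (intro add_mono D Suc)
    finally show ?case by (simp add: algebra_simps)
  qed simp
  have rep: "f n = of_real (?H (Suc j)) * f (n + j) - of_real (?H j) * f (Suc (n + j))" for j
  proof (induction j)
    case (Suc j)
    have "f (n + j) = - (of_real \<delta> * f (Suc (n + j)) + f (Suc (Suc (n + j))))"
      using eq[of "n + j"] by (simp only: eq_neg_iff_add_eq_0 add.assoc)
    with Suc have "f n = of_real (?H (Suc j)) * - (of_real \<delta> * f (Suc (n + j)) + f (Suc (Suc (n + j)))) - of_real (?H j) * f (Suc (n + j))"
      by simp
    also have "\<dots> = of_real (?H (Suc (Suc j))) * f (n + Suc j) - of_real (?H (Suc j)) * f (Suc (n + Suc j))"
      by (simp add: algebra_simps)
    finally show ?case .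
  qed simp
  have bnd: "norm (f n) \<le> 2 * D * B * (real j * ?s ^ j + ?s ^ j)" for j
  proof -
    have e: "exp (- \<sigma> * real (n + i)) * B \<le> ?s ^ j * B" if "j \<le> i" for i
    proof -
      have "exp (- \<sigma> * real (n + i)) \<le> exp (real j * (- \<sigma>))"
        using \<sigma> that mult_left_mono[of "real j" "real n + real i" \<sigma>] by (simp add: algebra_simps)
      then show ?thesis unfolding exp_of_nat_mult using B0 by (rule mult_right_mono)
    qed
    have "norm (f n) \<le> norm (of_real (?H (Suc j)) * f (n + j)) + norm (of_real (?H j) * f (Suc (n + j)))"
      by (subst rep[of j]) (rule norm_triangle_ineq4)
    also have "\<dots> = \<bar>?H (Suc j)\<bar> * cmod (f (n + j)) + \<bar>?H j\<bar> * cmod (f (n + Suc j))" by (simp add: norm_mult)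
    also have "\<dots> \<le> (D * real (Suc j)) * (?s ^ j * B) + (D * real (Suc j)) * (?s ^ j * B)"
    proof (intro add_mono mult_mono)
      show "\<bar>?H j\<bar> \<le> D * real (Suc j)" using H[of j] D0 by (simp add: algebra_simps)
      show "cmod (f (n + j)) \<le> ?s ^ j * B" by (rule order_trans[OF B e]) simp
      show "cmod (f (n + Suc j)) \<le> ?s ^ j * B" by (rule order_trans[OF B e]) simp
    qed (use H[of "Suc j"] D0 in simp_all)
    also have "\<dots> = 2 * D * B * (real j * ?s ^ j + ?s ^ j)" by (simp add: algebra_simps)
    finally show ?thesis .
  qed
  have s: "norm ?s < 1" using \<sigma> by simp
  have "(\<lambda>j. 2 * D * B * (real j * ?s ^ j + ?s ^ j)) \<longlonglongrightarrow> 2 * D * B * (0 + 0)"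
    by (intro tendsto_mult tendsto_add tendsto_const powser_times_n_limit_0 LIMSEQ_power_zero s)
  from LIMSEQ_le_const[OF this] have "norm (f n) \<le> 2 * D * B * (0 + 0)" using bnd by blast
  then show ?thesis by simp
qed

text \<open>
  The combination \<open>f (n + 1) - z * f n\<close> picks the growing mode \<open>1 / z\<close>; it vanishes because \<open>f\<close> is bounded.
  What is left is a multiple of the decaying mode, and it is zero at \<open>n = 0\<close>.
\<close>

lemma hyperbolic_homogeneous_zero:
  fixes f :: "nat \<Rightarrow> complex"
  assumes eq: "\<And>n. f n + of_real (- (z + 1 / z)) * f (Suc n) + f (Suc (Suc n)) = 0"
    and z: "z \<noteq> 0" "\<bar>z\<bar> < 1" and f0: "f 0 = 0" and B: "\<And>n. cmod (f n) \<le> B"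
  shows "f n = 0"
proof -
  define e where "e n = f (Suc n) - of_real z * f n" for n
  have step: "e n = of_real z * e (Suc n)" for n
  proof -
    have "f (Suc (Suc n)) = of_real (z + 1 / z) * f (Suc n) - f n" using eq[of n] by (simp add: algebra_simps add_eq_0_iff)
    then show ?thesis unfolding e_def using z by (simp add: field_simps)
  qed
  have it: "e n = of_real z ^ j * e (n + j)" for n j
  proof (induction j)
    case (Suc j)
    have "e n = of_real z ^ j * (of_real z * e (Suc (n + j)))"
      using Suc step[of "n + j"] by simp
    then show ?case by (simp add: mult_ac)
  qed simp
  have "e n = 0" for n
  proof -
    have "norm (e n) \<le> \<bar>z\<bar> ^ j * (2 * B)" for j
    proof -
      have "norm (e (n + j)) \<le> cmod (f (Suc (n + j))) + \<bar>z\<bar> * cmod (f (n + j))"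
        unfolding e_def by (rule order_trans[OF norm_triangle_ineq4]) (simp add: norm_mult)
      also have "\<dots> \<le> B + 1 * B" using z order_trans[OF norm_ge_zero B] by (intro add_mono mult_mono B) simp_all
      finally show ?thesis
        by (subst it[of n j]) (simp add: norm_mult norm_power mult_left_mono)
    qed
    moreover have "(\<lambda>j. \<bar>z\<bar> ^ j * (2 * B)) \<longlonglongrightarrow> 0 * (2 * B)"
      by (intro tendsto_mult tendsto_const LIMSEQ_power_zero) (use z in simp)
    ultimately have "norm (e n) \<le> 0 * (2 * B)" using LIMSEQ_le_const by blast
    then show ?thesis by simp
  qed
  then have "f (Suc n) = of_real z * f n" for n unfolding e_def by (metis eq_iff_diff_eq_0)
  then show ?thesis by (induction n) (simp_all add: f0)
qed

subsection \<open>Modes of the linear problem\<close>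

lemma contracting_root:
  fixes d :: real
  assumes "2 < d"
  defines "z \<equiv> - d / 2 + sqrt (d\<^sup>2 / 4 - 1)"
  shows "- 1 < z" "z < 0" "- (z + 1 / z) = d" "\<bar>z\<bar> = 1 / (d / 2 + sqrt (d\<^sup>2 / 4 - 1))"
proof -
  define s where "s = sqrt (d\<^sup>2 / 4 - 1)"
  have "1 < (d / 2)\<^sup>2" using assms by (intro one_less_power) simp_all
  then have d2: "0 < d\<^sup>2 / 4 - 1" by (simp add: power_divide)
  then have s0: "0 < s" unfolding s_def by simp
  have "s\<^sup>2 = d\<^sup>2 / 4 - 1" unfolding s_def using d2 by simp
  then have prod: "(d / 2 - s) * (d / 2 + s) = 1" by (simp add: algebra_simps power2_eq_square)
  have p: "1 < d / 2 + s" using assms s0 by simp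
  have e: "d / 2 - s = 1 / (d / 2 + s)" using prod p by (simp add: field_simps)
  have z: "z = - (1 / (d / 2 + s))" unfolding z_def s_def[symmetric] e[symmetric] by simp
  show "- 1 < z" "z < 0" using p unfolding z by simp_all
  show "- (z + 1 / z) = d" using e unfolding z by simp
  show "\<bar>z\<bar> = 1 / (d / 2 + sqrt (d\<^sup>2 / 4 - 1))" unfolding z s_def[symmetric] using p by simp
qed

lemma contracting_root_antimono:
  fixes d d' :: real
  assumes "2 < d" "d \<le> d'"
  shows "\<bar>- d' / 2 + sqrt (d'\<^sup>2 / 4 - 1)\<bar> \<le> \<bar>- d / 2 + sqrt (d\<^sup>2 / 4 - 1)\<bar>"
proof -
  have "1 < (d / 2)\<^sup>2" using assms by (intro one_less_power) simp_all
  then have d2: "0 < d\<^sup>2 / 4 - 1" by (simp add: power_divide)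
  have "d\<^sup>2 \<le> d'\<^sup>2" using assms by (intro power_mono) simp_all
  then have "sqrt (d\<^sup>2 / 4 - 1) \<le> sqrt (d'\<^sup>2 / 4 - 1)" by simp
  then show ?thesis
    unfolding contracting_root(4)[OF assms(1)] contracting_root(4)[OF less_le_trans[OF assms]]
    using assms d2 by (intro divide_left_mono mult_pos_pos add_mono add_pos_pos) (auto intro: less_le_trans)
qed

lemma sine_seq_sin:
  assumes "\<delta> = - 2 * cos b" shows "sine_seq \<delta> j * sin b = sin (real j * b)"
proof (induction j rule: induct_nat_012)
  case (ge2 j)
  have "sin (real (Suc (Suc j)) * b) = sin (real (Suc j) * b + b)" by (simp add: algebra_simps)
  moreover have "sin (real j * b) = sin (real (Suc j) * b - b)" by (simp add: algebra_simps)
  ultimately have "sin (real (Suc (Suc j)) * b) = 2 * cos b * sin (real (Suc j) * b) - sin (real j * b)"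
    by (simp only: sin_add sin_diff) simp
  then show ?case using ge2 assms by (simp add: algebra_simps)
qed simp_all

text \<open>
  For the mode \<open>m\<close> the recursion has the coefficient \<open>\<Delta> m\<close>. It is elliptic for \<open>\<bar>m\<bar> \<le> M0\<close> and hyperbolic with
  characteristic root \<open>Z m\<close> for \<open>\<bar>m\<bar> > M0\<close>. Nonresonance excludes the degenerate case \<open>\<Delta> m = 2\<close> with the
  double root \<open>- 1\<close>.
\<close>

locale corrector = nonlinearity +
  fixes \<gamma> :: real
  assumes gamma_pos: "0 < \<gamma>"
    and nonresonant: "\<forall>m::int. (of_int m * \<gamma>)\<^sup>2 / deriv F (- c) \<noteq> 4"
begin

abbreviation \<sigma>0 where "\<sigma>0 \<equiv> sigma0 F c \<gamma>"
abbreviation \<sigma>1 where "\<sigma>1 \<equiv> sigma1 F c \<gamma>"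
abbreviation M0 where "M0 \<equiv> m0 F c \<gamma>"
abbreviation \<Delta> where "\<Delta> \<equiv> delta F c \<gamma>"
abbreviation Z where "Z \<equiv> zroot F c \<gamma>"
abbreviation CKc where "CKc \<equiv> CK F c \<gamma>"

definition freq :: "int \<Rightarrow> real" where "freq m = (of_int m * \<gamma>)\<^sup>2 / deriv F (- c)"

lemma freq_mono: "\<bar>m\<bar> \<le> \<bar>m'\<bar> \<Longrightarrow> freq m \<le> freq m'"
proof -
  assume "\<bar>m\<bar> \<le> \<bar>m'\<bar>"
  then have "\<bar>of_int m :: real\<bar> \<le> \<bar>of_int m'\<bar>" by linarith
  then have "(of_int m * \<gamma>)\<^sup>2 \<le> (of_int m' * \<gamma>)\<^sup>2"
    unfolding power_mult_distrib by (intro mult_right_mono) (simp_all only: abs_le_square_iff zero_le_power2)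
  then show ?thesis unfolding freq_def using deriv_pos by (simp add: divide_right_mono)
qed

lemma freq_nonneg: "0 \<le> freq m"
  unfolding freq_def using deriv_pos by simp

lemma M0_props: "0 \<le> M0" "\<bar>m\<bar> \<le> M0 \<longleftrightarrow> freq m \<le> 4"
proof -
  let ?A = "{m. freq m \<le> 4}"
  have A: "M0 = Max ?A" unfolding m0_def freq_def[symmetric] by (simp add: freq_nonneg)
  define N where "N = \<lceil>2 * sqrt (deriv F (- c)) / \<gamma>\<rceil>"
  have "?A \<subseteq> {- N..N}"
  proof
    fix m assume "m \<in> ?A"
    then have "(of_int m * \<gamma>)\<^sup>2 \<le> (2 * sqrt (deriv F (- c)))\<^sup>2"
      using deriv_pos by (simp add: freq_def field_simps power_mult_distrib)
    then have "\<bar>of_int m * \<gamma>\<bar> \<le> \<bar>2 * sqrt (deriv F (- c))\<bar>" by (simp only: abs_le_square_iff)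
    then have "\<bar>of_int m\<bar> \<le> 2 * sqrt (deriv F (- c)) / \<gamma>"
      using gamma_pos deriv_pos by (simp add: abs_mult field_simps)
    then have "\<bar>of_int m :: real\<bar> \<le> of_int N" unfolding N_def by (meson le_of_int_ceiling order_trans)
    then show "m \<in> {- N..N}" by auto
  qed
  then have fin: "finite ?A" by (rule finite_subset) simp
  have zero: "0 \<in> ?A" by (simp add: freq_def)
  show M: "0 \<le> M0" unfolding A by (rule Max_ge[OF fin zero])
  have in_A: "M0 \<in> ?A" unfolding A by (rule Max_in[OF fin]) (use zero in blast)
  show "\<bar>m\<bar> \<le> M0 \<longleftrightarrow> freq m \<le> 4"
  proof
    assume "\<bar>m\<bar> \<le> M0"
    then have "freq m \<le> freq M0" by (intro freq_mono) simp
    then show "freq m \<le> 4" using in_A by simp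
  next
    assume "freq m \<le> 4"
    then have "freq \<bar>m\<bar> \<le> 4" using freq_mono[of "\<bar>m\<bar>" m] by simp
    then show "\<bar>m\<bar> \<le> M0" unfolding A by (intro Max_ge[OF fin]) simp
  qed
qed

lemma Delta_freq: "\<Delta> m = - 2 + freq m"
  by (simp add: delta_def freq_def)

lemma Delta_hyperbolic: "M0 < \<bar>m\<bar> \<Longrightarrow> 2 < \<Delta> m"
  using M0_props(2)[of m] by (simp add: Delta_freq)

lemma Delta_elliptic:
  assumes "\<bar>m\<bar> \<le> M0" "m \<noteq> 0" shows "- 2 < \<Delta> m" "\<Delta> m < 2"
proof -
  have "0 < freq m" unfolding freq_def using assms gamma_pos deriv_pos by simp
  then show "- 2 < \<Delta> m" by (simp add: Delta_freq)
  have "freq m \<noteq> 4" unfolding freq_def using nonresonant by blast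
  then show "\<Delta> m < 2" using M0_props(2)[of m] assms by (simp add: Delta_freq)
qed

lemma Z_props:
  assumes "M0 < \<bar>m\<bar>"
  shows "- 1 < Z m" "Z m < 0" "- (Z m + 1 / Z m) = \<Delta> m" "\<bar>Z m\<bar> \<le> \<bar>Z (M0 + 1)\<bar>"
proof -
  show "- 1 < Z m" "Z m < 0" "- (Z m + 1 / Z m) = \<Delta> m"
    using contracting_root[OF Delta_hyperbolic[OF assms]] unfolding zroot_def by simp_all
  have "freq (M0 + 1) \<le> freq m" using assms M0_props(1) by (intro freq_mono) simp
  moreover have "M0 < \<bar>M0 + 1\<bar>" using M0_props(1) by simp
  ultimately show "\<bar>Z m\<bar> \<le> \<bar>Z (M0 + 1)\<bar>"
    unfolding zroot_def by (intro contracting_root_antimono Delta_hyperbolic) (simp_all add: Delta_freq)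
qed

lemma sigma_props: "0 < \<sigma>0" "\<sigma>0 \<le> 1" "0 < \<sigma>1" "\<sigma>0 = 4 * \<sigma>1" "\<bar>Z (M0 + 1)\<bar> \<le> exp (- 2 * \<sigma>0)"
proof -
  have z: "- 1 < Z (M0 + 1)" "Z (M0 + 1) < 0"
    using Z_props[of "M0 + 1"] M0_props(1) by simp_all
  then have l: "ln \<bar>Z (M0 + 1)\<bar> < 0" by (intro ln_less_zero) simp_all
  then show "0 < \<sigma>0" unfolding sigma0_def by simp
  then show "0 < \<sigma>1" "\<sigma>0 = 4 * \<sigma>1" by (simp_all add: sigma1_def)
  show "\<sigma>0 \<le> 1" unfolding sigma0_def by simp
  have "\<sigma>0 \<le> - (1 / 2) * ln \<bar>Z (M0 + 1)\<bar>" unfolding sigma0_def by simp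
  then have "ln \<bar>Z (M0 + 1)\<bar> \<le> - 2 * \<sigma>0" by simp
  then have "exp (ln \<bar>Z (M0 + 1)\<bar>) \<le> exp (- 2 * \<sigma>0)" by simp
  then show "\<bar>Z (M0 + 1)\<bar> \<le> exp (- 2 * \<sigma>0)" using z by simp
qed

lemma Z_exp: "M0 < \<bar>m\<bar> \<Longrightarrow> \<bar>Z m\<bar> \<le> exp (- 2 * \<sigma>0)"
  using Z_props(4) sigma_props(5) by (rule order_trans)

text \<open>
  A bound on the increments of \<open>sine_seq (\<Delta> m)\<close>, hence on the elliptic kernel.
\<close>

definition increment :: "int \<Rightarrow> real" where
  "increment m = (if m = 0 then 1 else 2 / \<bar>sin (beta F c \<gamma> m)\<bar>)"

lemma beta_props:
  assumes "\<bar>m\<bar> \<le> M0" "m \<noteq> 0"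
  shows "\<Delta> m = - 2 * cos (beta F c \<gamma> m)" "sin (beta F c \<gamma> m) \<noteq> 0"
    "\<bar>sin (beta F c \<gamma> m)\<bar> = \<bar>sin (beta F c \<gamma> \<bar>m\<bar>)\<bar>"
proof -
  note d = Delta_elliptic[OF assms]
  have sg: "sgn m = 1 \<or> sgn m = - 1" using assms(2) by (auto simp: sgn_if)
  then have "cos (beta F c \<gamma> m) = cos (arccos (- \<Delta> m / 2))"
    unfolding beta_def by auto
  also have "\<dots> = - \<Delta> m / 2" by (rule cos_arccos) (use d in simp_all)
  finally have c: "cos (beta F c \<gamma> m) = - \<Delta> m / 2" .
  then show "\<Delta> m = - 2 * cos (beta F c \<gamma> m)" by simp
  have "(cos (beta F c \<gamma> m))\<^sup>2 < 1" unfolding c using d by (simp add: abs_square_less_1)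
  moreover have "(sin (beta F c \<gamma> m))\<^sup>2 + (cos (beta F c \<gamma> m))\<^sup>2 = 1" by (rule sin_cos_squared_add)
  ultimately have "(sin (beta F c \<gamma> m))\<^sup>2 \<noteq> 0" by linarith
  then show "sin (beta F c \<gamma> m) \<noteq> 0" by simp
  have "\<Delta> \<bar>m\<bar> = \<Delta> m" by (simp add: delta_def power_mult_distrib)
  then show "\<bar>sin (beta F c \<gamma> m)\<bar> = \<bar>sin (beta F c \<gamma> \<bar>m\<bar>)\<bar>"
    unfolding beta_def using sg assms(2) by auto
qed

lemma sine_seq_increment:
  assumes "\<bar>m\<bar> \<le> M0" shows "\<bar>sine_seq (\<Delta> m) (Suc j) - sine_seq (\<Delta> m) j\<bar> \<le> increment m"
proof (cases "m = 0")
  case True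
  have "sine_seq (- 2) j = real j" for j
    by (induction j rule: induct_nat_012) simp_all
  then show ?thesis using True by (simp add: increment_def delta_def)
next
  case False
  let ?b = "beta F c \<gamma> m"
  note b = beta_props[OF assms False]
  have "(sine_seq (\<Delta> m) (Suc j) - sine_seq (\<Delta> m) j) * sin ?b = sin (real (Suc j) * ?b) - sin (real j * ?b)"
    using sine_seq_sin[OF b(1), of j] sine_seq_sin[OF b(1), of "Suc j"] by (simp add: left_diff_distrib)
  then have "\<bar>sine_seq (\<Delta> m) (Suc j) - sine_seq (\<Delta> m) j\<bar> * \<bar>sin ?b\<bar> = \<bar>sin (real (Suc j) * ?b) - sin (real j * ?b)\<bar>"
    by (simp only: abs_mult[symmetric])
  also have "\<dots> \<le> 2"
    using abs_sin_le_one[of "real (Suc j) * ?b"] abs_sin_le_one[of "real j * ?b"] by linarith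
  finally show ?thesis using False b(2) by (simp add: increment_def pos_le_divide_eq)
qed

text \<open>
  Both arguments of the outer maximum in \<open>CK\<close> are operator norms: the first one bounds the hyperbolic
  kernels, the second one the elliptic kernels for all exponents from \<open>\<sigma>1\<close> on.
\<close>

lemma CK_ge:
  "(1 + exp (- 2 * \<sigma>0)) / (1 - exp (- 4 * \<sigma>0)) * (1 / (exp \<sigma>0 - 1) + 1 / (1 - exp (- 2 * \<sigma>0))) \<le> CKc"
  "\<bar>m\<bar> \<le> M0 \<Longrightarrow> increment m / (1 - exp (- \<sigma>1)) \<le> CKc" "0 < CKc"
proof -
  show first: "(1 + exp (- 2 * \<sigma>0)) / (1 - exp (- 4 * \<sigma>0)) * (1 / (exp \<sigma>0 - 1) + 1 / (1 - exp (- 2 * \<sigma>0))) \<le> CKc"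
    unfolding CK_def Let_def by simp
  have "0 < (1 + exp (- 2 * \<sigma>0)) / (1 - exp (- 4 * \<sigma>0)) * (1 / (exp \<sigma>0 - 1) + 1 / (1 - exp (- 2 * \<sigma>0)))"
    using sigma_props(1) by (intro mult_pos_pos divide_pos_pos add_pos_pos) simp_all
  then show "0 < CKc" using first by linarith
  assume m: "\<bar>m\<bar> \<le> M0"
  let ?f = "\<lambda>m. 1 / \<bar>sin (beta F c \<gamma> m)\<bar>"
  let ?S = "if M0 = 0 then 1 else Max (?f ` {0<..M0})"
  have e: "0 < 1 - exp (- \<sigma>1)" using sigma_props(3) by simp
  have Max: "?f j \<le> Max (?f ` {0<..M0})" if "0 < j" "j \<le> M0" for j
    by (rule Max_ge) (use that in auto)
  have "increment m \<le> 2 * ?S"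
  proof (cases "m = 0")
    case True
    have "1 \<le> ?S"
    proof (cases "M0 = 0")
      case False
      then have M1: "1 \<le> M0" using M0_props(1) by simp
      have "sin (beta F c \<gamma> 1) \<noteq> 0" using beta_props(2)[of 1] M1 by simp
      then have "1 \<le> ?f 1" using abs_sin_le_one[of "beta F c \<gamma> 1"] by (simp add: le_divide_eq)
      also have "?f 1 \<le> Max (?f ` {0<..M0})" by (rule Max) (use M1 in simp_all)
      finally show ?thesis using False by simp
    qed simp
    then show ?thesis using True by (simp add: increment_def)
  next
    case False
    then have "M0 \<noteq> 0" using m by auto
    have "?f m = ?f \<bar>m\<bar>" using beta_props(3)[OF m False] by simp
    also have "?f \<bar>m\<bar> \<le> Max (?f ` {0<..M0})" by (rule Max) (use m False in simp_all)
    finally show ?thesis using False \<open>M0 \<noteq> 0\<close> by (simp add: increment_def)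
  qed
  then have "increment m / (1 - exp (- \<sigma>1)) \<le> 2 * ?S / (1 - exp (- \<sigma>1))"
    using e by (intro divide_right_mono) simp_all
  also have "\<dots> \<le> CKc" unfolding CK_def Let_def by simp
  finally show "increment m / (1 - exp (- \<sigma>1)) \<le> CKc" .
qed

subsection \<open>The solution operators\<close>

definition mode_kernel :: "int \<Rightarrow> nat \<Rightarrow> nat \<Rightarrow> real" where
  "mode_kernel m = (if M0 < \<bar>m\<bar> then hyperbolic_kernel (Z m) else elliptic_kernel (\<Delta> m))"

text \<open>
  \<open>Kop y\<close> solves the linear problem with right-hand side \<open>y (n + 1) - y n\<close> and vanishes at \<open>n = 0\<close> in the
  hyperbolic modes. \<open>Sop h\<close> is the decaying homogeneous solution with the values \<open>h\<close> there.
\<close>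

definition Kop :: "seq \<Rightarrow> seq" where
  "Kop y n m = (\<Sum>k. of_real (mode_kernel m n k) * y k m)"

definition Sop :: "(int \<Rightarrow> complex) \<Rightarrow> seq" where
  "Sop h n m = (if M0 < \<bar>m\<bar> then of_real (Z m ^ n) * h m else 0)"

lemma mode_kernel_eq: "kernel_eq (\<Delta> m) (mode_kernel m)"
proof (cases "M0 < \<bar>m\<bar>")
  case True
  have "kernel_eq (- (Z m + 1 / Z m)) (hyperbolic_kernel (Z m))"
    by (rule hyperbolic_kernel_eq) (use Z_props(1,2)[OF True] in simp_all)
  then show ?thesis using True Z_props(3)[OF True] by (simp add: mode_kernel_def)
qed (simp add: mode_kernel_def elliptic_kernel_eq)

lemma mode_kernel_bound:
  assumes "\<sigma>1 \<le> \<sigma>" "\<sigma> \<le> \<sigma>0" shows "kernel_bound (mode_kernel m) \<sigma> CKc"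
proof -
  have mono: "kernel_bound \<kappa> \<sigma> C \<Longrightarrow> C \<le> CKc \<Longrightarrow> kernel_bound \<kappa> \<sigma> CKc" for \<kappa> C
    unfolding kernel_bound_def by (meson order_trans)
  show ?thesis
  proof (cases "M0 < \<bar>m\<bar>")
    case True
    have "kernel_bound (hyperbolic_kernel (Z m)) \<sigma> CKc"
      by (rule mono[OF hyperbolic_kernel_bound CK_ge(1)])
        (use Z_props(1,2)[OF True] Z_exp[OF True] sigma_props assms in simp_all)
    then show ?thesis using True by (simp add: mode_kernel_def)
  next
    case False
    have "kernel_bound (elliptic_kernel (\<Delta> m)) \<sigma> CKc"
      by (rule mono[OF elliptic_kernel_bound[OF sine_seq_increment _ assms(1)] CK_ge(2)])
        (use False sigma_props in simp_all)
    then show ?thesis using False by (simp add: mode_kernel_def)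
  qed
qed

lemma Kop_summable:
  assumes "bd \<sigma> y s" "\<sigma>1 \<le> \<sigma>" "\<sigma> \<le> \<sigma>0"
  shows "summable (\<lambda>k. of_real (mode_kernel m n k) * y k m)"
  by (rule kernel_bound_apply(1)[OF mode_kernel_bound[OF assms(2,3)] bd_point[OF assms(1)]])

lemma Kop_bd:
  assumes "bd \<sigma> y s" "\<sigma>1 \<le> \<sigma>" "\<sigma> \<le> \<sigma>0"
  shows "bd \<sigma> (Kop y) (CKc * s)"
proof -
  from bd_majorant[OF assms(1)] obtain f where f: "\<And>n m. exp (\<sigma> * real n) * cmod (y n m) \<le> f m"
    "\<And>m. 0 \<le> f m" "(\<lambda>m. w m * f m) summable_on UNIV" "(\<Sum>\<^sub>\<infinity>m. w m * f m) \<le> s" by metis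
  have e: "w m * (CKc * f m) = CKc * (w m * f m)" for m by simp
  show ?thesis
  proof (rule bd_majorantI)
    show "exp (\<sigma> * real n) * cmod (Kop y n m) \<le> CKc * f m" for n m
      unfolding Kop_def by (rule kernel_bound_apply(2)[OF mode_kernel_bound[OF assms(2,3)] f(1)])
    show "(\<lambda>m. w m * (CKc * f m)) summable_on UNIV"
      unfolding e by (rule summable_on_cmult_right[OF f(3)])
    show "(\<Sum>\<^sub>\<infinity>m. w m * (CKc * f m)) \<le> CKc * s"
      unfolding e infsum_cmult_right' using f(4) CK_ge(3) by simp
  qed
qed

lemma Kop_diff:
  assumes "bd \<sigma> y s" "bd \<sigma> y' s'" "\<sigma>1 \<le> \<sigma>" "\<sigma> \<le> \<sigma>0"
  shows "Kop (y - y') = Kop y - Kop y'"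
proof (intro ext)
  fix n m
  show "Kop (y - y') n m = (Kop y - Kop y') n m"
    using suminf_diff[OF Kop_summable[OF assms(1,3,4), of m n] Kop_summable[OF assms(2,3,4), of m n]]
    by (simp add: Kop_def right_diff_distrib)
qed

lemma Kop_add:
  assumes "bd \<sigma> y s" "bd \<sigma> y' s'" "\<sigma>1 \<le> \<sigma>" "\<sigma> \<le> \<sigma>0"
  shows "Kop (y + y') = Kop y + Kop y'"
  using Kop_diff[OF bd_add[OF assms(1,2)] assms(2-4)] by simp

lemma Kop_scaleR:
  assumes "bd \<sigma> y s" "\<sigma>1 \<le> \<sigma>" "\<sigma> \<le> \<sigma>0"
  shows "Kop (t *\<^sub>R y) = t *\<^sub>R Kop y"
proof (intro ext)
  fix n m
  have "Kop (t *\<^sub>R y) n m = (\<Sum>k. t *\<^sub>R (of_real (mode_kernel m n k) * y k m))"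
    by (simp add: Kop_def scaleR_fun_def)
  also have "\<dots> = t *\<^sub>R Kop y n m"
    unfolding Kop_def by (rule suminf_scaleR_right[OF Kop_summable[OF assms], symmetric])
  finally show "Kop (t *\<^sub>R y) n m = (t *\<^sub>R Kop y) n m" by (simp add: scaleR_fun_def)
qed

lemma Kop_equation:
  assumes "bd \<sigma> y s" "\<sigma>1 \<le> \<sigma>" "\<sigma> \<le> \<sigma>0"
  shows "Kop y n m + of_real (\<Delta> m) * Kop y (Suc n) m + Kop y (Suc (Suc n)) m = y (Suc (Suc n)) m - y (Suc n) m"
  unfolding Kop_def by (rule kernel_solves[OF mode_kernel_eq Kop_summable[OF assms]])

lemma Kop_boundary: "M0 < \<bar>m\<bar> \<Longrightarrow> Kop y 0 m = 0"
proof -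
  assume "M0 < \<bar>m\<bar>"
  then have "mode_kernel m 0 k = 0" for k by (simp add: mode_kernel_def hyperbolic_kernel_def)
  then show ?thesis by (simp add: Kop_def)
qed

lemma Sop_equation:
  "Sop h n m + of_real (\<Delta> m) * Sop h (Suc n) m + Sop h (Suc (Suc n)) m = 0"
proof (cases "M0 < \<bar>m\<bar>")
  case True
  have "1 + - (Z m + 1 / Z m) * Z m + Z m * Z m = 0"
    using Z_props(2)[OF True] by (simp add: field_simps)
  then have "of_real (1 + \<Delta> m * Z m + Z m * Z m) = (0::complex)"
    unfolding Z_props(3)[OF True] by (simp only: of_real_0)
  then have "of_real (Z m ^ n) * h m * (1 + of_real (\<Delta> m) * of_real (Z m) + of_real (Z m) * of_real (Z m)) = 0"
    by simp
  moreover have "Sop h n m + of_real (\<Delta> m) * Sop h (Suc n) m + Sop h (Suc (Suc n)) m =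
      of_real (Z m ^ n) * h m * (1 + of_real (\<Delta> m) * of_real (Z m) + of_real (Z m) * of_real (Z m))"
    using True by (simp add: Sop_def algebra_simps)
  ultimately show ?thesis by simp
qed (simp add: Sop_def)

lemma Sop_diff: "Sop (g - h) = Sop g - Sop h"
  by (intro ext) (simp add: Sop_def algebra_simps)

lemma Sop_add: "Sop (g + h) = Sop g + Sop h"
  by (intro ext) (simp add: Sop_def algebra_simps)

lemma Sop_scaleR: "Sop (t *\<^sub>R h) = t *\<^sub>R Sop h"
  by (intro ext) (simp add: Sop_def scaleR_fun_def)

lemma Sop_bd:
  assumes h: "\<And>A. finite A \<Longrightarrow> A \<subseteq> {m. M0 < \<bar>m\<bar>} \<Longrightarrow> (\<Sum>m\<in>A. w m * cmod (h m)) \<le> s"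
  shows "bd \<sigma>0 (Sop h) s"
proof (rule bdI)
  fix A :: "int set" and n assume A: "finite A"
  have "sel \<sigma>0 (Sop h) n A =
      (\<Sum>m\<in>A \<inter> {m. M0 < \<bar>m\<bar>}. w m * (exp (\<sigma>0 * real (n m)) * cmod (Sop h (n m) m)))"
    by (rule sum.mono_neutral_right[OF A]) (auto simp: Sop_def)
  also have "\<dots> \<le> (\<Sum>m\<in>A \<inter> {m. M0 < \<bar>m\<bar>}. w m * cmod (h m))"
  proof (rule sum_mono)
    fix m assume "m \<in> A \<inter> {m. M0 < \<bar>m\<bar>}"
    then have m: "M0 < \<bar>m\<bar>" by simp
    have "exp \<sigma>0 * \<bar>Z m\<bar> \<le> exp \<sigma>0 * exp (- 2 * \<sigma>0)" using Z_exp[OF m] by (intro mult_left_mono) simp_all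
    also have "\<dots> \<le> 1" unfolding exp_add[symmetric] using sigma_props(1) by simp
    finally have "(exp \<sigma>0 * \<bar>Z m\<bar>) ^ n m \<le> 1" by (intro power_le_one) simp_all
    moreover have "exp (\<sigma>0 * real (n m)) = exp \<sigma>0 ^ n m" by (simp add: exp_of_nat_mult[symmetric] mult.commute)
    ultimately have "exp (\<sigma>0 * real (n m)) * \<bar>Z m\<bar> ^ n m \<le> 1" by (simp add: power_mult_distrib)
    then have "exp (\<sigma>0 * real (n m)) * \<bar>Z m\<bar> ^ n m * cmod (h m) \<le> 1 * cmod (h m)"
      by (rule mult_right_mono) simp
    then show "w m * (exp (\<sigma>0 * real (n m)) * cmod (Sop h (n m) m)) \<le> w m * cmod (h m)"
      using m by (intro mult_left_mono w_nonneg) (simp add: Sop_def norm_mult norm_power mult.assoc)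
  qed
  also have "\<dots> \<le> s" by (rule h) (use A in auto)
  finally show "sel \<sigma>0 (Sop h) n A \<le> s" .
qed

text \<open>
  The boundary row of a sequence is insensitive to the exponent, since \<open>exp (\<sigma> * 0) = 1\<close>. So \<open>Sop\<close> recovers
  full decay even from a growing sequence.
\<close>

lemma Sop_row_bd:
  assumes "bd \<sigma> x s" shows "bd \<sigma>0 (Sop (x 0)) s"
proof (rule Sop_bd)
  fix A :: "int set" assume "finite A"
  then show "(\<Sum>m\<in>A. w m * cmod (x 0 m)) \<le> s" using bdD[OF assms, of A "\<lambda>_. 0"] by simp
qed

lemma linear_problem_unique:
  assumes v: "bd \<sigma> v t" and y: "bd \<sigma> y s" and \<sigma>: "\<sigma>1 \<le> \<sigma>" "\<sigma> \<le> \<sigma>0"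
    and eq: "\<And>n m. v n m + of_real (\<Delta> m) * v (Suc n) m + v (Suc (Suc n)) m = y (Suc (Suc n)) m - y (Suc n) m"
    and h: "\<And>m. M0 < \<bar>m\<bar> \<Longrightarrow> v 0 m = h m"
  shows "v = Sop h + Kop y"
proof (intro ext)
  fix n m
  define f where "f n = v n m - Kop y n m - Sop h n m" for n
  have hom: "f n + of_real (\<Delta> m) * f (Suc n) + f (Suc (Suc n)) = 0" for n
  proof -
    have "f n + of_real (\<Delta> m) * f (Suc n) + f (Suc (Suc n)) =
      (v n m + of_real (\<Delta> m) * v (Suc n) m + v (Suc (Suc n)) m)
      - (Kop y n m + of_real (\<Delta> m) * Kop y (Suc n) m + Kop y (Suc (Suc n)) m)
      - (Sop h n m + of_real (\<Delta> m) * Sop h (Suc n) m + Sop h (Suc (Suc n)) m)"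
      unfolding f_def by (simp add: algebra_simps)
    then show ?thesis unfolding eq Kop_equation[OF y \<sigma>] Sop_equation by simp
  qed
  have sp: "0 < \<sigma>" using \<sigma> sigma_props(3) by simp
  have vK: "bd \<sigma> (v - Kop y) (t + CKc * s)" by (rule bd_diff[OF v Kop_bd[OF y \<sigma>]])
  have "f n = 0"
  proof (cases "M0 < \<bar>m\<bar>")
    case True
    show ?thesis
    proof (rule hyperbolic_homogeneous_zero)
      show "f n + of_real (- (Z m + 1 / Z m)) * f (Suc n) + f (Suc (Suc n)) = 0" for n
        unfolding Z_props(3)[OF True] by (rule hom)
      show "Z m \<noteq> 0" "\<bar>Z m\<bar> < 1" using Z_props(1,2)[OF True] by simp_all
      show "f 0 = 0" unfolding f_def using h[OF True] Kop_boundary[OF True] True by (simp add: Sop_def)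
      show "cmod (f n) \<le> (t + CKc * s) + cmod (h m)" for n
      proof -
        have "cmod ((v - Kop y) n m) \<le> exp (- \<sigma> * real n) * (t + CKc * s)" by (rule bd_point'[OF vK])
        also have "\<dots> \<le> 1 * (t + CKc * s)"
          using sp bd_nonneg[OF vK] by (intro mult_right_mono) simp_all
        finally have 1: "cmod ((v - Kop y) n m) \<le> t + CKc * s" by simp
        have "\<bar>Z m\<bar> ^ n \<le> 1" using Z_props(1,2)[OF True] by (intro power_le_one) simp_all
        then have 2: "cmod (Sop h n m) \<le> cmod (h m)"
          using True mult_right_mono[of "\<bar>Z m\<bar> ^ n" 1 "cmod (h m)"] by (simp add: Sop_def norm_mult norm_power)
        have "f n = (v - Kop y) n m - Sop h n m" by (simp add: f_def)
        then show ?thesis by (simp only:) (rule order_trans[OF norm_triangle_ineq4 add_mono[OF 1 2]])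
      qed
    qed
  next
    case False
    show ?thesis
    proof (rule elliptic_homogeneous_zero[where f = f and \<delta> = "\<Delta> m", OF hom _ sp])
      show "\<bar>sine_seq (\<Delta> m) (Suc j) - sine_seq (\<Delta> m) j\<bar> \<le> increment m" for j
        by (rule sine_seq_increment) (use False in simp)
      show "cmod (f n) \<le> exp (- \<sigma> * real n) * (t + CKc * s)" for n
        using bd_point'[OF vK, of n m] False by (simp add: f_def Sop_def)
    qed
  qed
  then show "v n m = (Sop h + Kop y) n m" by (simp add: f_def algebra_simps)
qed

lemma mode_kernel_minus: "mode_kernel (- m) = mode_kernel m"
  unfolding mode_kernel_def zroot_def delta_def by (simp add: power_mult_distrib)

lemma csym_Kop:
  assumes "bd \<sigma> y s" "\<sigma>1 \<le> \<sigma>" "\<sigma> \<le> \<sigma>0" "csym y" shows "csym (Kop y)"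
  unfolding csym_def
proof (intro allI)
  fix n m
  have "(\<lambda>k. cnj (of_real (mode_kernel m n k) * y k m)) sums cnj (Kop y n m)"
    unfolding Kop_def sums_cnj by (rule summable_sums[OF Kop_summable[OF assms(1-3)]])
  then have "(\<lambda>k. of_real (mode_kernel (- m) n k) * y k (- m)) sums cnj (Kop y n m)"
    using assms(4) by (simp add: mode_kernel_minus csym_def)
  then show "Kop y n (- m) = cnj (Kop y n m)" unfolding Kop_def by (rule sums_unique[symmetric])
qed

lemma csym_Sop: "(\<And>m. h (- m) = cnj (h m)) \<Longrightarrow> csym (Sop h)"
  unfolding csym_def Sop_def zroot_def delta_def by (simp add: power_mult_distrib)

end

section \<open>Contractions on the sequence spaces\<close>

context weighted
begin

lemma bd_0_imp_0: assumes "bd \<sigma> x 0" shows "x = 0"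
proof (intro ext)
  fix n m
  have "cmod (x n m) \<le> exp (- \<sigma> * real n) * 0" by (rule bd_point'[OF assms])
  then show "x n m = 0 n m" by simp
qed

text \<open>
  The norm \<open>N\<close> of \<open>x\<close> satisfies \<open>N \<le> s + N / 4\<close>, so \<open>N\<close> is at most \<open>4 / 3 * s\<close>.
\<close>

lemma quarter_bound:
  assumes "bd \<sigma> x r" and step: "\<And>t. bd \<sigma> x t \<Longrightarrow> bd \<sigma> x (s + t / 4)"
  shows "bd \<sigma> x (2 * s)"
proof -
  define N where "N = nrm (Lsp \<sigma> w) x"
  have N: "bd \<sigma> x N" using assms(1) by (simp add: bd_iff N_def)
  from step[OF N] have "N \<le> s + N / 4" by (simp add: bd_iff N_def)
  moreover have "0 \<le> N" by (rule bd_nonneg[OF N])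
  ultimately show ?thesis by (intro bd_mono[OF N]) linarith
qed

text \<open>
  Banach's fixed point theorem for a set \<open>S\<close> that is closed under entrywise limits of bounded sequences.
  Completeness enters in this form: the iterates converge entry by entry, and the Cauchy
  bounds pass to the limit. The constant 1/4 is the one that the choice of \<open>c1\<close> provides.
\<close>

lemma contraction_fixed_point:
  assumes x0: "x0 \<in> S"
    and bounded: "\<And>x. x \<in> S \<Longrightarrow> \<exists>r. bd \<sigma> x r"
    and closed: "\<And>X x r. (\<And>i. X i \<in> S) \<Longrightarrow> (\<And>n m. (\<lambda>i. X i n m) \<longlonglongrightarrow> x n m) \<Longrightarrow> bd \<sigma> x r \<Longrightarrow> x \<in> S"
    and maps: "\<And>x. x \<in> S \<Longrightarrow> f x \<in> S"
    and contr: "\<And>x y d. x \<in> S \<Longrightarrow> y \<in> S \<Longrightarrow> bd \<sigma> (x - y) d \<Longrightarrow> bd \<sigma> (f x - f y) (d / 4)"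
  shows "\<exists>x\<in>S. f x = x"
proof -
  define X where "X i = (f ^^ i) x0" for i
  have X: "X i \<in> S" for i unfolding X_def by (induction i) (simp_all add: x0 maps)
  have XS: "X (Suc i) = f (X i)" for i by (simp add: X_def)
  obtain r0 r1 where "bd \<sigma> (X 0) r0" "bd \<sigma> (X (Suc 0)) r1" using bounded[OF X] by meson
  then have "bd \<sigma> (X (Suc 0) - X 0) (r1 + r0)" by (intro bd_diff)
  then obtain D where D: "bd \<sigma> (X (Suc 0) - X 0) D" by blast
  have D0: "0 \<le> D" by (rule bd_nonneg[OF D])
  have step: "bd \<sigma> (X (Suc i) - X i) (D * (1 / 4) ^ i)" for i
  proof (induction i)
    case 0 show ?case by (rule bd_mono[OF D]) simp
  next
    case (Suc i)
    have "bd \<sigma> (X (Suc (Suc i)) - X (Suc i)) (D * (1 / 4) ^ i / 4)"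
      using contr[OF X X Suc] by (simp only: XS[symmetric])
    then show ?case by (rule bd_mono) simp
  qed
  have tail: "bd \<sigma> (X (i + j) - X i) (2 * D * (1 / 4) ^ i)" for i j
  proof -
    \<comment> \<open>The geometric sum is at most \<open>4 / 3 * D * (1 / 4)\<^sup>i\<close>; the factor 2 with the deficit \<open>1 - (1 / 4)\<^sup>j\<close> is a
      bound that an induction on \<open>j\<close> reproduces.\<close>
    have "bd \<sigma> (X (i + j) - X i) (2 * D * (1 / 4) ^ i * (1 - (1 / 4) ^ j))"
    proof (induction j)
      case 0 show ?case using bd_zero by (simp only: add_0_right diff_self power_0 mult_zero_right)
    next
      case (Suc j)
      have e: "X (i + Suc j) - X i = (X (Suc (i + j)) - X (i + j)) + (X (i + j) - X i)" by simp
      have "0 \<le> D * (1 / 4) ^ (i + j)" using D0 by simp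
      then have "D * (1 / 4) ^ (i + j) + 2 * D * (1 / 4) ^ i * (1 - (1 / 4) ^ j) \<le> 2 * D * (1 / 4) ^ i * (1 - (1 / 4) ^ Suc j)"
        by (simp add: power_add algebra_simps)
      then show ?case unfolding e by (rule bd_mono[OF bd_add[OF step Suc]])
    qed
    moreover have "2 * D * (1 / 4) ^ i * (1 - (1 / 4) ^ j) \<le> 2 * D * (1 / 4) ^ i * 1"
      using D0 by (intro mult_left_mono) simp_all
    ultimately show ?thesis using bd_mono by simp
  qed
  have "convergent (\<lambda>i. X i n m)" for n m
  proof -
    have "summable (\<lambda>i. X (Suc i) n m - X i n m)"
    proof (rule summable_comparison_test)
      show "summable (\<lambda>i. exp (- \<sigma> * real n) * (D * (1 / 4) ^ i))"
        by (intro summable_mult summable_geometric) simp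
      show "\<exists>N. \<forall>i\<ge>N. norm (X (Suc i) n m - X i n m) \<le> exp (- \<sigma> * real n) * (D * (1 / 4) ^ i)"
        using bd_point'[OF step, of _ n m] by auto
    qed
    then have "convergent (\<lambda>N. \<Sum>i<N. X (Suc i) n m - X i n m)" by (simp add: summable_iff_convergent)
    then have "convergent (\<lambda>N. X N n m - X 0 n m)" by (simp only: sum_lessThan_telescope[of "\<lambda>i. X i n m"])
    then show ?thesis using convergent_diff_const_right_iff by blast
  qed
  then obtain x where x: "(\<lambda>i. X i n m) \<longlonglongrightarrow> x n m" for n m
    unfolding convergent_def by metis
  have lim: "bd \<sigma> (x - X i) (2 * D * (1 / 4) ^ i)" for i
  proof (rule bd_limit[where X = "\<lambda>j. X (i + j) - X i", OF tail tendsto_const])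
    fix n m
    have "(\<lambda>j. X (j + i) n m) \<longlonglongrightarrow> x n m" by (rule LIMSEQ_ignore_initial_segment[OF x])
    then show "(\<lambda>j. (X (i + j) - X i) n m) \<longlonglongrightarrow> (x - X i) n m"
      by (simp add: add.commute tendsto_diff)
  qed
  obtain r where r: "bd \<sigma> (X 0) r" using bounded[OF X] by blast
  have "bd \<sigma> x (2 * D * (1 / 4) ^ 0 + r)"
    using bd_add[OF lim[of 0] r] by (simp only: diff_add_cancel)
  then have xS: "x \<in> S" by (rule closed[OF X x])
  have "bd \<sigma> (f x - x) (2 * D * (1 / 4) ^ i / 4 + 2 * D * (1 / 4) ^ Suc i)" for i
  proof -
    have "f x - x = (f x - f (X i)) - (x - X (Suc i))" unfolding XS by simp
    then show ?thesis using bd_diff[OF contr[OF xS X lim] lim[of "Suc i"], of i] by simp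
  qed
  moreover have "(\<lambda>i. 2 * D * (1 / 4) ^ i / 4 + 2 * D * (1 / 4) ^ Suc i) \<longlonglongrightarrow> 2 * D * 0 / 4 + 2 * D * 0"
    by (intro tendsto_add tendsto_mult tendsto_divide tendsto_const LIMSEQ_power_zero LIMSEQ_Suc[OF LIMSEQ_power_zero]) simp_all
  ultimately have "bd \<sigma> (f x - x) (2 * D * 0 / 4 + 2 * D * 0)"
    by (rule bd_limit[where X = "\<lambda>_. f x - x"]) simp
  then have "f x - x = 0" by (intro bd_0_imp_0) simp
  then show ?thesis using xS by auto
qed

end

section \<open>The corrector as a fixed point\<close>

context corrector
begin

abbreviation c1 where "c1 \<equiv> c1const F c \<gamma> CF"
abbreviation G where "G \<equiv> Gs coeff"
abbreviation DG where "DG \<equiv> DGs coeff"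

lemma c1_props: "0 < c1" "c1 \<le> rh / 8" "CKc * (CF * c1) \<le> 1 / 4"
proof -
  have p: "0 < 4 * CKc * CF" using CK_ge(3) CF_pos by simp
  then show "0 < c1" using rho_props(1) by (simp add: c1const_def)
  show "c1 \<le> rh / 8" by (simp add: c1const_def)
  have "c1 \<le> 1 / (4 * CKc * CF)" by (simp add: c1const_def)
  then have "(CKc * CF) * c1 \<le> (CKc * CF) * (1 / (4 * CKc * CF))" using CK_ge(3) CF_pos by (intro mult_left_mono) (simp_all only: mult_nonneg_nonneg less_imp_le)
  then show "CKc * (CF * c1) \<le> 1 / 4" using CK_ge(3) CF_pos by simp
qed

lemma bd_u8: "bd 0 u c1 \<Longrightarrow> bd 0 u (rh / 8)"
  using bd_mono c1_props(2) by blast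

lemma in_disc_u: "bd 0 u c1 \<Longrightarrow> in_disc u"
  by (rule in_disc_self[OF bd_u8])

lemma in_disc_uv:
  assumes "bd 0 u c1" "bd \<sigma> v R" "0 \<le> \<sigma>" "R < c1" shows "in_disc (u + v)"
proof (rule in_disc_add[OF bd_u8[OF assms(1)]])
  show "bd 0 v (rh / 8)"
    by (rule bd_mono[OF bd_exponent_mono[OF assms(2,3)]]) (use assms(4) c1_props(2) in simp)
qed

lemma G_lipschitz:
  assumes u: "bd 0 u c1" and v: "bd \<sigma> v R" "bd \<sigma> v' R" "R < c1" and \<sigma>: "\<sigma>1 \<le> \<sigma>" "\<sigma> \<le> \<sigma>0"
    and d: "bd \<sigma> (v' - v) d"
  shows "bd \<sigma> (G (u + v') - G (u + v)) (CF * c1 * d)"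
  by (rule Gs_lipschitz_CF[OF u _ _ _ v(1,2) _ _ d]) (use v(3) c1_props \<sigma> sigma_props in simp_all)

lemma Kop_G_contracts:
  assumes u: "bd 0 u c1" and v: "bd \<sigma> v R" "bd \<sigma> v' R" "R < c1" and \<sigma>: "\<sigma>1 \<le> \<sigma>" "\<sigma> \<le> \<sigma>0"
    and d: "bd \<sigma> (v' - v) d"
  shows "bd \<sigma> (Kop (G (u + v') - G (u + v))) (d / 4)"
proof (rule bd_mono[OF Kop_bd[OF G_lipschitz[OF assms] \<sigma>]])
  show "CKc * (CF * c1 * d) \<le> d / 4"
    using mult_right_mono[OF c1_props(3) bd_nonneg[OF d]] by (simp add: mult_ac)
qed

lemma DG_bd:
  assumes u: "bd 0 u c1" and v: "bd \<sigma> v R" "R < c1" and \<sigma>: "\<sigma>1 \<le> \<sigma>" "\<sigma> \<le> \<sigma>0" and x: "bd \<sigma> x s"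
  shows "bd \<sigma> (DG (u + v) x) (CF * c1 * s)"
  by (rule DGs_CF[OF u _ v(1) _ _ _ _ x]) (use v(2) c1_props \<sigma> sigma_props in simp_all)

lemma Kop_DG_contracts:
  assumes u: "bd 0 u c1" and v: "bd \<sigma> v R" "R < c1" and \<sigma>: "\<sigma>1 \<le> \<sigma>" "\<sigma> \<le> \<sigma>0" and x: "bd \<sigma> x s"
  shows "bd \<sigma> (Kop (DG (u + v) x)) (s / 4)"
proof (rule bd_mono[OF Kop_bd[OF DG_bd[OF assms] \<sigma>]])
  show "CKc * (CF * c1 * s) \<le> s / 4"
    using mult_right_mono[OF c1_props(3) bd_nonneg[OF x]] by (simp add: mult_ac)
qed

lemma Y_bd:
  assumes u: "bd 0 u c1" and v: "bd \<sigma> v R" "R < c1" and \<sigma>: "\<sigma>1 \<le> \<sigma>" "\<sigma> \<le> \<sigma>0"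
  shows "bd \<sigma> (G (u + v) - G u) (CF * c1 * R)"
proof -
  have "bd \<sigma> 0 R" by (rule bd_mono[OF bd_zero bd_nonneg[OF v(1)]])
  moreover have "bd \<sigma> (v - 0) R" using v(1) by simp
  ultimately show ?thesis using G_lipschitz[OF u _ v(1,2) \<sigma>, of 0 R] by simp
qed

definition Phi :: "seq \<Rightarrow> (int \<Rightarrow> complex) \<Rightarrow> seq \<Rightarrow> seq" where
  "Phi u h v = Sop h + Kop (G (u + v) - G u)"

lemma Phi_contracts:
  assumes u: "bd 0 u c1" and v: "bd \<sigma> v R" "bd \<sigma> v' R" "R < c1" and \<sigma>: "\<sigma>1 \<le> \<sigma>" "\<sigma> \<le> \<sigma>0"
    and d: "bd \<sigma> (v' - v) d"
  shows "bd \<sigma> (Phi u h v' - Phi u h v) (d / 4)"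
proof -
  have "Kop (G (u + v') - G u) - Kop (G (u + v) - G u) = Kop ((G (u + v') - G u) - (G (u + v) - G u))"
    by (rule Kop_diff[symmetric, OF Y_bd[OF u v(2,3) \<sigma>] Y_bd[OF u v(1,3) \<sigma>] \<sigma>])
  then have "Phi u h v' - Phi u h v = Kop (G (u + v') - G (u + v))" by (simp add: Phi_def)
  then show ?thesis using Kop_G_contracts[OF assms] by simp
qed

definition bdata :: "(int \<Rightarrow> complex) \<Rightarrow> seq \<Rightarrow> real \<Rightarrow> int \<Rightarrow> complex" where
  "bdata b u \<epsilon> m = of_real \<epsilon> * b m - u 0 m"

lemma sigma_range: "\<sigma>1 \<le> \<sigma>0" "\<sigma>0 \<le> \<sigma>0" "0 \<le> \<sigma>0"
  using sigma_props by simp_all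

lemma is_corrector_iff_fixed_point:
  assumes u: "bd 0 u c1" and R: "2 * (rho_u F c \<gamma> w u + \<bar>\<epsilon>\<bar>) < c1"
  shows "is_corrector F c \<gamma> w b CF u \<epsilon> v \<longleftrightarrow>
     bd \<sigma>0 v (2 * (rho_u F c \<gamma> w u + \<bar>\<epsilon>\<bar>)) \<and> Phi u (bdata b u \<epsilon>) v = v"
proof -
  let ?R = "2 * (rho_u F c \<gamma> w u + \<bar>\<epsilon>\<bar>)" and ?h = "bdata b u \<epsilon>"
  define y where "y = G (u + v) - G u"
  have Phi: "Phi u ?h v = Sop ?h + Kop y" by (simp only: Phi_def y_def)
  have Ybd: "bd \<sigma>0 y (CF * c1 * ?R)" if "bd \<sigma>0 v ?R"
    unfolding y_def by (rule Y_bd[OF u that R sigma_range(1,2)])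
  have W: "W2 F c u v (Suc n) m = y (Suc n) m - y (Suc (Suc n)) m" if "bd \<sigma>0 v ?R" for n m
    unfolding W2_def Y_eq_Gs[OF in_disc_u[OF u] in_disc_uv[OF u that sigma_range(3) R]] y_def by simp
  show ?thesis
  proof
    assume C: "is_corrector F c \<gamma> w b CF u \<epsilon> v"
    then have v: "bd \<sigma>0 v ?R" unfolding is_corrector_def bd_iff by blast
    have "v = Sop ?h + Kop y"
    proof (rule linear_problem_unique[OF v Ybd[OF v] sigma_range(1,2)])
      fix n m
      have "v (Suc n - 1) m + of_real (\<Delta> m) * v (Suc n) m + v (Suc n + 1) m + W2 F c u v (Suc n) m = 0"
        using C unfolding is_corrector_def by (metis Suc_eq_plus1 le_add2)
      then show "v n m + of_real (\<Delta> m) * v (Suc n) m + v (Suc (Suc n)) m = y (Suc (Suc n)) m - y (Suc n) m"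
        unfolding W[OF v] by (simp add: algebra_simps add_eq_0_iff)
    next
      fix m assume "M0 < \<bar>m\<bar>"
      then show "v 0 m = ?h m" using C unfolding is_corrector_def bdata_def by blast
    qed
    from this[symmetric] show "bd \<sigma>0 v ?R \<and> Phi u ?h v = v" using v unfolding Phi by blast
  next
    assume A: "bd \<sigma>0 v ?R \<and> Phi u ?h v = v"
    then have v: "bd \<sigma>0 v ?R" and fp: "v = Sop ?h + Kop y" by (simp_all add: Phi)
    note y = Ybd[OF v]
    have fpn: "v n m = Sop ?h n m + Kop y n m" for n m
      using arg_cong[OF fp, of "\<lambda>x. x n m"] by (simp only: plus_fun_apply)
    have eq: "v n m + of_real (\<Delta> m) * v (Suc n) m + v (Suc (Suc n)) m = y (Suc (Suc n)) m - y (Suc n) m" for n m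
    proof -
      have "v n m + of_real (\<Delta> m) * v (Suc n) m + v (Suc (Suc n)) m =
         (Sop ?h n m + of_real (\<Delta> m) * Sop ?h (Suc n) m + Sop ?h (Suc (Suc n)) m) +
         (Kop y n m + of_real (\<Delta> m) * Kop y (Suc n) m + Kop y (Suc (Suc n)) m)"
        unfolding fpn by (simp add: algebra_simps)
      then show ?thesis unfolding Sop_equation Kop_equation[OF y sigma_range(1,2)] by simp
    qed
    have e: "v (n - 1) m + of_real (\<Delta> m) * v n m + v (n + 1) m + W2 F c u v n m = 0" if n: "1 \<le> n" for n m
    proof -
      obtain k where k: "n = Suc k" using n by (cases n) auto
      show ?thesis unfolding k W[OF v] using eq[of k m] by (simp add: algebra_simps)
    qed
    have "v 0 m = ?h m" if "M0 < \<bar>m\<bar>" for m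
    proof -
      show ?thesis unfolding fpn[of 0 m] using that Kop_boundary[OF that] by (simp add: Sop_def)
    qed
    then show "is_corrector F c \<gamma> w b CF u \<epsilon> v"
      using v R e c1_props(2) unfolding is_corrector_def bdata_def bd_iff by auto
  qed
qed

lemma Sop_bdata_bd:
  assumes u: "bd 0 u c1" and b: "((\<lambda>m. w m * cmod (b m)) has_sum 1) UNIV"
  shows "bd \<sigma>0 (Sop (bdata b u \<epsilon>)) (rho_u F c \<gamma> w u + \<bar>\<epsilon>\<bar>)"
proof (rule Sop_bd)
  fix A assume A: "finite A" "A \<subseteq> {m. M0 < \<bar>m\<bar>}"
  have us: "(\<lambda>m. w m * cmod (u 0 m)) summable_on {m. M0 < \<bar>m\<bar>}"
  proof (rule nonneg_bdd_above_summable_on)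
    show "bdd_above (sum (\<lambda>m. w m * cmod (u 0 m)) ` {A. A \<subseteq> {m. M0 < \<bar>m\<bar>} \<and> finite A})"
      by (rule bdd_aboveI[of _ c1]) (use bdD[OF u, of _ "\<lambda>_. 0"] in auto)
  qed (simp add: w_nonneg)
  have "(\<Sum>m\<in>A. w m * cmod (bdata b u \<epsilon> m)) \<le> (\<Sum>m\<in>A. w m * cmod (u 0 m) + \<bar>\<epsilon>\<bar> * (w m * cmod (b m)))"
  proof (rule sum_mono)
    fix m
    have "cmod (bdata b u \<epsilon> m) \<le> \<bar>\<epsilon>\<bar> * cmod (b m) + cmod (u 0 m)"
      unfolding bdata_def by (rule order_trans[OF norm_triangle_ineq4]) (simp add: norm_mult)
    from mult_left_mono[OF this w_nonneg[of m]]
    show "w m * cmod (bdata b u \<epsilon> m) \<le> w m * cmod (u 0 m) + \<bar>\<epsilon>\<bar> * (w m * cmod (b m))"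
      by (simp add: algebra_simps)
  qed
  also have "\<dots> = (\<Sum>m\<in>A. w m * cmod (u 0 m)) + \<bar>\<epsilon>\<bar> * (\<Sum>m\<in>A. w m * cmod (b m))"
    by (simp add: sum.distrib sum_distrib_left)
  also have "\<dots> \<le> rho_u F c \<gamma> w u + \<bar>\<epsilon>\<bar> * 1"
  proof (intro add_mono mult_left_mono)
    show "(\<Sum>m\<in>A. w m * cmod (u 0 m)) \<le> rho_u F c \<gamma> w u"
      unfolding rho_u_def by (rule finite_sum_le_infsum[OF us A(1)]) (use A(2) w_nonneg in auto)
    have "(\<Sum>m\<in>A. w m * cmod (b m)) \<le> infsum (\<lambda>m. w m * cmod (b m)) UNIV"
      by (rule finite_sum_le_infsum[OF has_sum_imp_summable[OF b] A(1)]) (simp_all add: w_nonneg)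
    then show "(\<Sum>m\<in>A. w m * cmod (b m)) \<le> 1" using infsumI[OF b] by simp
  qed simp
  finally show "(\<Sum>m\<in>A. w m * cmod (bdata b u \<epsilon> m)) \<le> rho_u F c \<gamma> w u + \<bar>\<epsilon>\<bar>" by simp
qed

text \<open>
  \<open>Phi\<close> maps the ball of radius \<open>R = 2 * (rho_u + \<bar>\<epsilon>\<bar>)\<close> into itself, as half of \<open>R\<close> comes from the boundary data
  and a quarter of it from the nonlinear term. The symmetric sequences in the ball form a closed set
  that \<open>Phi\<close> preserves, so it contains the fixed point. Reflecting the fixed point and appealing to
  uniqueness would not do, because for a weight that is not even the reflection may leave the space.
\<close>

lemma corrector_exists_unique:
  assumes u: "bd 0 u c1" and R: "2 * (rho_u F c \<gamma> w u + \<bar>\<epsilon>\<bar>) < c1"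
    and b: "((\<lambda>m. w m * cmod (b m)) has_sum 1) UNIV" and b_sym: "\<And>m. b (- m) = cnj (b m)" and u_sym: "csym u"
  shows "\<exists>!v. is_corrector F c \<gamma> w b CF u \<epsilon> v"
    and "is_corrector F c \<gamma> w b CF u \<epsilon> v \<Longrightarrow> csym v"
proof -
  let ?R = "2 * (rho_u F c \<gamma> w u + \<bar>\<epsilon>\<bar>)" and ?h = "bdata b u \<epsilon>"
  let ?S = "{v. bd \<sigma>0 v ?R \<and> csym v}"
  note S = Sop_bdata_bd[OF u b, of \<epsilon>]
  have R0: "0 \<le> ?R" using bd_nonneg[OF S] by simp
  have Phi_R: "bd \<sigma>0 (Phi u ?h v) ?R" if v: "bd \<sigma>0 v ?R" for v
  proof -
    have "bd \<sigma>0 (Phi u ?h v) ((rho_u F c \<gamma> w u + \<bar>\<epsilon>\<bar>) + CKc * (CF * c1 * ?R))"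
      unfolding Phi_def by (rule bd_add[OF S Kop_bd[OF Y_bd[OF u v R sigma_range(1,2)] sigma_range(1,2)]])
    moreover have "CKc * (CF * c1 * ?R) \<le> ?R / 4"
      using mult_right_mono[OF c1_props(3) R0] by (simp add: mult_ac)
    moreover have "a + X \<le> 2 * a" if "X \<le> 2 * a / 4" "0 \<le> 2 * a" for X a :: real using that by simp
    ultimately show ?thesis using R0 by (elim bd_mono) blast
  qed
  have Phi_sym: "csym (Phi u ?h v)" if v: "bd \<sigma>0 v ?R" "csym v" for v
    unfolding Phi_def
  proof (rule csym_add)
    show "csym (Sop ?h)"
    proof (rule csym_Sop)
      show "?h (- m) = cnj (?h m)" for m
        using u_sym b_sym[of m] by (simp add: bdata_def csym_def)
    qed
    show "csym (Kop (G (u + v) - G u))"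
      by (rule csym_Kop[OF Y_bd[OF u v(1) R sigma_range(1,2)] sigma_range(1,2)])
        (intro csym_diff csym_Gs in_disc_u in_disc_uv[OF u v(1) sigma_range(3) R] u u_sym csym_add v)
  qed
  have "\<exists>v\<in>?S. Phi u ?h v = v"
  proof (rule contraction_fixed_point[where \<sigma> = \<sigma>0])
    show "0 \<in> ?S" using bd_mono[OF bd_zero R0] by (simp add: csym_def)
    show "\<exists>r. bd \<sigma>0 x r" if "x \<in> ?S" for x using that by blast
    show "Phi u ?h x \<in> ?S" if "x \<in> ?S" for x using that Phi_R Phi_sym by blast
    show "bd \<sigma>0 (Phi u ?h x - Phi u ?h y) (d / 4)" if "x \<in> ?S" "y \<in> ?S" "bd \<sigma>0 (x - y) d" for x y d
      using that by (intro Phi_contracts[OF u _ _ R sigma_range(1,2)]) auto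
    fix X x r assume X: "\<And>i. X i \<in> ?S" "\<And>n m. (\<lambda>i. X i n m) \<longlonglongrightarrow> x n m"
    have "bd \<sigma>0 x ?R" by (rule bd_limit[where X = X and R = "\<lambda>_. ?R"]) (use X in auto)
    moreover have "csym x"
      unfolding csym_def
    proof (intro allI)
      fix n m
      have "(\<lambda>i. cnj (X i n m)) \<longlonglongrightarrow> cnj (x n m)" by (intro tendsto_cnj X)
      then have "(\<lambda>i. X i n (- m)) \<longlonglongrightarrow> cnj (x n m)" using X(1) by (simp add: csym_def)
      then show "x n (- m) = cnj (x n m)" by (rule LIMSEQ_unique[OF X(2)])
    qed
    ultimately show "x \<in> ?S" by simp
  qed
  then obtain v where v: "bd \<sigma>0 v ?R" "csym v" "Phi u ?h v = v" by blast
  have uniq: "v' = v" if "bd \<sigma>0 v' ?R" "Phi u ?h v' = v'" for v'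
  proof -
    have "bd \<sigma>0 (v' - v) (2 * 0)"
    proof (rule quarter_bound[OF bd_diff[OF that(1) v(1)]])
      fix t assume "bd \<sigma>0 (v' - v) t"
      from Phi_contracts[OF u v(1) that(1) R sigma_range(1,2) this, of ?h]
      show "bd \<sigma>0 (v' - v) (0 + t / 4)" unfolding that(2) v(3) by simp
    qed
    then have "v' - v = 0" by (intro bd_0_imp_0) simp
    then show ?thesis by simp
  qed
  note iff = is_corrector_iff_fixed_point[OF u R]
  show "\<exists>!v. is_corrector F c \<gamma> w b CF u \<epsilon> v" unfolding iff using v uniq by blast
  show "is_corrector F c \<gamma> w b CF u \<epsilon> v \<Longrightarrow> csym v" for v
    unfolding iff using uniq v(2) by blast
qed

end

section \<open>Differentiable dependence on the parameters\<close>

lemma blinop_apply_bound: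
  fixes N :: "'b::real_vector nspace"
  assumes T: "T \<in> vecs (blinop (euclid :: 'q::real_normed_vector nspace) N)"
    and N: "\<And>y t. y \<in> vecs N \<Longrightarrow> nrm N (t *\<^sub>R y) \<le> \<bar>t\<bar> * nrm N y" 
  shows "nrm N (T h) \<le> nrm (blinop euclid N) T * norm h"
proof -
  from T have TY: "\<And>x. T x \<in> vecs N" and Ts: "\<And>r x. T (r *\<^sub>R x) = r *\<^sub>R T x"
    by (auto simp: blinop_def euclid_def)
  from T obtain B where B: "\<And>x. nrm N (T x) \<le> B * norm x" by (auto simp: blinop_def euclid_def)
  let ?S = "{x::'q. norm x \<le> 1}"
  have N0: "nrm (blinop euclid N) T = (SUP x\<in>?S. nrm N (T x))" by (simp add: blinop_def euclid_def)
  have bdd: "bdd_above ((\<lambda>x. nrm N (T x)) ` ?S)"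
  proof (rule bdd_aboveI2)
    fix x assume x: "x \<in> ?S"
    have "nrm N (T x) \<le> B * norm x" by (rule B)
    also have "\<dots> \<le> \<bar>B\<bar> * 1" using x by (intro mult_mono) auto
    finally show "nrm N (T x) \<le> \<bar>B\<bar>" by simp
  qed
  show ?thesis
  proof (cases "h = 0")
    case True
    then show ?thesis using B[of h] by simp
  next
    case False
    define g where "g = (1 / norm h) *\<^sub>R h"
    have "g \<in> ?S" using False by (simp add: g_def)
    then have g: "nrm N (T g) \<le> nrm (blinop euclid N) T" unfolding N0 by (rule cSUP_upper[OF _ bdd])
    have "h = norm h *\<^sub>R g" using False by (simp add: g_def)
    then have "T h = norm h *\<^sub>R T g" using Ts by metis
    then have "nrm N (T h) \<le> \<bar>norm h\<bar> * nrm N (T g)" using N[OF TY[of g], of "norm h"] by (simp only:)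
    also have "\<dots> \<le> norm h * nrm (blinop euclid N) T" using g by (simp add: mult_left_mono)
    finally show ?thesis by (simp add: mult.commute)
  qed
qed

lemma nrm_euclid: "nrm euclid x = norm x"
  by (simp add: euclid_def)

lemma norm_fst_snd_le: "norm (fst h) \<le> norm h" "norm (snd h) \<le> norm h"
  by (metis norm_fst_le prod.collapse, metis norm_snd_le prod.collapse)

lemma (in weighted) nrm_scaleR_le:
  "y \<in> vecs (Lsp \<sigma> w) \<Longrightarrow> nrm (Lsp \<sigma> w) (t *\<^sub>R y) \<le> \<bar>t\<bar> * nrm (Lsp \<sigma> w) y"
  using bd_scaleR[of \<sigma> y "nrm (Lsp \<sigma> w) y" t] by (simp add: bd_iff)

text \<open>
  How the linearization error of \<open>Y\<close> is divided into parts that are small of second order: with \<open>a\<close>, \<open>b\<close>,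
  \<open>g\<close> the values of \<open>G\<close> at \<open>u' + v'\<close>, \<open>u' + v\<close>, \<open>u + v\<close>, the five summands are the remainder in \<open>v\<close>, the
  change of the derivative between the base points \<open>u + v\<close> and \<open>u' + v\<close>, the remainder in \<open>u\<close>, the error of
  the given derivative of \<open>u\<close>, and the derivative applied to the error that is to be estimated.
\<close>

lemma corrector_remainder_split:
  fixes a :: "'a::ab_group_add"
  shows "(a - u') - (g - u) - (d5 - d6) - d7 =
     (a - b - d1) + (d1 - d2) + ((b - g - d3) - (u' - u - d4)) + ((d3 - d5) - (d4 - d6)) + (d2 - d7)"
  by (simp add: algebra_simps)

text \<open>
  The parameters range over a normed space; \<open>Du\<close> is the derivative of the given family with values in the
  large space with exponent \<open>- \<sigma>1\<close>. The bound \<open>r < c1 / 4\<close> keeps the radius of the ball for the corrector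
  strictly below \<open>c1\<close>.
\<close>

locale corrector_family = corrector +
  fixes b :: "int \<Rightarrow> complex" and c0 :: real and r :: real
    and u :: "'q::real_normed_vector \<Rightarrow> seq" and Du :: "'q \<Rightarrow> 'q \<Rightarrow> seq"
  assumes b_sum: "((\<lambda>m. w m * cmod (b m)) has_sum 1) UNIV"
    and b_sym: "\<And>m. b (- m) = cnj (b m)"
    and u_bd: "\<And>q. norm q \<le> c0 \<Longrightarrow> bd 0 (u q) c1"
    and u_rho: "\<And>q. norm q \<le> c0 \<Longrightarrow> rho_u F c \<gamma> w (u q) \<le> c1 / 4"
    and u_sym: "\<And>q. norm q \<le> c0 \<Longrightarrow> csym (u q)"
    and u_C1: "C1_deriv euclid (Lsp (- \<sigma>1) w) {q. norm q \<le> c0} u Du"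
    and r_le: "r \<le> c0" and r_small: "r < c1 / 4"
begin

definition P :: "('q \<times> real) set" where "P = {(q, \<epsilon>). norm q \<le> r \<and> \<bar>\<epsilon>\<bar> \<le> r}"

text \<open>
  An upper bound for \<open>2 * (rho_u + \<bar>\<epsilon>\<bar>)\<close> that is the same for all parameters.
\<close>

definition R1 :: real where "R1 = c1 / 2 + 2 * r"

definition V :: "'q \<times> real \<Rightarrow> seq" where
  "V p = (THE v. is_corrector F c \<gamma> w b CF (u (fst p)) (snd p) v)"

lemma R1_less: "R1 < c1"
  using r_small by (simp add: R1_def)

lemma in_P: "p \<in> P \<Longrightarrow> norm (fst p) \<le> c0" "p \<in> P \<Longrightarrow> \<bar>snd p\<bar> \<le> r"
  using r_le by (auto simp: P_def)

lemma V_props: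
  assumes p: "p \<in> P"
  shows "\<exists>!v. is_corrector F c \<gamma> w b CF (u (fst p)) (snd p) v"
    and "is_corrector F c \<gamma> w b CF (u (fst p)) (snd p) (V p)"
    and "csym (V p)" "bd \<sigma>0 (V p) R1"
    and "V p = Sop (bdata b (u (fst p)) (snd p)) + Kop (G (u (fst p) + V p) - G (u (fst p)))"
proof -
  note q = in_P(1)[OF p]
  have le: "2 * (rho_u F c \<gamma> w (u (fst p)) + \<bar>snd p\<bar>) \<le> R1"
    using u_rho[OF q] in_P(2)[OF p] by (simp add: R1_def)
  note R = le_less_trans[OF le R1_less]
  note ex = corrector_exists_unique[OF u_bd[OF q] R b_sum b_sym u_sym[OF q]]
  show "\<exists>!v. is_corrector F c \<gamma> w b CF (u (fst p)) (snd p) v" by (rule ex(1))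
  then show V: "is_corrector F c \<gamma> w b CF (u (fst p)) (snd p) (V p)" unfolding V_def by (rule theI')
  then show "csym (V p)" by (rule ex(2))
  from V have fp: "bd \<sigma>0 (V p) (2 * (rho_u F c \<gamma> w (u (fst p)) + \<bar>snd p\<bar>))"
    "Phi (u (fst p)) (bdata b (u (fst p)) (snd p)) (V p) = V p"
    using is_corrector_iff_fixed_point[OF u_bd[OF q] R] by blast+
  show "bd \<sigma>0 (V p) R1" by (rule bd_mono[OF fp(1) le])
  show "V p = Sop (bdata b (u (fst p)) (snd p)) + Kop (G (u (fst p) + V p) - G (u (fst p)))"
    using fp(2)[symmetric] unfolding Phi_def .
qed

lemma R1_nonneg: "p \<in> P \<Longrightarrow> 0 \<le> R1"
  using bd_nonneg V_props(4) by blast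

text \<open>
  The exponents that occur are \<open>- \<sigma>1\<close> for increments of the given family, \<open>\<sigma>0 = 4 * \<sigma>1\<close> for the corrector,
  \<open>2 * \<sigma>1\<close> for its increments and its derivative, and \<open>\<sigma>1\<close> for second-order errors.
\<close>

lemma ranges:
  "\<sigma>1 \<le> \<sigma>1" "\<sigma>1 \<le> \<sigma>0" "\<sigma>1 \<le> 2 * \<sigma>1" "2 * \<sigma>1 \<le> \<sigma>0" "0 \<le> \<sigma>1" "- \<sigma>1 \<le> 1" "\<sigma>0 \<le> 1"
  "\<sigma>1 \<le> \<sigma>0 + - \<sigma>1" "\<sigma>0 + - \<sigma>1 \<le> \<sigma>0" "2 * \<sigma>1 \<le> \<sigma>0 + - \<sigma>1" "2 * \<sigma>1 \<le> 1" "\<sigma>1 \<le> 1"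
  "0 \<le> 2 * \<sigma>1" "- \<sigma>1 \<le> 2 * \<sigma>1"
  using sigma_props by simp_all

lemma V_bd: "p \<in> P \<Longrightarrow> \<sigma> \<le> \<sigma>0 \<Longrightarrow> bd \<sigma> (V p) R1"
  using V_props(4) bd_exponent_mono by blast

lemma in_disc_points:
  assumes "p \<in> P" "norm q \<le> c0" shows "in_disc (u q)" "in_disc (u q + V p)"
  using in_disc_u[OF u_bd[OF assms(2)]] in_disc_uv[OF u_bd[OF assms(2)] V_props(4)[OF assms(1)] sigma_range(3) R1_less] by blast+

subsection \<open>The given family\<close>

lemma Du_blinop: "norm q \<le> c0 \<Longrightarrow> Du q \<in> vecs (blinop euclid (Lsp (- \<sigma>1) w))"
  using u_C1 unfolding C1_deriv_def has_fderiv_def by blast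

lemma Du_linear:
  assumes "norm q \<le> c0" shows "Du q (x + y) = Du q x + Du q y" "Du q (t *\<^sub>R x) = t *\<^sub>R Du q x"
  using Du_blinop[OF assms] by (auto simp: blinop_def euclid_def)

lemma Du_bounded:
  assumes "norm q \<le> c0" obtains B where "0 \<le> B" "\<And>h. bd (- \<sigma>1) (Du q h) (B * norm h)"
proof
  let ?B = "\<bar>nrm (blinop euclid (Lsp (- \<sigma>1) w)) (Du q)\<bar>"
  show "0 \<le> ?B" by simp
  fix h
  have "nrm (Lsp (- \<sigma>1) w) (Du q h) \<le> nrm (blinop euclid (Lsp (- \<sigma>1) w)) (Du q) * norm h"
    by (rule blinop_apply_bound[OF Du_blinop[OF assms] nrm_scaleR_le])
  also have "\<dots> \<le> ?B * norm h" by (intro mult_right_mono) simp_all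
  finally show "bd (- \<sigma>1) (Du q h) (?B * norm h)"
    using Du_blinop[OF assms] by (auto simp: bd_iff blinop_def euclid_def)
qed

lemma Du_continuous:
  assumes q: "norm q \<le> c0" and e: "0 < e"
  obtains d where "0 < d" "\<And>q' h. norm q' \<le> c0 \<Longrightarrow> norm (q' - q) < d \<Longrightarrow> bd (- \<sigma>1) (Du q' h - Du q h) (e * norm h)"
proof -
  let ?X = "blinop euclid (Lsp (- \<sigma>1) w)"
  from u_C1 q e obtain d where d: "0 < d" "\<And>q'. norm q' \<le> c0 \<Longrightarrow> norm (q' - q) < d \<Longrightarrow> nrm ?X (Du q' - Du q) < e"
    unfolding C1_deriv_def nrm_euclid by blast
  have "bd (- \<sigma>1) (Du q' h - Du q h) (e * norm h)" if q': "norm q' \<le> c0" "norm (q' - q) < d" for q' h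
  proof -
    obtain B B' where B: "\<And>h. bd (- \<sigma>1) (Du q h) (B * norm h)" "\<And>h. bd (- \<sigma>1) (Du q' h) (B' * norm h)"
      using Du_bounded[OF q] Du_bounded[OF q'(1)] by metis
    have bb: "bd (- \<sigma>1) (Du q' h - Du q h) ((B' + B) * norm h)" for h
      using bd_diff[OF B(2) B(1), of h h] by (simp add: distrib_right)
    have T: "Du q' - Du q \<in> vecs ?X"
      using bb unfolding bd_iff blinop_def euclid_def
      by (auto simp: Du_linear[OF q] Du_linear[OF q'(1)] scaleR_diff_right intro!: exI[of _ "B' + B"])
    have "nrm (Lsp (- \<sigma>1) w) ((Du q' - Du q) h) \<le> nrm ?X (Du q' - Du q) * norm h"
      by (rule blinop_apply_bound[OF T nrm_scaleR_le])
    also have "\<dots> \<le> e * norm h" using d(2)[OF q'] by (intro mult_right_mono) simp_all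
    finally show ?thesis using bb[of h] by (simp add: bd_iff)
  qed
  then show thesis using d(1) that by blast
qed

lemma u_remainder:
  assumes q: "norm q \<le> c0" and e: "0 < e"
  obtains d where "0 < d" "\<And>q'. norm q' \<le> c0 \<Longrightarrow> norm (q' - q) < d \<Longrightarrow>
     bd (- \<sigma>1) (u q' - u q - Du q (q' - q)) (e * norm (q' - q))"
proof -
  from u_C1 q e obtain d where d: "0 < d" "\<And>q'. norm q' \<le> c0 \<Longrightarrow> norm (q' - q) < d \<Longrightarrow>
      nrm (Lsp (- \<sigma>1) w) (u q' - u q - Du q (q' - q)) \<le> e * norm (q' - q)"
    unfolding C1_deriv_def has_fderiv_def nrm_euclid by blast
  have "bd (- \<sigma>1) (u q' - u q - Du q (q' - q)) (e * norm (q' - q))" if q': "norm q' \<le> c0" "norm (q' - q) < d" for q'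
  proof -
    obtain B where B: "\<And>h. bd (- \<sigma>1) (Du q h) (B * norm h)" using Du_bounded[OF q] by metis
    have "- \<sigma>1 \<le> 0" using ranges by simp
    then have "bd (- \<sigma>1) (u q') c1" "bd (- \<sigma>1) (u q) c1"
      using bd_exponent_mono[OF u_bd[OF q'(1)]] bd_exponent_mono[OF u_bd[OF q]] by blast+
    from bd_diff[OF bd_diff[OF this] B[of "q' - q"]] show ?thesis
      using d(2)[OF q'] by (simp add: bd_iff)
  qed
  then show thesis using d(1) that by blast
qed

lemma u_lipschitz:
  assumes q: "norm q \<le> c0"
  obtains L d where "0 \<le> L" "0 < d" "\<And>q'. norm q' \<le> c0 \<Longrightarrow> norm (q' - q) < d \<Longrightarrow> bd (- \<sigma>1) (u q' - u q) (L * norm (q' - q))"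
proof -
  obtain B where B: "0 \<le> B" "\<And>h. bd (- \<sigma>1) (Du q h) (B * norm h)" using Du_bounded[OF q] by metis
  obtain d where d: "0 < d" "\<And>q'. norm q' \<le> c0 \<Longrightarrow> norm (q' - q) < d \<Longrightarrow>
     bd (- \<sigma>1) (u q' - u q - Du q (q' - q)) (1 * norm (q' - q))" using u_remainder[OF q, of 1] by auto
  show thesis
  proof (rule that[of "1 + B", OF _ d(1)])
    show "0 \<le> 1 + B" using B by simp
    fix q' assume "norm q' \<le> c0" "norm (q' - q) < d"
    from bd_add[OF d(2)[OF this] B(2)[of "q' - q"]]
    show "bd (- \<sigma>1) (u q' - u q) ((1 + B) * norm (q' - q))" by (simp add: distrib_right)
  qed
qed

lemma Sop_b_bd: "bd \<sigma>0 (Sop b) 1"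
proof (rule Sop_bd)
  fix A :: "int set" assume A: "finite A"
  have "(\<Sum>m\<in>A. w m * cmod (b m)) \<le> infsum (\<lambda>m. w m * cmod (b m)) UNIV"
    by (rule finite_sum_le_infsum[OF has_sum_imp_summable[OF b_sum] A]) (simp_all add: w_nonneg)
  then show "(\<Sum>m\<in>A. w m * cmod (b m)) \<le> 1" using infsumI[OF b_sum] by simp
qed

lemma Sop_bdata_diff:
  "Sop (bdata b x' \<epsilon>') - Sop (bdata b x \<epsilon>) = (\<epsilon>' - \<epsilon>) *\<^sub>R Sop b - Sop ((x' - x) 0)"
  by (intro ext) (simp add: Sop_def bdata_def scaleR_fun_def scaleR_conv_of_real algebra_simps)

lemma norm_fst_snd: "norm (fst p' - fst p) \<le> norm (p' - p)" "\<bar>snd p' - snd p\<bar> \<le> norm (p' - p)"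
  for p p' :: "'q \<times> real"
  using norm_fst_snd_le[of "p' - p"] by simp_all

lemma Kop_bd_down:
  assumes "bd \<tau> y s" "\<sigma>1 \<le> \<sigma>" "\<sigma> \<le> \<tau>" "\<sigma> \<le> \<sigma>0" shows "bd \<sigma> (Kop y) (CKc * s)"
  by (rule Kop_bd[OF bd_exponent_mono[OF assms(1,3)] assms(2,4)])

subsection \<open>The corrector is locally Lipschitz\<close>

lemma V_difference:
  assumes p: "p \<in> P" and p': "p' \<in> P"
  shows "V p' - V p = (snd p' - snd p) *\<^sub>R Sop b - Sop ((u (fst p') - u (fst p)) 0) +
     Kop ((G (u (fst p') + V p') - G (u (fst p'))) - (G (u (fst p) + V p) - G (u (fst p))))"
proof -
  note y = Y_bd[OF u_bd[OF in_P(1)[OF p]] V_bd[OF p ranges(4)] R1_less ranges(3,4)]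
  note y' = Y_bd[OF u_bd[OF in_P(1)[OF p']] V_bd[OF p' ranges(4)] R1_less ranges(3,4)]
  show ?thesis
    unfolding Kop_diff[OF y' y ranges(3,4)] Sop_bdata_diff[symmetric]
    by (subst (1) V_props(5)[OF p'], subst (1) V_props(5)[OF p]) simp
qed

text \<open>
  The increment of \<open>V\<close> has three sources: the boundary data, the change of \<open>v\<close> in \<open>Y\<close>, which contracts, and
  the change of \<open>u\<close> in \<open>Y\<close>. The last one is a mixed difference of \<open>G\<close>, a product of an increment with
  exponent \<open>- \<sigma>1\<close> and the corrector with exponent \<open>\<sigma>0\<close>.
\<close>

lemma V_lipschitz:
  assumes p: "p \<in> P"
  obtains L d where "0 \<le> L" "0 < d"
    "\<And>p'. p' \<in> P \<Longrightarrow> norm (p' - p) < d \<Longrightarrow> bd (- \<sigma>1) (u (fst p') - u (fst p)) (L * norm (p' - p))"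
    "\<And>p'. p' \<in> P \<Longrightarrow> norm (p' - p) < d \<Longrightarrow> bd (2 * \<sigma>1) (V p' - V p) (L * norm (p' - p))"
proof -
  note q = in_P(1)[OF p]
  obtain Lu d where L: "0 \<le> Lu" and d: "0 < d" and
    Lu: "\<And>q'. norm q' \<le> c0 \<Longrightarrow> norm (q' - fst p) < d \<Longrightarrow> bd (- \<sigma>1) (u q' - u (fst p)) (Lu * norm (q' - fst p))"
    using u_lipschitz[OF q] by metis
  define L2 where "L2 = 2 * (1 + Lu + CKc * (MM * (R1 * Lu)))"
  have L2: "0 \<le> L2" "Lu \<le> L2"
    using L CK_ge(3) MM_nonneg R1_nonneg[OF p] by (simp_all add: L2_def)
  have du: "bd (- \<sigma>1) (u (fst p') - u (fst p)) (Lu * norm (p' - p))" if p': "p' \<in> P" "norm (p' - p) < d" for p'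
  proof (rule bd_mono[OF Lu[OF in_P(1)[OF p'(1)]]])
    show "norm (fst p' - fst p) < d" using norm_fst_snd(1)[of p' p] p'(2) by linarith
    show "Lu * norm (fst p' - fst p) \<le> Lu * norm (p' - p)" by (intro mult_left_mono norm_fst_snd L)
  qed
  have "bd (2 * \<sigma>1) (V p' - V p) (L2 * norm (p' - p))" if p': "p' \<in> P" "norm (p' - p) < d" for p'
  proof -
    note q' = in_P(1)[OF p'(1)]
    let ?u = "u (fst p)" and ?u' = "u (fst p')" and ?v = "V p" and ?v' = "V p'" and ?k = "norm (p' - p)"
    let ?A = "G (?u' + ?v') - G (?u' + ?v)" and ?B = "(G (?u' + ?v) - G ?u') - (G (?u + ?v) - G ?u)"
    let ?S = "(snd p' - snd p) *\<^sub>R Sop b - Sop ((?u' - ?u) 0)"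
    have v: "bd (2 * \<sigma>1) ?v R1" "bd (2 * \<sigma>1) ?v' R1"
      using V_bd[OF p ranges(4)] V_bd[OF p'(1) ranges(4)] by blast+
    have S: "bd (2 * \<sigma>1) ?S (?k + Lu * ?k)"
    proof (rule bd_exponent_mono[OF _ ranges(4)], rule bd_diff)
      show "bd \<sigma>0 ((snd p' - snd p) *\<^sub>R Sop b) ?k"
        by (rule bd_mono[OF bd_scaleR[OF Sop_b_bd]]) (use norm_fst_snd(2)[of p' p] in simp)
      show "bd \<sigma>0 (Sop ((?u' - ?u) 0)) (Lu * ?k)" by (rule Sop_row_bd[OF du[OF p']])
    qed
    have B: "bd (2 * \<sigma>1) ?B (MM * (R1 * (Lu * ?k)))"
      by (rule bd_exponent_mono[OF Gs_mixed_bd[OF in_disc_points(1)[OF p q] in_disc_points(1)[OF p q'] in_disc_points(2)[OF p q]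
         in_disc_points(2)[OF p q'] du[OF p'] ranges(6) V_props(4)[OF p] ranges(7)] ranges(10)])
    have dv0: "bd (2 * \<sigma>1) (?v' - ?v) (R1 + R1)" by (rule bd_diff[OF v(2,1)])
    have A: "bd (2 * \<sigma>1) ?A (CF * c1 * (R1 + R1))"
      by (rule G_lipschitz[OF u_bd[OF q'] v R1_less ranges(3,4) dv0])
    note V_difference[OF p p'(1)]
    also have "(G (?u' + ?v') - G ?u') - (G (?u + ?v) - G ?u) = ?A + ?B" by simp
    also have "Kop (?A + ?B) = Kop ?A + Kop ?B" by (rule Kop_add[OF A B ranges(3,4)])
    finally have eq: "?v' - ?v = ?S + (Kop ?A + Kop ?B)" .
    have "bd (2 * \<sigma>1) (?v' - ?v) (2 * (?k + Lu * ?k + CKc * (MM * (R1 * (Lu * ?k)))))"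
    proof (rule quarter_bound[OF dv0])
      fix t assume t: "bd (2 * \<sigma>1) (?v' - ?v) t"
      have "bd (2 * \<sigma>1) (?S + (Kop ?A + Kop ?B)) ((?k + Lu * ?k) + (t / 4 + CKc * (MM * (R1 * (Lu * ?k)))))"
        by (intro bd_add S Kop_G_contracts[OF u_bd[OF q'] v R1_less ranges(3,4) t] Kop_bd[OF B ranges(3,4)])
      then show "bd (2 * \<sigma>1) (?v' - ?v) (?k + Lu * ?k + CKc * (MM * (R1 * (Lu * ?k))) + t / 4)"
        unfolding eq[symmetric] by (rule bd_mono) simp
    qed
    then show ?thesis by (rule bd_mono) (simp add: L2_def algebra_simps)
  qed
  moreover have "bd (- \<sigma>1) (u (fst p') - u (fst p)) (L2 * norm (p' - p))" if p': "p' \<in> P" "norm (p' - p) < d" for p'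
    by (rule bd_mono[OF du[OF p']]) (intro mult_right_mono L2(2) norm_ge_zero)
  ultimately show thesis using that[OF L2(1) d] by blast
qed

subsection \<open>The derivative of the corrector\<close>

text \<open>
  Formal differentiation of the fixed point equation of \<open>V\<close> gives \<open>x = inhom p h + Kop (DG (u + v) x)\<close> for
  the derivative \<open>x\<close> in direction \<open>h\<close>. The two values of \<open>DG\<close> in \<open>inhom\<close> occur only as a difference: each of them
  may grow in \<open>n\<close>, and the series in \<open>Kop\<close> would diverge in general.
\<close>

definition inhom :: "'q \<times> real \<Rightarrow> 'q \<times> real \<Rightarrow> seq" where
  "inhom p h = snd h *\<^sub>R Sop b - Sop (Du (fst p) (fst h) 0) +
     Kop (DG (u (fst p) + V p) (Du (fst p) (fst h)) - DG (u (fst p)) (Du (fst p) (fst h)))"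

definition dV :: "'q \<times> real \<Rightarrow> 'q \<times> real \<Rightarrow> seq" where
  "dV p h = (SOME x. (\<exists>s. bd (2 * \<sigma>1) x s) \<and> x = inhom p h + Kop (DG (u (fst p) + V p) x))"

lemma DG_difference_bd:
  assumes p: "p \<in> P" and x: "bd (- \<sigma>1) x s" and q: "norm q \<le> c0"
  shows "bd (\<sigma>0 + - \<sigma>1) (DG (u q + V p) x - DG (u q) x) (MM * (R1 * s))"
proof (rule DGs_diff_bd[OF in_disc_points[OF p q] _ ranges(7) x ranges(6)])
  show "bd \<sigma>0 (u q + V p - u q) R1" using V_props(4)[OF p] by simp
qed

lemma inhom_bounded:
  assumes p: "p \<in> P" obtains B where "0 \<le> B" "\<And>h. bd (2 * \<sigma>1) (inhom p h) (B * norm h)"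
proof -
  note q = in_P(1)[OF p]
  obtain B where B: "0 \<le> B" "\<And>h. bd (- \<sigma>1) (Du (fst p) h) (B * norm h)" using Du_bounded[OF q] by metis
  let ?C = "1 + B + CKc * (MM * (R1 * B))"
  show thesis
  proof (rule that[of ?C])
    show "0 \<le> ?C" using B(1) CK_ge(3) MM_nonneg R1_nonneg[OF p] by simp
    fix h :: "'q \<times> real"
    let ?D = "Du (fst p) (fst h)"
    have D: "bd (- \<sigma>1) ?D (B * norm h)"
      by (rule bd_mono[OF B(2)]) (intro mult_left_mono norm_fst_snd_le B(1))
    have "bd (2 * \<sigma>1) (inhom p h) (norm h + B * norm h + CKc * (MM * (R1 * (B * norm h))))"
      unfolding inhom_def
    proof (intro bd_add)
      show "bd (2 * \<sigma>1) (snd h *\<^sub>R Sop b - Sop (?D 0)) (norm h + B * norm h)"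
      proof (rule bd_exponent_mono[OF _ ranges(4)], rule bd_diff[OF _ Sop_row_bd[OF D]])
        show "bd \<sigma>0 (snd h *\<^sub>R Sop b) (norm h)"
          by (rule bd_mono[OF bd_scaleR[OF Sop_b_bd]]) (use norm_fst_snd_le(2)[of h] in simp)
      qed
      show "bd (2 * \<sigma>1) (Kop (DG (u (fst p) + V p) ?D - DG (u (fst p)) ?D)) (CKc * (MM * (R1 * (B * norm h))))"
        by (rule Kop_bd_down[OF DG_difference_bd[OF p D q] ranges(3,10,4)])
    qed
    then show "bd (2 * \<sigma>1) (inhom p h) (?C * norm h)" by (rule bd_mono) (simp add: algebra_simps)
  qed
qed

text \<open>
  The linearized equation is solved by the same contraction argument. The exponent \<open>2 * \<sigma>1\<close> leaves a margin
  \<open>\<sigma>1\<close> that is used up when the operator itself varies with the parameters.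
\<close>

lemma linearized_solution:
  assumes p: "p \<in> P" and y: "bd (2 * \<sigma>1) y s"
  shows "\<exists>x. (\<exists>s. bd (2 * \<sigma>1) x s) \<and> x = y + Kop (DG (u (fst p) + V p) x)"
proof -
  note q = in_P(1)[OF p]
  note v = V_bd[OF p ranges(4)]
  let ?T = "\<lambda>x. Kop (DG (u (fst p) + V p) x)"
  have T: "bd (2 * \<sigma>1) (?T x) (t / 4)" if "bd (2 * \<sigma>1) x t" for x t
    by (rule Kop_DG_contracts[OF u_bd[OF q] v R1_less ranges(3,4) that])
  have Td: "?T x - ?T x' = ?T (x - x')" if x: "bd (2 * \<sigma>1) x t" "bd (2 * \<sigma>1) x' t'" for x x' t t'
    unfolding DGs_diff_arg[OF in_disc_points(2)[OF p q] x(1) ranges(11) x(2)]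
    by (rule Kop_diff[symmetric, OF DG_bd[OF u_bd[OF q] v R1_less ranges(3,4) x(1)] DG_bd[OF u_bd[OF q] v R1_less ranges(3,4) x(2)] ranges(3,4)])
  have "\<exists>x\<in>{x. \<exists>s. bd (2 * \<sigma>1) x s}. y + ?T x = x"
  proof (rule contraction_fixed_point[where \<sigma> = "2 * \<sigma>1"])
    show "0 \<in> {x. \<exists>s. bd (2 * \<sigma>1) x s}" using bd_zero by blast
    show "y + ?T x \<in> {x. \<exists>s. bd (2 * \<sigma>1) x s}" if "x \<in> {x. \<exists>s. bd (2 * \<sigma>1) x s}" for x
      using that T bd_add[OF y] by blast
    fix x x' d assume x: "x \<in> {x. \<exists>s. bd (2 * \<sigma>1) x s}" "x' \<in> {x. \<exists>s. bd (2 * \<sigma>1) x s}" "bd (2 * \<sigma>1) (x - x') d"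
    then obtain t t' where "bd (2 * \<sigma>1) x t" "bd (2 * \<sigma>1) x' t'" by blast
    from Td[OF this] have "(y + ?T x) - (y + ?T x') = ?T (x - x')" by simp
    then show "bd (2 * \<sigma>1) ((y + ?T x) - (y + ?T x')) (d / 4)" using T[OF x(3)] by simp
  qed blast+
  then obtain x s where "bd (2 * \<sigma>1) x s" "y + ?T x = x" by blast
  then show ?thesis by (intro exI[of _ x]) auto
qed

lemma linearized_bound:
  assumes p: "p \<in> P" and \<sigma>: "\<sigma>1 \<le> \<sigma>" "\<sigma> \<le> \<sigma>0"
    and x: "bd \<sigma> x t" "x = y + Kop (DG (u (fst p) + V p) x)" and y: "bd \<sigma> y s"
  shows "bd \<sigma> x (2 * s)"
proof (rule quarter_bound[OF x(1)])
  fix t assume "bd \<sigma> x t"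
  from bd_add[OF y Kop_DG_contracts[OF u_bd[OF in_P(1)[OF p]] V_bd[OF p \<sigma>(2)] R1_less \<sigma> this]]
  show "bd \<sigma> x (s + t / 4)" using x(2) by simp
qed

lemma linearized_unique:
  assumes p: "p \<in> P"
    and x: "bd (2 * \<sigma>1) x t" "x = y + Kop (DG (u (fst p) + V p) x)"
    and x': "bd (2 * \<sigma>1) x' t'" "x' = y + Kop (DG (u (fst p) + V p) x')"
  shows "x = x'"
proof -
  note q = in_P(1)[OF p]
  note v = V_bd[OF p ranges(4)]
  have "x - x' = Kop (DG (u (fst p) + V p) x) - Kop (DG (u (fst p) + V p) x')"
    by (subst x(2), subst x'(2)) simp
  also have "\<dots> = Kop (DG (u (fst p) + V p) (x - x'))"
    unfolding DGs_diff_arg[OF in_disc_points(2)[OF p q] x(1) ranges(11) x'(1)]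
    by (rule Kop_diff[symmetric, OF DG_bd[OF u_bd[OF q] v R1_less ranges(3,4) x(1)] DG_bd[OF u_bd[OF q] v R1_less ranges(3,4) x'(1)] ranges(3,4)])
  finally have "x - x' = 0 + Kop (DG (u (fst p) + V p) (x - x'))" by simp
  from linearized_bound[OF p ranges(3,4) bd_diff[OF x(1) x'(1)] this bd_zero]
  have "x - x' = 0" by (intro bd_0_imp_0) simp
  then show ?thesis by simp
qed

lemma dV_props:
  assumes p: "p \<in> P"
  shows "\<exists>s. bd (2 * \<sigma>1) (dV p h) s" "dV p h = inhom p h + Kop (DG (u (fst p) + V p) (dV p h))"
proof -
  obtain B where "\<And>h. bd (2 * \<sigma>1) (inhom p h) (B * norm h)" using inhom_bounded[OF p] by metis
  from someI_ex[OF linearized_solution[OF p this[of h]]]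
  show "\<exists>s. bd (2 * \<sigma>1) (dV p h) s" "dV p h = inhom p h + Kop (DG (u (fst p) + V p) (dV p h))"
    unfolding dV_def[symmetric] by blast+
qed

lemma dV_bounded:
  assumes p: "p \<in> P" obtains B where "0 \<le> B" "\<And>h. bd (2 * \<sigma>1) (dV p h) (B * norm h)"
proof -
  obtain B where B: "0 \<le> B" "\<And>h. bd (2 * \<sigma>1) (inhom p h) (B * norm h)" using inhom_bounded[OF p] by metis
  show thesis
  proof (rule that[of "2 * B"])
    fix h
    obtain s where "bd (2 * \<sigma>1) (dV p h) s" using dV_props(1)[OF p] by blast
    from linearized_bound[OF p ranges(3,4) this dV_props(2)[OF p] B(2)]
    show "bd (2 * \<sigma>1) (dV p h) (2 * B * norm h)" by (simp only: mult.assoc)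
  qed (use B(1) in simp)
qed

lemma inhom_linear:
  assumes p: "p \<in> P" shows "inhom p (h + k) = inhom p h + inhom p k" "inhom p (t *\<^sub>R h) = t *\<^sub>R inhom p h"
proof -
  note q = in_P(1)[OF p]
  obtain B where B: "\<And>h. bd (- \<sigma>1) (Du (fst p) h) (B * norm h)" using Du_bounded[OF q] by metis
  let ?u = "u (fst p)" and ?v = "V p"
  let ?D = "\<lambda>h. Du (fst p) (fst h)"
  let ?N = "\<lambda>h. DG (?u + ?v) (?D h) - DG ?u (?D h)"
  note N = DG_difference_bd[OF p B q]
  have "?N (h + k) = ?N h + ?N k"
    unfolding fst_add Du_linear(1)[OF q] DGs_add_arg[OF in_disc_points(1)[OF p q] B ranges(6) B]
      DGs_add_arg[OF in_disc_points(2)[OF p q] B ranges(6) B] by simp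
  moreover have "Kop (?N h + ?N k) = Kop (?N h) + Kop (?N k)"
    by (rule Kop_add[OF N N ranges(8,9)])
  moreover have "Sop (?D (h + k) 0) = Sop (?D h 0) + Sop (?D k 0)"
    unfolding Sop_add[symmetric] by (simp add: Du_linear[OF q] plus_fun_def)
  ultimately show "inhom p (h + k) = inhom p h + inhom p k"
    unfolding inhom_def by (simp add: scaleR_add_left)
  have "?N (t *\<^sub>R h) = t *\<^sub>R ?N h"
    unfolding fst_scaleR Du_linear(2)[OF q] DGs_scaleR[OF in_disc_points(1)[OF p q] B ranges(6)]
      DGs_scaleR[OF in_disc_points(2)[OF p q] B ranges(6)] by (simp add: scaleR_diff_right)
  moreover have "Kop (t *\<^sub>R ?N h) = t *\<^sub>R Kop (?N h)" by (rule Kop_scaleR[OF N ranges(8,9)])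
  moreover have "Sop (?D (t *\<^sub>R h) 0) = t *\<^sub>R Sop (?D h 0)"
    unfolding Sop_scaleR[symmetric] by (simp add: Du_linear[OF q] scaleR_fun_def)
  ultimately show "inhom p (t *\<^sub>R h) = t *\<^sub>R inhom p h"
    unfolding inhom_def by (simp add: scaleR_diff_right scaleR_add_right)
qed

lemma dV_linear:
  assumes p: "p \<in> P" shows "dV p (h + k) = dV p h + dV p k" "dV p (t *\<^sub>R h) = t *\<^sub>R dV p h"
proof -
  note q = in_P(1)[OF p]
  note v = V_bd[OF p ranges(4)]
  let ?T = "\<lambda>x. Kop (DG (u (fst p) + V p) x)"
  obtain B where B: "\<And>h. bd (2 * \<sigma>1) (dV p h) (B * norm h)" using dV_bounded[OF p] by metis
  note D = DG_bd[OF u_bd[OF q] v R1_less ranges(3,4) B]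
  have "?T (dV p h + dV p k) = ?T (dV p h) + ?T (dV p k)"
    unfolding DGs_add_arg[OF in_disc_points(2)[OF p q] B ranges(11) B] by (rule Kop_add[OF D D ranges(3,4)])
  moreover have "dV p h + dV p k = (inhom p h + ?T (dV p h)) + (inhom p k + ?T (dV p k))"
    using dV_props(2)[OF p] by metis
  ultimately have "dV p h + dV p k = inhom p (h + k) + ?T (dV p h + dV p k)"
    unfolding inhom_linear(1)[OF p] by (simp only: add_ac)
  from linearized_unique[OF p B dV_props(2)[OF p] bd_add[OF B B] this]
  show "dV p (h + k) = dV p h + dV p k" .
  have "?T (t *\<^sub>R dV p h) = t *\<^sub>R ?T (dV p h)"
    unfolding DGs_scaleR[OF in_disc_points(2)[OF p q] B ranges(11)] by (rule Kop_scaleR[OF D ranges(3,4)])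
  moreover have "t *\<^sub>R dV p h = t *\<^sub>R (inhom p h + ?T (dV p h))"
    using dV_props(2)[OF p] by metis
  ultimately have "t *\<^sub>R dV p h = inhom p (t *\<^sub>R h) + ?T (t *\<^sub>R dV p h)"
    unfolding inhom_linear(2)[OF p] by (simp only: scaleR_add_right)
  from linearized_unique[OF p B dV_props(2)[OF p] bd_scaleR[OF B] this]
  show "dV p (t *\<^sub>R h) = t *\<^sub>R dV p h" .
qed

end

context corrector_family
begin

text \<open>
  The error \<open>V p' - V p - dV p (p' - p)\<close> solves the linearized equation up to the terms \<open>?X1\<close> to \<open>?X4\<close> and the
  error of \<open>Du\<close> in the boundary data. Those are products with two increments, or carry the small factor
  \<open>\<eta>\<close>. Counting exponents, \<open>?X1\<close> has \<open>2 * \<sigma>1 + 2 * \<sigma>1\<close>, \<open>?X2\<close> has \<open>- \<sigma>1 + 2 * \<sigma>1\<close>, \<open>?X3\<close> has \<open>4 * \<sigma>1 - 2 * \<sigma>1\<close>,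
  \<open>?X4\<close> has \<open>4 * \<sigma>1 - \<sigma>1\<close>; all are at least \<open>\<sigma>1\<close>, and \<open>?X2\<close> shows that no larger exponent can be reached
  in this way.
\<close>

lemma V_differentiable:
  assumes p: "p \<in> P" and e: "0 < e"
  obtains d where "0 < d" "\<And>p'. p' \<in> P \<Longrightarrow> norm (p' - p) < d \<Longrightarrow>
     bd \<sigma>1 (V p' - V p - dV p (p' - p)) (e * norm (p' - p))"
proof -
  note q = in_P(1)[OF p]
  obtain L d1 where L: "0 \<le> L" "0 < d1" and
    du: "\<And>p'. p' \<in> P \<Longrightarrow> norm (p' - p) < d1 \<Longrightarrow> bd (- \<sigma>1) (u (fst p') - u (fst p)) (L * norm (p' - p))" and
    dv: "\<And>p'. p' \<in> P \<Longrightarrow> norm (p' - p) < d1 \<Longrightarrow> bd (2 * \<sigma>1) (V p' - V p) (L * norm (p' - p))"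
    using V_lipschitz[OF p] by metis
  obtain B where B: "\<And>h. bd (2 * \<sigma>1) (dV p h) (B * norm h)" using dV_bounded[OF p] by metis
  obtain BD where BD: "\<And>h. bd (- \<sigma>1) (Du (fst p) h) (BD * norm h)" using Du_bounded[OF q] by metis
  \<comment> \<open>The final estimate is \<open>2 * (\<eta> * K1 + k * K2)\<close> times the increment, with \<open>k\<close> the distance of the parameters.\<close>
  define K1 where "K1 = 1 + CKc * (MM * R1)"
  define K2 where "K2 = CKc * (MM * (L * L + L * L + R1 * (L * L)))"
  have K: "1 \<le> K1" "0 \<le> K2"
    using L CK_ge(3) MM_nonneg R1_nonneg[OF p] by (simp_all add: K1_def K2_def)
  define \<eta> where "\<eta> = e / (4 * K1)"
  have \<eta>: "0 < \<eta>" "\<eta> * K1 = e / 4" using e K by (simp_all add: \<eta>_def)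
  obtain d2 where d2: "0 < d2" and rem: "\<And>q'. norm q' \<le> c0 \<Longrightarrow> norm (q' - fst p) < d2 \<Longrightarrow>
     bd (- \<sigma>1) (u q' - u (fst p) - Du (fst p) (q' - fst p)) (\<eta> * norm (q' - fst p))"
    using u_remainder[OF q \<eta>(1)] by metis
  define d where "d = min (min d1 d2) (e / (4 * (K2 + 1)))"
  have d: "0 < d" "d \<le> d1" "d \<le> d2" "d \<le> e / (4 * (K2 + 1))" using L d2 e K by (simp_all add: d_def)
  show thesis
  proof (rule that[OF d(1)])
    fix p' assume p': "p' \<in> P" and near: "norm (p' - p) < d"
    note q' = in_P(1)[OF p']
    define k where "k = norm (p' - p)"
    let ?h = "p' - p"
    define u1 where "u1 = u (fst p)"
    define u2 where "u2 = u (fst p')"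
    define v1 where "v1 = V p"
    define v2 where "v2 = V p'"
    define D where "D = Du (fst p) (fst p' - fst p)"
    define z where "z = dV p ?h"
    have k: "0 \<le> k" by (simp add: k_def)
    have near1: "norm (p' - p) < d1" using near d by simp
    have pts: "in_disc u1" "in_disc u2" "in_disc (u1 + v1)" "in_disc (u2 + v1)" "in_disc (u2 + v2)"
      unfolding u1_def u2_def v1_def v2_def
      using in_disc_points[OF p q] in_disc_points[OF p q'] in_disc_points[OF p' q'] by blast+
    have DU: "bd (- \<sigma>1) (u2 - u1) (L * k)" and DVb: "bd (2 * \<sigma>1) (v2 - v1) (L * k)"
      using du[OF p' near1] dv[OF p' near1] by (simp_all add: u1_def u2_def v1_def v2_def k_def)
    have DD: "bd (- \<sigma>1) (u2 - u1 - D) (\<eta> * k)"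
      unfolding u1_def u2_def D_def k_def
    proof (rule bd_mono[OF rem[OF q']])
      show "norm (fst p' - fst p) < d2" using norm_fst_snd(1)[of p' p] near d by linarith
      show "\<eta> * norm (fst p' - fst p) \<le> \<eta> * norm (p' - p)" using \<eta> by (intro mult_left_mono norm_fst_snd) simp
    qed
    have Db: "bd (- \<sigma>1) D (BD * norm (fst p' - fst p))" unfolding D_def by (rule BD)
    have zb: "bd (2 * \<sigma>1) z (B * k)" unfolding z_def k_def by (rule B)
    have v0: "bd \<sigma>0 v1 R1" unfolding v1_def by (rule V_props(4)[OF p])
    have u0: "bd 0 u1 c1" "bd 0 u2 c1" unfolding u1_def u2_def by (rule u_bd[OF q], rule u_bd[OF q'])
    have v1': "bd \<sigma>1 v1 R1" "bd \<sigma>1 v2 R1" unfolding v1_def v2_def by (rule V_bd[OF p ranges(2)], rule V_bd[OF p' ranges(2)])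
    have dv1: "bd \<sigma>1 (v2 - v1) (L * k)" by (rule bd_exponent_mono[OF DVb ranges(3)])
    have z1: "bd \<sigma>1 z (B * k)" by (rule bd_exponent_mono[OF zb ranges(3)])
    let ?W = "(G (u2 + v2) - G u2) - (G (u1 + v1) - G u1)"
    let ?N = "DG (u1 + v1) D - DG u1 D"
    let ?M = "DG (u1 + v1) z"
    let ?X1 = "G (u2 + v2) - G (u2 + v1) - DG (u2 + v1) (v2 - v1)"
    let ?X2 = "DG (u2 + v1) (v2 - v1) - DG (u1 + v1) (v2 - v1)"
    let ?X3 = "(G (u2 + v1) - G (u1 + v1) - DG (u1 + v1) (u2 - u1)) - (G u2 - G u1 - DG u1 (u2 - u1))"
    let ?X4 = "DG (u1 + v1) (u2 - u1 - D) - DG u1 (u2 - u1 - D)"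
    let ?X5 = "DG (u1 + v1) (v2 - v1 - z)"
    have X1: "bd \<sigma>1 ?X1 (MM * ((L * k) * (L * k)))"
    proof (rule bd_exponent_mono)
      show "bd (2 * \<sigma>1 + 2 * \<sigma>1) ?X1 (MM * ((L * k) * (L * k)))"
        using Gs_remainder_bd[OF pts(4,5), of "2 * \<sigma>1" "L * k"] DVb ranges(11) by simp
    qed (use ranges in simp)
    have X2: "bd \<sigma>1 ?X2 (MM * ((L * k) * (L * k)))"
    proof (rule bd_exponent_mono)
      show "bd (- \<sigma>1 + 2 * \<sigma>1) ?X2 (MM * ((L * k) * (L * k)))"
        by (rule DGs_diff_bd[OF pts(3,4) _ ranges(6) DVb ranges(11)]) (use DU in simp)
    qed simp
    have X3: "bd \<sigma>1 ?X3 (MM * (R1 * ((L * k) * (L * k))))"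
    proof (rule bd_exponent_mono)
      show "bd (\<sigma>0 + (- \<sigma>1 + - \<sigma>1)) ?X3 (MM * (R1 * ((L * k) * (L * k))))"
        by (rule Gs_remainder_diff_bd[OF pts(1-4) DU ranges(6) v0 ranges(7)])
    qed (use sigma_props in simp)
    have X4: "bd \<sigma>1 ?X4 (MM * (R1 * (\<eta> * k)))"
      unfolding u1_def v1_def
      by (rule bd_exponent_mono[OF DG_difference_bd[OF p _ q] ranges(8)]) (use DD in \<open>simp add: u1_def\<close>)
    have X5: "?X5 = DG (u1 + v1) (v2 - v1) - DG (u1 + v1) z"
      by (rule DGs_diff_arg[OF pts(3) dv1 ranges(12) z1])
    have X4': "?X4 = (DG (u1 + v1) (u2 - u1) - DG (u1 + v1) D) - (DG u1 (u2 - u1) - DG u1 D)"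
      unfolding DGs_diff_arg[OF pts(3) DU ranges(6) Db] DGs_diff_arg[OF pts(1) DU ranges(6) Db] ..
    have split: "?W - ?N - ?M = (?X1 + ?X2 + ?X3 + ?X4) + ?X5"
      unfolding X5 X4' by (rule corrector_remainder_split)
    let ?Z = "?X1 + ?X2 + ?X3 + ?X4"
    define s where "s = MM * ((L * k) * (L * k)) + MM * ((L * k) * (L * k)) + MM * (R1 * ((L * k) * (L * k))) + MM * (R1 * (\<eta> * k))"
    have Z: "bd \<sigma>1 ?Z s"
      unfolding s_def by (intro bd_add X1 X2 X3 X4)
    have Wb: "bd \<sigma>1 ?W (CF * c1 * R1 + CF * c1 * R1)"
      by (intro bd_diff Y_bd[OF u0(2) v1'(2) R1_less ranges(1,2)] Y_bd[OF u0(1) v1'(1) R1_less ranges(1,2)])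
    have Nb: "bd \<sigma>1 ?N (MM * (R1 * (BD * norm (fst p' - fst p))))"
      unfolding u1_def v1_def by (rule bd_exponent_mono[OF DG_difference_bd[OF p Db q] ranges(8)])
    have Mb: "bd \<sigma>1 ?M (CF * c1 * (B * k))"
      by (rule DG_bd[OF u0(1) v1'(1) R1_less ranges(1,2) z1])
    have ez: "bd \<sigma>1 (v2 - v1 - z) (L * k + B * k)" by (rule bd_diff[OF dv1 z1])
    have X5b: "bd \<sigma>1 ?X5 (CF * c1 * (L * k + B * k))"
      by (rule DG_bd[OF u0(1) v1'(1) R1_less ranges(1,2) ez])
    have "Kop ?W - Kop ?N - Kop ?M = Kop (?W - ?N - ?M)"
      unfolding Kop_diff[OF bd_diff[OF Wb Nb] Mb ranges(1,2)] Kop_diff[OF Wb Nb ranges(1,2)] ..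
    also have "\<dots> = Kop ?Z + Kop ?X5"
      unfolding split by (rule Kop_add[OF Z X5b ranges(1,2)])
    finally have KW: "Kop ?W - Kop ?N - Kop ?M = Kop ?Z + Kop ?X5" .
    have vd: "v2 - v1 = (snd p' - snd p) *\<^sub>R Sop b - Sop ((u2 - u1) 0) + Kop ?W"
      unfolding u1_def u2_def v1_def v2_def by (rule V_difference[OF p p'])
    have zd: "z = (snd p' - snd p) *\<^sub>R Sop b - Sop (D 0) + Kop ?N + Kop ?M"
      using dV_props(2)[OF p, of ?h] by (simp add: z_def[symmetric] inhom_def u1_def v1_def D_def)
    have Sd: "Sop ((u2 - u1) 0) - Sop (D 0) = Sop ((u2 - u1 - D) 0)"
      unfolding Sop_diff[symmetric] by (simp add: fun_diff_def)
    have arith: "(a - x + w) - (a - y + n + m) = - (x - y) + (w - n - m)" for a x y w n m :: seq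
      by (simp add: algebra_simps)
    have "v2 - v1 - z = - (Sop ((u2 - u1) 0) - Sop (D 0)) + (Kop ?W - Kop ?N - Kop ?M)"
      by (subst vd, subst zd) (rule arith)
    then have eq: "v2 - v1 - z = - Sop ((u2 - u1 - D) 0) + (Kop ?Z + Kop ?X5)"
      unfolding KW Sd .
    have "bd \<sigma>1 (v2 - v1 - z) (2 * (\<eta> * k + CKc * s))"
    proof (rule quarter_bound[OF ez])
      fix t assume t: "bd \<sigma>1 (v2 - v1 - z) t"
      have "bd \<sigma>1 (- Sop ((u2 - u1 - D) 0) + (Kop ?Z + Kop ?X5)) (\<eta> * k + (CKc * s + t / 4))"
      proof (intro bd_add bd_uminus)
        show "bd \<sigma>1 (Sop ((u2 - u1 - D) 0)) (\<eta> * k)"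
          by (rule bd_exponent_mono[OF Sop_row_bd[OF DD] ranges(2)])
        show "bd \<sigma>1 (Kop ?Z) (CKc * s)" by (rule Kop_bd[OF Z ranges(1,2)])
        show "bd \<sigma>1 (Kop ?X5) (t / 4)" by (rule Kop_DG_contracts[OF u0(1) v1'(1) R1_less ranges(1,2) t])
      qed
      then show "bd \<sigma>1 (v2 - v1 - z) (\<eta> * k + CKc * s + t / 4)"
        unfolding eq[symmetric] by (rule bd_mono) simp
    qed
    moreover have "2 * (\<eta> * k + CKc * s) \<le> e * k"
    proof -
      have "\<eta> * k + CKc * s = k * (\<eta> * K1 + k * K2)"
        unfolding s_def K1_def K2_def by (simp add: algebra_simps)
      moreover have "k * K2 \<le> e / 4"
      proof -
        have "k * K2 \<le> (e / (4 * (K2 + 1))) * (K2 + 1)"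
          using near d(4) K e k unfolding k_def[symmetric] by (intro mult_mono) simp_all
        also have "\<dots> = e / 4" using K by (simp add: field_simps)
        finally show ?thesis .
      qed
      ultimately have "\<eta> * k + CKc * s \<le> k * (e / 4 + e / 4)"
        using \<eta>(2) k mult_left_mono[of "\<eta> * K1 + k * K2" "e / 4 + e / 4" k] by linarith
      then show ?thesis by (simp add: mult.commute)
    qed
    ultimately have "bd \<sigma>1 (v2 - v1 - z) (e * k)" by (rule bd_mono)
    then show "bd \<sigma>1 (V p' - V p - dV p (p' - p)) (e * norm (p' - p))"
      by (simp only: v1_def v2_def z_def k_def)
  qed
qed

text \<open>
  The difference of the derivatives at \<open>p'\<close> and \<open>p\<close> solves the linearized equation at \<open>p'\<close>. Its inhomogeneity
  collects the change of \<open>inhom\<close> and the change \<open>?E\<close> of the operator, applied to the old derivative; the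
  latter is a product with exponents \<open>- \<sigma>1\<close> and \<open>2 * \<sigma>1\<close>.
\<close>

lemma dV_continuous:
  assumes p: "p \<in> P" and e: "0 < e"
  obtains d where "0 < d" "\<And>p' h. p' \<in> P \<Longrightarrow> norm (p' - p) < d \<Longrightarrow> bd \<sigma>1 (dV p' h - dV p h) (e * norm h)"
proof -
  note q = in_P(1)[OF p]
  obtain L d1 where L: "0 \<le> L" "0 < d1" and
    du: "\<And>p'. p' \<in> P \<Longrightarrow> norm (p' - p) < d1 \<Longrightarrow> bd (- \<sigma>1) (u (fst p') - u (fst p)) (L * norm (p' - p))" and
    dv: "\<And>p'. p' \<in> P \<Longrightarrow> norm (p' - p) < d1 \<Longrightarrow> bd (2 * \<sigma>1) (V p' - V p) (L * norm (p' - p))"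
    using V_lipschitz[OF p] by metis
  obtain B where B: "0 \<le> B" "\<And>h. bd (2 * \<sigma>1) (dV p h) (B * norm h)" using dV_bounded[OF p] by metis
  obtain BD where BD: "0 \<le> BD" "\<And>h. bd (- \<sigma>1) (Du (fst p) h) (BD * norm h)" using Du_bounded[OF q] by metis
  \<comment> \<open>The final estimate is \<open>2 * (\<eta> * K1 + k * K2)\<close> times the norm of the direction, with \<open>k\<close> as before.\<close>
  define K1 where "K1 = 1 + CKc * (MM * R1)"
  define K2 where "K2 = CKc * (MM * (L * BD + R1 * L * BD + (L + L) * B))"
  have K: "1 \<le> K1" "0 \<le> K2"
    using L B(1) BD(1) CK_ge(3) MM_nonneg R1_nonneg[OF p] by (simp_all add: K1_def K2_def)
  define \<eta> where "\<eta> = e / (4 * K1)"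
  have \<eta>: "0 < \<eta>" "\<eta> * K1 = e / 4" using e K by (simp_all add: \<eta>_def)
  obtain d2 where d2: "0 < d2" and Dc: "\<And>q' h. norm q' \<le> c0 \<Longrightarrow> norm (q' - fst p) < d2 \<Longrightarrow>
     bd (- \<sigma>1) (Du q' h - Du (fst p) h) (\<eta> * norm h)"
    using Du_continuous[OF q \<eta>(1)] by metis
  define d where "d = min (min d1 d2) (e / (4 * (K2 + 1)))"
  have d: "0 < d" "d \<le> d1" "d \<le> d2" "d \<le> e / (4 * (K2 + 1))" using L d2 e K by (simp_all add: d_def)
  show thesis
  proof (rule that[OF d(1)])
    fix p' and h :: "'q \<times> real" assume p': "p' \<in> P" and near: "norm (p' - p) < d"
    note q' = in_P(1)[OF p']
    define k where "k = norm (p' - p)"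
    define nh where "nh = norm h"
    define u1 where "u1 = u (fst p)"
    define u2 where "u2 = u (fst p')"
    define v1 where "v1 = V p"
    define v2 where "v2 = V p'"
    define D1 where "D1 = Du (fst p) (fst h)"
    define D2 where "D2 = Du (fst p') (fst h)"
    define x1 where "x1 = dV p h"
    define x2 where "x2 = dV p' h"
    have k: "0 \<le> k" "0 \<le> nh" by (simp_all add: k_def nh_def)
    have near1: "norm (p' - p) < d1" using near d by simp
    have pts: "in_disc u1" "in_disc u2" "in_disc (u1 + v1)" "in_disc (u2 + v1)" "in_disc (u2 + v2)"
      unfolding u1_def u2_def v1_def v2_def
      using in_disc_points[OF p q] in_disc_points[OF p q'] in_disc_points[OF p' q'] by blast+
    have DU: "bd (- \<sigma>1) (u2 - u1) (L * k)" and DVb: "bd (2 * \<sigma>1) (v2 - v1) (L * k)"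
      using du[OF p' near1] dv[OF p' near1] by (simp_all add: u1_def u2_def v1_def v2_def k_def)
    have D1b: "bd (- \<sigma>1) D1 (BD * nh)" unfolding D1_def nh_def
      by (rule bd_mono[OF BD(2)]) (intro mult_left_mono norm_fst_snd_le BD(1))
    have DD: "bd (- \<sigma>1) (D2 - D1) (\<eta> * nh)"
      unfolding D1_def D2_def nh_def
    proof (rule bd_mono[OF Dc[OF q']])
      show "norm (fst p' - fst p) < d2" using norm_fst_snd(1)[of p' p] near d by linarith
      show "\<eta> * norm (fst h) \<le> \<eta> * norm h" using \<eta> by (intro mult_left_mono norm_fst_snd_le) simp
    qed
    have D2b: "bd (- \<sigma>1) D2 (\<eta> * nh + BD * nh)" using bd_add[OF DD D1b] by simp
    have x1b: "bd (2 * \<sigma>1) x1 (B * nh)" unfolding x1_def nh_def by (rule B(2))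
    obtain t2 where x2b: "bd (2 * \<sigma>1) x2 t2" unfolding x2_def using dV_props(1)[OF p'] by blast
    have x11: "bd \<sigma>1 x1 (B * nh)" "bd \<sigma>1 x2 t2"
      by (rule bd_exponent_mono[OF x1b ranges(3)], rule bd_exponent_mono[OF x2b ranges(3)])
    have u0: "bd 0 u1 c1" "bd 0 u2 c1" unfolding u1_def u2_def by (rule u_bd[OF q], rule u_bd[OF q'])
    have v0: "bd \<sigma>0 v1 R1" unfolding v1_def by (rule V_props(4)[OF p])
    have v1': "bd \<sigma>1 v1 R1" "bd \<sigma>1 v2 R1" unfolding v1_def v2_def by (rule V_bd[OF p ranges(2)], rule V_bd[OF p' ranges(2)])
    let ?N1 = "DG (u1 + v1) D1 - DG u1 D1" and ?N2 = "DG (u2 + v2) D2 - DG u2 D2"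
    let ?Q1 = "DG (u2 + v2) (D2 - D1) - DG u2 (D2 - D1)"
    let ?Q2 = "DG (u2 + v2) D1 - DG (u2 + v1) D1"
    let ?Q3 = "(DG (u2 + v1) D1 - DG u2 D1) - (DG (u1 + v1) D1 - DG u1 D1)"
    let ?E = "DG (u2 + v2) x1 - DG (u1 + v1) x1"
    have Q1: "bd \<sigma>1 ?Q1 (MM * (R1 * (\<eta> * nh)))"
      unfolding u2_def v2_def by (rule bd_exponent_mono[OF DG_difference_bd[OF p' DD q'] ranges(8)])
    have Q2: "bd \<sigma>1 ?Q2 (MM * ((L * k) * (BD * nh)))"
    proof (rule bd_exponent_mono)
      show "bd (2 * \<sigma>1 + - \<sigma>1) ?Q2 (MM * ((L * k) * (BD * nh)))"
        by (rule DGs_diff_bd[OF pts(4,5) _ ranges(11) D1b ranges(6)]) (use DVb in simp)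
    qed simp
    have Q3: "bd \<sigma>1 ?Q3 (MM * (R1 * (L * k) * (BD * nh)))"
    proof (rule bd_exponent_mono)
      show "bd (\<sigma>0 + - \<sigma>1 + - \<sigma>1) ?Q3 (MM * (R1 * (L * k) * (BD * nh)))"
        by (rule DGs_mixed_bd[OF pts(1-4) DU ranges(6) v0 ranges(7) D1b ranges(6)])
    qed (use sigma_props in simp)
    have E: "bd \<sigma>1 ?E (MM * ((L * k + L * k) * (B * nh)))"
    proof (rule bd_exponent_mono)
      have "bd (- \<sigma>1) ((u2 - u1) + (v2 - v1)) (L * k + L * k)"
        by (rule bd_add[OF DU bd_exponent_mono[OF DVb ranges(14)]])
      moreover have "(u2 - u1) + (v2 - v1) = (u2 + v2) - (u1 + v1)" by simp
      ultimately have "bd (- \<sigma>1) ((u2 + v2) - (u1 + v1)) (L * k + L * k)" by (simp only:)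
      then show "bd (- \<sigma>1 + 2 * \<sigma>1) ?E (MM * ((L * k + L * k) * (B * nh)))"
        by (rule DGs_diff_bd[OF pts(3,5) _ ranges(6) x1b ranges(11)])
    qed simp
    define s where "s = \<eta> * nh + CKc * (MM * (R1 * (\<eta> * nh)) + MM * ((L * k) * (BD * nh)) + MM * (R1 * (L * k) * (BD * nh)))
       + CKc * (MM * ((L * k + L * k) * (B * nh)))"
    have Qsplit: "?N2 - ?N1 = ?Q1 + ?Q2 + ?Q3"
      unfolding DGs_diff_arg[OF pts(5) D2b ranges(6) D1b] DGs_diff_arg[OF pts(2) D2b ranges(6) D1b] by simp
    have N1b: "bd \<sigma>1 ?N1 (MM * (R1 * (BD * nh)))" and N2b: "bd \<sigma>1 ?N2 (MM * (R1 * (\<eta> * nh + BD * nh)))"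
      unfolding u1_def v1_def u2_def v2_def
      by (rule bd_exponent_mono[OF DG_difference_bd[OF p D1b q] ranges(8)],
          rule bd_exponent_mono[OF DG_difference_bd[OF p' D2b q'] ranges(8)])
    define y where "y = - Sop ((D2 - D1) 0) + Kop (?Q1 + ?Q2 + ?Q3) + Kop ?E"
    have y: "bd \<sigma>1 y s"
      unfolding y_def s_def
      by (intro bd_add bd_uminus bd_exponent_mono[OF Sop_row_bd[OF DD] ranges(2)] Kop_bd[OF _ ranges(1,2)] Q1 Q2 Q3 E)
    note DGx = DG_bd[OF u0(2) v1'(2) R1_less ranges(1,2)]
    have "x2 - x1 = y + Kop (DG (u2 + v2) (x2 - x1))"
    proof -
      have e1: "x1 = snd h *\<^sub>R Sop b - Sop (D1 0) + Kop ?N1 + Kop (DG (u1 + v1) x1)"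
        using dV_props(2)[OF p, of h] by (simp add: x1_def[symmetric] inhom_def u1_def v1_def D1_def)
      have e2: "x2 = snd h *\<^sub>R Sop b - Sop (D2 0) + Kop ?N2 + Kop (DG (u2 + v2) x2)"
        using dV_props(2)[OF p', of h] by (simp add: x2_def[symmetric] inhom_def u2_def v2_def D2_def)
      have "Kop ?N2 - Kop ?N1 = Kop (?Q1 + ?Q2 + ?Q3)"
        unfolding Qsplit[symmetric] by (rule Kop_diff[OF N2b N1b ranges(1,2), symmetric])
      moreover have "Kop (DG (u2 + v2) x2) - Kop (DG (u2 + v2) x1) = Kop (DG (u2 + v2) (x2 - x1))"
        unfolding DGs_diff_arg[OF pts(5) x11(2) ranges(12) x11(1)]
        by (rule Kop_diff[OF DGx[OF x11(2)] DGx[OF x11(1)] ranges(1,2), symmetric])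
      moreover have "Kop (DG (u2 + v2) x1) - Kop (DG (u1 + v1) x1) = Kop ?E"
        by (rule Kop_diff[OF DGx[OF x11(1)] DG_bd[OF u0(1) v1'(1) R1_less ranges(1,2) x11(1)] ranges(1,2), symmetric])
      moreover have "Sop (D2 0) - Sop (D1 0) = Sop ((D2 - D1) 0)"
        unfolding Sop_diff[symmetric] by (simp add: fun_diff_def)
      moreover have "(a - s2 + n2 + m2) - (a - s1 + n1 + m1) = - (s2 - s1) + (n2 - n1) + (m - m1) + (m2 - m)"
        for a s1 s2 n1 n2 m1 m2 m :: seq by (simp add: algebra_simps)
      moreover have "x2 - x1 = (snd h *\<^sub>R Sop b - Sop (D2 0) + Kop ?N2 + Kop (DG (u2 + v2) x2))
          - (snd h *\<^sub>R Sop b - Sop (D1 0) + Kop ?N1 + Kop (DG (u1 + v1) x1))"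
        using e1 e2 by (simp only: e1[symmetric] e2[symmetric])
      ultimately show ?thesis unfolding y_def by metis
    qed
    from linearized_bound[OF p' ranges(1,2) bd_diff[OF x11(2,1)] this[unfolded u2_def v2_def] y]
    have "bd \<sigma>1 (x2 - x1) (2 * s)" .
    moreover have "2 * s \<le> e * nh"
    proof -
      have "s = nh * (\<eta> * K1 + k * K2)"
        unfolding s_def K1_def K2_def by (simp add: algebra_simps)
      moreover have "k * K2 \<le> e / 4"
      proof -
        have "k * K2 \<le> (e / (4 * (K2 + 1))) * (K2 + 1)"
          using near d(4) K e k unfolding k_def[symmetric] by (intro mult_mono) simp_all
        also have "\<dots> = e / 4" using K by (simp add: field_simps)
        finally show ?thesis .
      qed
      ultimately have "s \<le> nh * (e / 4 + e / 4)"
        using \<eta>(2) k mult_left_mono[of "\<eta> * K1 + k * K2" "e / 4 + e / 4" nh] by linarith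
      then show ?thesis by (simp add: mult.commute)
    qed
    ultimately have "bd \<sigma>1 (x2 - x1) (e * nh)" by (rule bd_mono)
    then show "bd \<sigma>1 (dV p' h - dV p h) (e * norm h)" by (simp only: x1_def x2_def nh_def)
  qed
qed

lemma V_C1: "C1_map euclid (Lsp \<sigma>1 w) P V"
  unfolding C1_map_def C1_deriv_def
proof (intro exI[of _ dV] conjI ballI allI impI)
  fix p assume p: "p \<in> P"
  show "V p \<in> vecs (Lsp \<sigma>1 w)" using V_bd[OF p ranges(2)] by (simp add: bd_iff)
  obtain B where "\<And>h. bd (2 * \<sigma>1) (dV p h) (B * norm h)" using dV_bounded[OF p] by metis
  then have B: "\<And>h. bd \<sigma>1 (dV p h) (B * norm h)" using bd_exponent_mono ranges(3) by blast
  show "has_fderiv euclid (Lsp \<sigma>1 w) P V (dV p) p"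
    unfolding has_fderiv_def
  proof (intro conjI allI impI)
    show "dV p \<in> vecs (blinop euclid (Lsp \<sigma>1 w))"
      using B unfolding blinop_def euclid_def bd_iff 
      by (simp add: dV_linear[OF p] del: split_paired_All) blast
    fix e :: real assume "0 < e"
    then obtain d where "0 < d" "\<And>p'. p' \<in> P \<Longrightarrow> norm (p' - p) < d \<Longrightarrow>
       bd \<sigma>1 (V p' - V p - dV p (p' - p)) (e * norm (p' - p))" using V_differentiable[OF p] by metis
    then show "\<exists>d>0. \<forall>y\<in>P. nrm euclid (y - p) < d \<longrightarrow>
        nrm (Lsp \<sigma>1 w) (V y - V p - dV p (y - p)) \<le> e * nrm euclid (y - p)"
      unfolding nrm_euclid bd_iff by blast
  qed
  fix e :: real assume e: "0 < e"
  then have "0 < e / 2" by simp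
  then obtain d where d: "0 < d" "\<And>p' h. p' \<in> P \<Longrightarrow> norm (p' - p) < d \<Longrightarrow> bd \<sigma>1 (dV p' h - dV p h) (e / 2 * norm h)"
    using dV_continuous[OF p] by metis
  have "nrm (blinop euclid (Lsp \<sigma>1 w)) (dV p' - dV p) < e" if p': "p' \<in> P" "norm (p' - p) < d" for p'
  proof -
    have "nrm (blinop euclid (Lsp \<sigma>1 w)) (dV p' - dV p) =
        (SUP h\<in>{h. norm h \<le> 1}. nrm (Lsp \<sigma>1 w) (dV p' h - dV p h))"
      by (simp add: blinop_def euclid_def)
    also have "\<dots> \<le> e / 2"
    proof (rule cSUP_least)
      have "(0 :: 'q \<times> real) \<in> {h. norm h \<le> 1}" by simp
      then show "{h :: 'q \<times> real. norm h \<le> 1} \<noteq> {}" by blast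
      fix h :: "'q \<times> real" assume h: "h \<in> {h. norm h \<le> 1}"
      have "nrm (Lsp \<sigma>1 w) (dV p' h - dV p h) \<le> e / 2 * norm h"
        using d(2)[OF p', of h] by (simp only: bd_iff)
      also have "\<dots> \<le> e / 2 * 1" using h e by (intro mult_left_mono) simp_all
      finally show "nrm (Lsp \<sigma>1 w) (dV p' h - dV p h) \<le> e / 2" by simp
    qed
    finally show ?thesis using e by simp
  qed
  then show "\<exists>d>0. \<forall>y\<in>P. nrm euclid (y - p) < d \<longrightarrow> nrm (blinop euclid (Lsp \<sigma>1 w)) (dV y - dV p) < e"
    unfolding nrm_euclid using d(1) by blast
qed

end

theorem theorem18:
  fixes c \<gamma> CF c0 C0 c1 r :: real
    and F :: "real \<Rightarrow> real"
    and w :: "int \<Rightarrow> real"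
    and b :: "int \<Rightarrow> complex"
    and u :: "real ^ 'n \<Rightarrow> seq"
  assumes "\<exists>U. open U \<and> - c \<in> U \<and> real_analytic_on F U"
    and "deriv F (- c) > 0"
    and "\<gamma> > 0"
    and "\<forall>m::int. (of_int m * \<gamma>)\<^sup>2 / deriv F (- c) \<noteq> 4"
    and "admissible_weight w"
    and "((\<lambda>m. w m * cmod (b m)) has_sum 1) UNIV"
    and "\<forall>m. b (- m) = cnj (b m)"
    and "CF_const F c w CF"
    and "c0 > 0" and "C0 > 1"
    and "c1 = c1const F c \<gamma> CF"
    and "\<forall>q. norm q \<le> c0 \<longrightarrow> u q \<in> vecs (Lsp 0 w)"
    and "\<forall>q. norm q \<le> c0 \<longrightarrow> nrm (Lsp 0 w) (u q) \<le> c1 \<and> rho_u F c \<gamma> w (u q) \<le> c1 / 4"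
    and "\<exists>Du. C1_deriv euclid (Lsp (- sigma1 F c \<gamma>) w) {q. norm q \<le> c0} u Du \<and>
           (\<forall>q j. norm q \<le> c0 \<longrightarrow> nrm (Lsp (- sigma1 F c \<gamma>) w) (Du q (axis j 1)) \<le> C0)"
    and "\<forall>q n m. norm q \<le> c0 \<longrightarrow> u q n (- m) = cnj (u q n m)"
    and "r = min c0 (c1 / (4 * C0))"
  shows "\<exists>V :: (real ^ 'n) \<times> real \<Rightarrow> seq.
           (\<forall>q \<epsilon>. norm q \<le> r \<and> \<bar>\<epsilon>\<bar> \<le> r \<longrightarrow>
              (\<exists>!v. is_corrector F c \<gamma> w b CF (u q) \<epsilon> v) \<and>
              is_corrector F c \<gamma> w b CF (u q) \<epsilon> (V (q, \<epsilon>)) \<and>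
              (\<forall>n m. V (q, \<epsilon>) n (- m) = cnj (V (q, \<epsilon>) n m))) \<and>
           C1_map euclid (Lsp (sigma1 F c \<gamma>) w) {(q, \<epsilon>). norm q \<le> r \<and> \<bar>\<epsilon>\<bar> \<le> r} V"
proof -
  from assms(14) obtain Du where Du: "C1_deriv euclid (Lsp (- sigma1 F c \<gamma>) w) {q. norm q \<le> c0} u Du"
    by blast
  interpret corrector w F c CF \<gamma>
    by unfold_locales (use assms(1-5,8) in simp_all)
  have "c1 / (4 * C0) < c1 / (4 * 1)"
    using c1_props(1) assms(10,11) by (intro divide_strict_left_mono) simp_all
  then have "r < c1 / 4" using assms(16) by simp
  then interpret corrector_family w F c CF \<gamma> b c0 r u Du
    by unfold_locales (use assms Du in \<open>auto simp: csym_def bd_iff\<close>)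
  have mem: "(q :: real ^ 'n, \<epsilon>) \<in> P \<longleftrightarrow> norm q \<le> r \<and> \<bar>\<epsilon>\<bar> \<le> r" for q \<epsilon>
    by (simp add: P_def)
  show ?thesis
  proof (intro exI[of _ V] conjI allI impI)
    fix q :: "real ^ 'n" and \<epsilon> assume "norm q \<le> r \<and> \<bar>\<epsilon>\<bar> \<le> r"
    then have p: "(q, \<epsilon>) \<in> P" by (simp add: mem)
    show "\<exists>!v. is_corrector F c \<gamma> w b CF (u q) \<epsilon> v" using V_props(1)[OF p] by simp
    show "is_corrector F c \<gamma> w b CF (u q) \<epsilon> (V (q, \<epsilon>))" using V_props(2)[OF p] by simp
    show "V (q, \<epsilon>) n (- m) = cnj (V (q, \<epsilon>) n m)" for n m
      using V_props(3)[OF p] by (simp add: csym_def)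
  next
    show "C1_map euclid (Lsp (sigma1 F c \<gamma>) w) {(q, \<epsilon>). norm q \<le> r \<and> \<bar>\<epsilon>\<bar> \<le> r} V"
      using V_C1 by (simp add: P_def)
  qed
qed

end
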